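(* Let $f$ be a transcendental entire function on $\mathbb{C}_p$. Then the set $\{a\in\mathbb{C}_p : f(x)(x-a) \text{ is not prime}\}$ is at most countable.
   Context: $p$ is a prime number and $\mathbb{C}_p$ is the completion of an algebraic closure of the field $\mathbb{Q}_p$ of $p$-adic numbers, with the usual $p$-adic absolute value. $\mathcal{A}(\mathbb{C}_p)$ is the algebra of entire functions on $\mathbb{C}_p$ (power series over $\mathbb{C}_p$ converging on all of $\mathbb{C}_p$), and $\mathcal{M}(\mathbb{C}_p)$, the field of meromorphic functions in $\mathbb{C}_p$, is its field of fractions. An entire function is transcendental if it is not a polynomial. A linear rational function is one of the form $(ax+b)/(cx+d)$ with $ad-bc\neq0$. A function $F\in\mathcal{M}(\mathbb{C}_p)$ is prime if every factorization $F=f\circ g$ with $f,g\in\mathcal{M}(\mathbb{C}_p)$ implies that $f$ or $g$ is a linear rational function. *)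

theory Defs
  imports
    "HOL-Analysis.Abstract_Metric_Spaces"
    "HOL-Computational_Algebra.Polynomial_FPS"
    "HOL-Computational_Algebra.Formal_Laurent_Series"
begin

section \<open>The field of \<open>p\<close>-adic complex numbers\<close>

locale nonarch_absolute_value =
  fixes absv :: "'a::field \<Rightarrow> real"
  assumes absv_nonneg: "0 \<le> absv x"
    and absv_eq_0_iff: "absv x = 0 \<longleftrightarrow> x = 0"
    and absv_mult: "absv (x * y) = absv x * absv y"
    and absv_add_le_max: "absv (x + y) \<le> max (absv x) (absv y)"

definition absv_dist :: "('a::field \<Rightarrow> real) \<Rightarrow> 'a \<Rightarrow> 'a \<Rightarrow> real" where
  "absv_dist absv x y = absv (x - y)"

abbreviation absv_topology :: "('a::field \<Rightarrow> real) \<Rightarrow> 'a topology" where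
  "absv_topology absv \<equiv> Metric_space.mtopology UNIV (absv_dist absv)"

lemma (in nonarch_absolute_value) Metric_space_absv_dist:
  "Metric_space UNIV (absv_dist absv)"
proof
  fix x y z :: 'a
  have "absv 1 = absv 1 * absv 1" "absv 1 = absv (-1) * absv (-1)"
    using absv_mult[of 1 1] absv_mult[of "-1" "-1"] by simp_all
  moreover have "absv 1 \<noteq> 0" by (simp add: absv_eq_0_iff)
  ultimately have "absv (-1) = 1"
    using absv_nonneg[of "-1"] by (simp add: square_eq_1_iff)
  then have minus: "absv (- u) = absv u" for u
    using absv_mult[of "-1" u] by simp
  show "0 \<le> absv_dist absv x y"
    by (simp add: absv_dist_def absv_nonneg)
  show "absv_dist absv x y = absv_dist absv y x"
    using minus[of "x - y"] by (simp add: absv_dist_def)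
  show "absv_dist absv x y = 0 \<longleftrightarrow> x = y"
    by (simp add: absv_dist_def absv_eq_0_iff)
  show "absv_dist absv x z \<le> absv_dist absv x y + absv_dist absv y z"
    using absv_add_le_max[of "x - y" "y - z"] absv_nonneg[of "x - y"] absv_nonneg[of "y - z"]
    by (simp add: absv_dist_def)
qed

text \<open>
  When \<open>absv\<close> is complete and extends the \<open>p\<close>-adic absolute value of the rationals, the closure
  of the rationals is the completion of the rationals, i.e. the field of \<open>p\<close>-adic numbers.
\<close>

definition padic_numbers :: "('a::field_char_0 \<Rightarrow> real) \<Rightarrow> 'a set" where
  "padic_numbers absv = absv_topology absv closure_of range of_rat"

definition algebraic_over :: "'a::field set \<Rightarrow> 'a set" where
  "algebraic_over k = {x. \<exists>P. P \<noteq> 0 \<and> (\<forall>i. coeff P i \<in> k) \<and> poly P x = 0}"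

definition algebraically_closed_in :: "'a::field set \<Rightarrow> bool" where
  "algebraically_closed_in k \<longleftrightarrow>
     (\<forall>P. degree P > 0 \<and> (\<forall>i. coeff P i \<in> k) \<longrightarrow> (\<exists>x\<in>k. poly P x = 0))"

text \<open>
  The pair of the field \<open>'a\<close> and the absolute value \<open>absv\<close> is a completion of an algebraic closure
  of the field of \<open>p\<close>-adic numbers; this determines the pair up to isometric isomorphism. The
  normalisation of \<open>absv\<close> at \<open>p\<close> forces \<open>absv\<close> to be the \<open>p\<close>-adic absolute value on the rationals,
  because a nonarchimedean absolute value with \<open>absv p < 1\<close> is 1 at the integers prime to \<open>p\<close>.
\<close>

locale padic_complex_field = nonarch_absolute_value absv
  for p :: nat and absv :: "'a::field_char_0 \<Rightarrow> real" +
  assumes prime_p: "prime p"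
    and absv_p: "absv (of_nat p) = 1 / real p"
    and complete: "Metric_space.mcomplete UNIV (absv_dist absv)"
    and algebraic_closure: "algebraically_closed_in (algebraic_over (padic_numbers absv))"
    and dense: "absv_topology absv closure_of algebraic_over (padic_numbers absv) = UNIV"


section \<open>Entire functions\<close>

definition fps_sums_to :: "('a::field \<Rightarrow> real) \<Rightarrow> 'a fps \<Rightarrow> 'a \<Rightarrow> 'a \<Rightarrow> bool" where
  "fps_sums_to absv f x y \<longleftrightarrow>
     limitin (absv_topology absv) (\<lambda>N. \<Sum>n<N. fps_nth f n * x ^ n) y sequentially"

definition entire :: "('a::field \<Rightarrow> real) \<Rightarrow> 'a fps \<Rightarrow> bool" where
  "entire absv f \<longleftrightarrow> (\<forall>x. \<exists>y. fps_sums_to absv f x y)"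

definition entire_eval :: "('a::field \<Rightarrow> real) \<Rightarrow> 'a fps \<Rightarrow> 'a \<Rightarrow> 'a" where
  "entire_eval absv f x = (THE y. fps_sums_to absv f x y)"

definition transcendental_entire :: "('a::field \<Rightarrow> real) \<Rightarrow> 'a fps \<Rightarrow> bool" where
  "transcendental_entire absv f \<longleftrightarrow> entire absv f \<and> f \<notin> range fps_of_poly"


section \<open>Meromorphic functions\<close>

text \<open>
  The formal Laurent series form a field containing the ring of entire functions, so the field of
  fractions of that ring is realised as the set of quotients inside the Laurent series; a
  meromorphic function is thus represented by its Laurent expansion at 0.
\<close>

definition meromorphic_functions :: "('a::field \<Rightarrow> real) \<Rightarrow> 'a fls set" where
  "meromorphic_functions absv =
     {fps_to_fls a / fps_to_fls b | a b. entire absv a \<and> entire absv b \<and> b \<noteq> 0}"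

definition has_finite_value :: "('a::field \<Rightarrow> real) \<Rightarrow> 'a fls \<Rightarrow> 'a \<Rightarrow> 'a \<Rightarrow> bool" where
  "has_finite_value absv F x y \<longleftrightarrow>
     (\<exists>a b. entire absv a \<and> entire absv b \<and> entire_eval absv b x \<noteq> 0 \<and>
        F = fps_to_fls a / fps_to_fls b \<and> y = entire_eval absv a x / entire_eval absv b x)"

text \<open>
  The value, in the projective line, of a meromorphic function at a finite point;
  \<open>None\<close> stands for the point at infinity, attained exactly at the poles.
\<close>

definition mero_eval :: "('a::field \<Rightarrow> real) \<Rightarrow> 'a fls \<Rightarrow> 'a \<Rightarrow> 'a option" where
  "mero_eval absv F x =
     (if \<exists>y. has_finite_value absv F x y then Some (THE y. has_finite_value absv F x y) else None)"

text \<open>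
  \<open>F = f \<circ> g\<close>: both sides agree, as functions with values in the projective line, at every point
  that is not a pole of \<open>g\<close>. At the poles of \<open>g\<close> (a discrete set) \<open>f \<circ> g\<close> is only defined through
  meromorphic continuation, which is the existence of \<open>F\<close>.
\<close>

definition is_composition :: "('a::field \<Rightarrow> real) \<Rightarrow> 'a fls \<Rightarrow> 'a fls \<Rightarrow> 'a fls \<Rightarrow> bool" where
  "is_composition absv F f g \<longleftrightarrow>
     (\<forall>x y. mero_eval absv g x = Some y \<longrightarrow> mero_eval absv F x = mero_eval absv f y)"

definition linear_rational :: "'a::field fls \<Rightarrow> bool" where
  "linear_rational F \<longleftrightarrow>
     (\<exists>a b c d. a * d - b * c \<noteq> 0 \<and>
        F = (fls_const a * fls_X + fls_const b) / (fls_const c * fls_X + fls_const d))"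

definition prime_meromorphic :: "('a::field \<Rightarrow> real) \<Rightarrow> 'a fls \<Rightarrow> bool" where
  "prime_meromorphic absv F \<longleftrightarrow>
     F \<in> meromorphic_functions absv \<and>
     (\<forall>f\<in>meromorphic_functions absv. \<forall>g\<in>meromorphic_functions absv.
        is_composition absv F f g \<longrightarrow> linear_rational f \<or> linear_rational g)"

end

theory Submission
  imports Defs
begin

text \<open>
  Write \<open>\<phi>\<^sub>a = f (X - a)\<close>. If \<open>\<phi>\<^sub>a\<close> is not prime, then \<open>\<phi>\<^sub>a = U \<circ> V\<close> with entire, non-affine \<open>U\<close>, \<open>V\<close>.

  If \<open>V\<close> is a polynomial, then one of its fibres consists of zeros of \<open>f\<close>, which leaves countably many
  \<open>V\<close> up to affine maps; moreover \<open>V(a) = V(b)\<close> for another zero \<open>b\<close> of \<open>f\<close>, so \<open>a\<close> is a root of one of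
  countably many polynomials.

  If \<open>V\<close> is transcendental, then the fibre of \<open>V\<close> over a critical point \<open>w\<close> of \<open>U\<close> contains two distinct
  critical points of \<open>\<phi>\<^sub>a\<close> with the common value \<open>U(w)\<close>. For \<open>U(w) \<noteq> 0\<close> this happens for countably many
  \<open>a\<close> only: such coincidences are isolated, and the field is separable. For all other \<open>a\<close> the
  critical points of \<open>U\<close> are zeros of \<open>U\<close>, so \<open>U'/U\<close> has no zeros and decays at least like \<open>1/z\<^sup>2\<close>. Then
  \<open>\<phi>\<^sub>a'/\<phi>\<^sub>a = f'/f + 1/(X - a)\<close> is \<open>o(r\<^sup>-\<^sup>2)\<close> in Gauss norm, which holds for at most one \<open>a\<close>, because
  \<open>1/(X - a) - 1/(X - b)\<close> has Gauss norm \<open>|a - b| / r\<^sup>2\<close>.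
\<close>

section \<open>Absolute values, convergence and Gauss norms\<close>

text \<open>The obstacle is the residue characteristic: \<open>absv (of_nat n)\<close> may be below
  1, so the Gauss norm of a derivative has only the upper bound \<open>gnorm f r / r\<close>. Fast
  decay of the logarithmic derivative of \<open>f * lin a\<close> is therefore no contradiction for
  one \<open>a\<close>; only two such parameters exclude each other. Isolating coincidences is a
  first-order argument and needs critical points with nonzero second derivative. Eliminating
  \<open>a\<close> from the equations of a degenerate one off the zeros of \<open>f\<close> leaves
  the zeros of f f'' - 2 f'^2 = -f^3 (1/f)'', which is not identically 0 because \<open>f\<close>
  has a zero. Zeros of \<open>f\<close> are excluded as values of \<open>a\<close>, so that
  \<open>a\<close> is a simple zero of \<open>f * lin a\<close>. Simplicity separates b from
  \<open>a\<close> in the polynomial case and produces a second zero of U in the transcendental one.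
  Most of the analysis rests on the criterion \<open>entire_has_zero\<close>: a term of index k
  \<ge> 1 at least as large as the constant one forces a zero in the disc. It does the work of
  Newton polygons and of the maximum principle.\<close>

context nonarch_absolute_value
begin

lemma absv_0 [simp]: "absv 0 = 0"
  by (simp add: absv_eq_0_iff)

lemma absv_pos: "x \<noteq> 0 \<Longrightarrow> 0 < absv x"
  using absv_nonneg[of x] absv_eq_0_iff[of x] by linarith

lemma absv_1 [simp]: "absv 1 = 1"
  using absv_mult[of 1 1] absv_eq_0_iff[of 1] by simp

lemma absv_minus [simp]: "absv (- x) = absv x"
proof -
  have "absv (-1) * absv (-1) = 1"
    using absv_mult[of "-1" "-1"] by simp
  then have "absv (-1) = 1"
    using absv_nonneg[of "-1"] by (simp add: square_eq_1_iff)
  then show ?thesis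
    using absv_mult[of "-1" x] by simp
qed

lemma absv_diff_commute: "absv (x - y) = absv (y - x)"
  using absv_minus[of "x - y"] by simp

lemma absv_diff_le_max: "absv (x - y) \<le> max (absv x) (absv y)"
  using absv_add_le_max[of x "- y"] by simp

lemma absv_add_le: "absv x \<le> B \<Longrightarrow> absv y \<le> B \<Longrightarrow> absv (x + y) \<le> B"
  using absv_add_le_max[of x y] by simp

lemma absv_diff_le: "absv x \<le> B \<Longrightarrow> absv y \<le> B \<Longrightarrow> absv (x - y) \<le> B"
  using absv_diff_le_max[of x y] by simp

lemma absv_diff_less: "absv x < B \<Longrightarrow> absv y < B \<Longrightarrow> absv (x - y) < B"
  using absv_diff_le_max[of x y] by simp

lemma absv_add_eq: "absv y < absv x \<Longrightarrow> absv (x + y) = absv x"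
  using absv_add_le_max[of x y] absv_diff_le_max[of "x + y" y] by auto

lemma absv_eqI: "absv (x - y) < absv y \<Longrightarrow> absv x = absv y"
  using absv_add_eq[of "x - y" y] by simp

lemma absv_power: "absv (x ^ n) = absv x ^ n"
  by (induction n) (simp_all add: absv_mult)

lemma absv_inverse: "absv (inverse x) = inverse (absv x)"
proof (cases "x = 0")
  case False
  then have "absv (inverse x) * absv x = 1"
    using absv_mult[of "inverse x" x] by simp
  then show ?thesis
    by (metis inverse_unique mult.commute)
qed simp

lemma absv_divide: "absv (x / y) = absv x / absv y"
  by (simp add: divide_inverse absv_mult absv_inverse)

lemma absv_sum_le:
  "0 \<le> B \<Longrightarrow> (\<And>i. i \<in> A \<Longrightarrow> absv (f i) \<le> B) \<Longrightarrow> absv (sum f A) \<le> B"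
  by (induction A rule: infinite_finite_induct) (auto intro: absv_add_le)

lemma absv_of_nat_le: "absv (of_nat n) \<le> 1"
  by (induction n) (auto intro: absv_add_le)

section \<open>Sums of power series\<close>

lemma fps_sums_to_iff:
  "fps_sums_to absv f x y \<longleftrightarrow> (\<lambda>N. absv ((\<Sum>n<N. fps_nth f n * x ^ n) - y)) \<longlonglongrightarrow> 0"
proof -
  interpret Metric_space UNIV "absv_dist absv"
    by (rule Metric_space_absv_dist)
  show ?thesis
    by (simp add: fps_sums_to_def limit_metric_sequentially LIMSEQ_def absv_dist_def absv_nonneg)
qed

lemma fps_sums_to_unique:
  assumes "fps_sums_to absv f x y" "fps_sums_to absv f x z"
  shows "y = z"
proof -
  interpret Metric_space UNIV "absv_dist absv"
    by (rule Metric_space_absv_dist)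
  show ?thesis
    using assms limitin_metric_unique[of _ y sequentially z] by (auto simp: fps_sums_to_def)
qed

lemma entire_eval_eqI: "fps_sums_to absv f x y \<Longrightarrow> entire_eval absv f x = y"
  using fps_sums_to_unique by (auto simp: entire_eval_def)

lemma entire_eval_sums: "entire absv f \<Longrightarrow> fps_sums_to absv f x (entire_eval absv f x)"
  using entire_eval_eqI by (metis entire_def)

lemma fps_sums_to_add:
  assumes "fps_sums_to absv f x y" "fps_sums_to absv g x z"
  shows "fps_sums_to absv (f + g) x (y + z)"
  unfolding fps_sums_to_iff
proof (rule tendsto_sandwich[OF _ _ tendsto_const])
  let ?s = "\<lambda>f N. (\<Sum>n<N. fps_nth f n * x ^ n)"
  show "(\<lambda>N. absv (?s f N - y) + absv (?s g N - z)) \<longlonglongrightarrow> 0"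
    using tendsto_add[OF assms[unfolded fps_sums_to_iff]] by simp
  show "\<forall>\<^sub>F N in sequentially. absv (?s (f + g) N - (y + z)) \<le> absv (?s f N - y) + absv (?s g N - z)"
  proof (intro always_eventually allI)
    fix N
    have *: "?s (f + g) N - (y + z) = (?s f N - y) + (?s g N - z)"
      by (simp add: sum.distrib algebra_simps)
    show "absv (?s (f + g) N - (y + z)) \<le> absv (?s f N - y) + absv (?s g N - z)"
      unfolding * using absv_add_le_max[of "?s f N - y" "?s g N - z"] absv_nonneg[of "?s f N - y"]
        absv_nonneg[of "?s g N - z"] by simp
  qed
qed (simp add: absv_nonneg)

text \<open>Some partial sum is closer to \<open>y\<close> than \<open>absv y\<close>, and then it
  has exactly the absolute value of \<open>y\<close>.\<close>

lemma absv_limit_le: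
  assumes "fps_sums_to absv f x y" and "\<And>n. absv (fps_nth f n) * absv x ^ n \<le> B"
  shows "absv y \<le> B"
proof (rule ccontr)
  assume "\<not> absv y \<le> B"
  have "0 \<le> B" using assms(2)[of 0] absv_nonneg[of "fps_nth f 0"] by simp
  let ?s = "\<lambda>N. (\<Sum>n<N. fps_nth f n * x ^ n)"
  from assms(1) have "\<forall>\<^sub>F N in sequentially. absv (?s N - y) < absv y"
    unfolding fps_sums_to_iff using \<open>\<not> absv y \<le> B\<close> \<open>0 \<le> B\<close> by (intro order_tendstoD) auto
  then obtain N where "absv (?s N - y) < absv y"
    by (auto simp: eventually_sequentially)
  then have "absv (?s N) = absv y"
    by (rule absv_eqI)
  moreover have "absv (?s N) \<le> B"
    by (intro absv_sum_le \<open>0 \<le> B\<close>) (simp add: absv_mult absv_power assms(2))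
  ultimately show False using \<open>\<not> absv y \<le> B\<close> by simp
qed

end

context padic_complex_field
begin

section \<open>Completeness and coefficient criteria for entire series\<close>

lemma p_gt_1: "1 < p"
  using prime_p prime_gt_1_nat by blast

text \<open>Powers of 1 / p. The value group is unbounded, so estimates at points of the field reach
  every real radius.\<close>

lemma exists_absv_ge: "\<exists>x. r \<le> absv x \<and> x \<noteq> 0"
proof -
  obtain n where n: "r < real p ^ n"
    using real_arch_pow[of "real p"] p_gt_1 by auto
  have "absv (inverse (of_nat p) ^ n) = real p ^ n"
    by (simp add: absv_power absv_inverse absv_p)
  then show ?thesis
    using n p_gt_1 by (intro exI[of _ "inverse (of_nat p) ^ n"]) auto
qed

lemma complete_sequence:
  assumes "\<And>\<epsilon>. 0 < \<epsilon> \<Longrightarrow> \<exists>N. \<forall>m\<ge>N. \<forall>n\<ge>N. absv (s m - s n) < \<epsilon>"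
  obtains y where "(\<lambda>n. absv (s n - y)) \<longlonglongrightarrow> 0"
proof -
  interpret Metric_space UNIV "absv_dist absv"
    by (rule Metric_space_absv_dist)
  have "MCauchy s"
    using assms unfolding MCauchy_def absv_dist_def by simp
  then obtain y where "limitin mtopology s y sequentially"
    using complete by (auto simp: mcomplete_def)
  then have "(\<lambda>n. absv (s n - y)) \<longlonglongrightarrow> 0"
    by (simp add: limit_metric_sequentially LIMSEQ_def absv_dist_def absv_nonneg)
  then show thesis by (rule that)
qed

text \<open>By the strong triangle inequality the distance of two terms is at most the largest step
  between them, so steps tending to 0 suffice.\<close>

lemma ultrametric_cauchy:
  assumes "(\<lambda>n. b n) \<longlonglongrightarrow> (0 :: real)" and "\<And>n. absv (s (Suc n) - s n) \<le> b n"
  obtains y where "(\<lambda>n. absv (s n - y)) \<longlonglongrightarrow> 0"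
proof (rule complete_sequence)
  fix \<epsilon> :: real assume "0 < \<epsilon>"
  then obtain N where N: "\<And>n. n \<ge> N \<Longrightarrow> b n < \<epsilon> / 2"
    using order_tendstoD(2)[OF assms(1), of "\<epsilon> / 2"] by (auto simp: eventually_sequentially)
  have *: "absv (s (N + k) - s N) \<le> \<epsilon> / 2" for k
  proof (induction k)
    case (Suc k)
    have "absv ((s (Suc (N + k)) - s (N + k)) + (s (N + k) - s N)) \<le> \<epsilon> / 2"
      using assms(2)[of "N + k"] N[of "N + k"] Suc by (intro absv_add_le) auto
    then show ?case by simp
  qed (use \<open>0 < \<epsilon>\<close> in simp)
  have "absv (s m - s n) < \<epsilon>" if "m \<ge> N" "n \<ge> N" for m n
  proof -
    have "absv (s m - s N) \<le> \<epsilon> / 2" "absv (s n - s N) \<le> \<epsilon> / 2"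
      using *[of "m - N"] *[of "n - N"] that by simp_all
    then have "absv ((s m - s N) - (s n - s N)) \<le> \<epsilon> / 2"
      by (rule absv_diff_le)
    then show ?thesis using \<open>0 < \<epsilon>\<close> by simp
  qed
  then show "\<exists>N. \<forall>m\<ge>N. \<forall>n\<ge>N. absv (s m - s n) < \<epsilon>" by blast
qed (rule that)

lemma entire_tendsto:
  assumes "entire absv f" "0 \<le> r"
  shows "(\<lambda>n. absv (fps_nth f n) * r ^ n) \<longlonglongrightarrow> 0"
proof -
  obtain x where x: "r \<le> absv x" using exists_absv_ge by blast
  obtain y where y: "fps_sums_to absv f x y" using assms by (auto simp: entire_def)
  let ?e = "\<lambda>N. absv ((\<Sum>n<N. fps_nth f n * x ^ n) - y)"
  have lim: "?e \<longlonglongrightarrow> 0" using y by (simp add: fps_sums_to_iff)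
  show ?thesis
  proof (rule tendsto_sandwich[OF _ _ tendsto_const])
    show "(\<lambda>N. ?e (Suc N) + ?e N) \<longlonglongrightarrow> 0"
      using tendsto_add[OF LIMSEQ_Suc[OF lim] lim] by simp
    show "\<forall>\<^sub>F N in sequentially. absv (fps_nth f N) * r ^ N \<le> ?e (Suc N) + ?e N"
    proof (intro always_eventually allI)
      fix N
      have "absv (fps_nth f N) * r ^ N \<le> absv (fps_nth f N) * absv x ^ N"
        using x assms(2) by (intro mult_left_mono power_mono absv_nonneg)
      also have "\<dots> = absv (((\<Sum>n<Suc N. fps_nth f n * x ^ n) - y) - ((\<Sum>n<N. fps_nth f n * x ^ n) - y))"
        by (simp add: absv_mult absv_power)
      also have "\<dots> \<le> ?e (Suc N) + ?e N"
        using absv_diff_le_max[of "(\<Sum>n<Suc N. fps_nth f n * x ^ n) - y" "(\<Sum>n<N. fps_nth f n * x ^ n) - y"]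
          absv_nonneg[of "(\<Sum>n<Suc N. fps_nth f n * x ^ n) - y"]
          absv_nonneg[of "(\<Sum>n<N. fps_nth f n * x ^ n) - y"] by linarith
      finally show "absv (fps_nth f N) * r ^ N \<le> ?e (Suc N) + ?e N" .
    qed
  qed (use assms in \<open>simp add: absv_nonneg\<close>)
qed

text \<open>A bound at radius 2 r makes the terms at radius r decay like 2^-n, and terms tending to
  0 suffice for convergence. Boundedness is the condition that is easy to check for products,
  quotients and composites.\<close>

lemma entireI_bounded:
  assumes "\<And>r. 1 \<le> r \<Longrightarrow> \<exists>B. \<forall>n. absv (fps_nth f n) * r ^ n \<le> B"
  shows "entire absv f"
  unfolding entire_def
proof
  fix x
  define r where "r = max 1 (absv x)"
  have "1 \<le> 2 * r" by (simp add: r_def)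
  from assms[OF this] obtain B where B: "\<And>n. absv (fps_nth f n) * (2 * r) ^ n \<le> B"
    by blast
  have "(\<lambda>n. B * (1/2) ^ n) \<longlonglongrightarrow> B * 0"
    by (intro tendsto_mult_left LIMSEQ_power_zero) simp
  then have lim: "(\<lambda>n. B * (1/2) ^ n) \<longlonglongrightarrow> 0" by simp
  let ?s = "\<lambda>N. \<Sum>n<N. fps_nth f n * x ^ n"
  have "absv (?s (Suc n) - ?s n) \<le> B * (1/2) ^ n" for n
  proof -
    have "absv (?s (Suc n) - ?s n) = absv (fps_nth f n) * absv x ^ n"
      by (simp add: absv_mult absv_power)
    also have "\<dots> \<le> absv (fps_nth f n) * r ^ n"
      by (intro mult_left_mono power_mono absv_nonneg) (simp add: r_def)
    also have "\<dots> = (absv (fps_nth f n) * (2 * r) ^ n) * (1/2) ^ n"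
      by (simp add: power_mult_distrib field_simps)
    also have "\<dots> \<le> B * (1/2) ^ n"
      by (intro mult_right_mono B) simp
    finally show ?thesis .
  qed
  then obtain y where "(\<lambda>n. absv (?s n - y)) \<longlonglongrightarrow> 0"
    by (rule ultrametric_cauchy[OF lim, of ?s])
  then show "\<exists>y. fps_sums_to absv f x y" by (auto simp: fps_sums_to_iff)
qed

lemma entire_bounded:
  assumes "entire absv f" "0 \<le> r"
  shows "\<exists>B. \<forall>n. absv (fps_nth f n) * r ^ n \<le> B"
proof -
  have "Bseq (\<lambda>n. absv (fps_nth f n) * r ^ n)"
    using entire_tendsto[OF assms] by (auto intro!: convergent_imp_Bseq convergentI)
  then obtain K where "\<And>n. norm (absv (fps_nth f n) * r ^ n) \<le> K"
    by (auto simp: Bseq_def)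
  then show ?thesis by (intro exI[of _ K]) (auto simp: abs_le_iff)
qed

text \<open>The Gauss norm at a real radius, which need not be the absolute value of an element. As
  a supremum of reals it is meaningful only for bounded terms, as entire series have them.\<close>

definition gnorm :: "'a fps \<Rightarrow> real \<Rightarrow> real" where
  "gnorm f r = (SUP n. absv (fps_nth f n) * r ^ n)"

lemma gnorm_upper:
  assumes "entire absv f" "0 \<le> r"
  shows "absv (fps_nth f n) * r ^ n \<le> gnorm f r"
  unfolding gnorm_def using entire_bounded[OF assms] by (intro cSUP_upper) (auto simp: bdd_above_def)

lemma gnorm_least: "(\<And>n. absv (fps_nth f n) * r ^ n \<le> B) \<Longrightarrow> gnorm f r \<le> B"
  unfolding gnorm_def by (rule cSUP_least) auto

lemma gnorm_nonneg: "entire absv f \<Longrightarrow> 0 \<le> r \<Longrightarrow> 0 \<le> gnorm f r"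
  using gnorm_upper[of f r 0] absv_nonneg[of "fps_nth f 0"] by simp

lemma gnorm_pos:
  assumes "entire absv f" "0 < r" "f \<noteq> 0"
  shows "0 < gnorm f r"
proof -
  obtain n where "fps_nth f n \<noteq> 0" using assms(3) by (auto simp: fps_eq_iff)
  then have "0 < absv (fps_nth f n) * r ^ n" using assms(2) by (simp add: absv_pos)
  also have "\<dots> \<le> gnorm f r" using assms by (intro gnorm_upper) auto
  finally show ?thesis .
qed

text \<open>The terms tend to 0, so only finitely many exceed half the supremum.\<close>

lemma gnorm_attained:
  assumes "entire absv f" "0 < r"
  shows "\<exists>n. absv (fps_nth f n) * r ^ n = gnorm f r"
proof (cases "f = 0")
  case True
  have "gnorm f r = 0" by (simp add: True gnorm_def)
  then show ?thesis using True by simp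
next
  case False
  have pos: "0 < gnorm f r" by (rule gnorm_pos[OF assms False])
  have "\<forall>\<^sub>F n in sequentially. absv (fps_nth f n) * r ^ n < gnorm f r / 2"
    using assms pos by (intro order_tendstoD[OF entire_tendsto]) auto
  then obtain N where N: "\<And>n. n \<ge> N \<Longrightarrow> absv (fps_nth f n) * r ^ n < gnorm f r / 2"
    by (auto simp: eventually_sequentially)
  define M where "M = Max ((\<lambda>n. absv (fps_nth f n) * r ^ n) ` {..N})"
  have "M \<in> (\<lambda>n. absv (fps_nth f n) * r ^ n) ` {..N}"
    unfolding M_def by (intro Max_in) auto
  then obtain k where k: "M = absv (fps_nth f k) * r ^ k" by blast
  have "gnorm f r \<le> max M (gnorm f r / 2)"
  proof (rule gnorm_least)
    fix n show "absv (fps_nth f n) * r ^ n \<le> max M (gnorm f r / 2)"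
    proof (cases "n \<le> N")
      case True
      then have "absv (fps_nth f n) * r ^ n \<le> M" unfolding M_def by (intro Max_ge) auto
      then show ?thesis by simp
    next
      case False
      then show ?thesis using N[of n] by linarith
    qed
  qed
  then have "gnorm f r \<le> M" using pos by auto
  moreover have "M \<le> gnorm f r" unfolding k using assms by (intro gnorm_upper) auto
  ultimately show ?thesis using k by auto
qed

section \<open>Evaluation and products of entire series\<close>

lemma entire_add:
  assumes "entire absv f" "entire absv g"
  shows "entire absv (f + g)"
  unfolding entire_def using fps_sums_to_add[OF entire_eval_sums[OF assms(1)] entire_eval_sums[OF assms(2)]] by blast

lemma eval_add:
  "entire absv f \<Longrightarrow> entire absv g \<Longrightarrow>
    entire_eval absv (f + g) x = entire_eval absv f x + entire_eval absv g x"
  by (intro entire_eval_eqI fps_sums_to_add entire_eval_sums)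

lemma absv_eval_le: "entire absv f \<Longrightarrow> absv x \<le> r \<Longrightarrow> absv (entire_eval absv f x) \<le> gnorm f r"
proof (rule absv_limit_le[OF entire_eval_sums])
  fix n assume *: "entire absv f" "absv x \<le> r"
  have "absv (fps_nth f n) * absv x ^ n \<le> absv (fps_nth f n) * r ^ n"
    by (intro mult_left_mono power_mono * absv_nonneg)
  also have "\<dots> \<le> gnorm f r"
    using * absv_nonneg[of x] by (intro gnorm_upper) auto
  finally show "absv (fps_nth f n) * absv x ^ n \<le> gnorm f r" .
qed

lemma fps_of_poly_sums: "fps_sums_to absv (fps_of_poly P) x (poly P x)"
  unfolding fps_sums_to_iff
proof (rule tendsto_eventually, unfold eventually_sequentially, intro exI allI impI)
  fix N assume "Suc (degree P) \<le> N"
  then have "(\<Sum>n<N. coeff P n * x ^ n) = (\<Sum>n<Suc (degree P). coeff P n * x ^ n)"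
    by (intro sum.mono_neutral_right) (auto simp: coeff_eq_0)
  then show "absv ((\<Sum>n<N. fps_nth (fps_of_poly P) n * x ^ n) - poly P x) = 0"
    by (simp add: poly_altdef lessThan_Suc_atMost)
qed

lemma entire_fps_of_poly [simp]: "entire absv (fps_of_poly P)"
  using fps_of_poly_sums by (auto simp: entire_def)

lemma eval_fps_of_poly [simp]: "entire_eval absv (fps_of_poly P) x = poly P x"
  by (rule entire_eval_eqI[OF fps_of_poly_sums])

lemma entire_const [simp]: "entire absv (fps_const c)"
  and eval_const [simp]: "entire_eval absv (fps_const c) x = c"
proof -
  have eq: "fps_const c = fps_of_poly [:c:]" by simp
  show "entire absv (fps_const c)" unfolding eq by (rule entire_fps_of_poly)
  show "entire_eval absv (fps_const c) x = c" unfolding eq eval_fps_of_poly by simp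
qed

lemma entire_0 [simp]: "entire absv 0"
  and eval_0 [simp]: "entire_eval absv 0 x = 0"
  and entire_1 [simp]: "entire absv 1"
  and eval_1 [simp]: "entire_eval absv 1 x = 1"
  using entire_const[of 0] entire_const[of 1] eval_const[of 0] eval_const[of 1] by simp_all

lemma entire_X [simp]: "entire absv fps_X"
  and eval_X [simp]: "entire_eval absv fps_X x = x"
proof -
  have eq: "fps_X = fps_of_poly [:0, 1 :: 'a:]" by (simp add: fps_of_poly_pCons)
  show "entire absv fps_X" unfolding eq by (rule entire_fps_of_poly)
  show "entire_eval absv fps_X x = x" unfolding eq eval_fps_of_poly by simp
qed

text \<open>Phrased with bounds at one radius instead of \<open>gnorm\<close>, because it is later
  applied to the formal inverse of an entire series, which is bounded on one disc only.\<close>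

lemma absv_mult_coeff_le:
  assumes f: "\<And>i. absv (fps_nth f i) * r ^ i \<le> A" and g: "\<And>i. absv (fps_nth g i) * r ^ i \<le> B"
    and r: "0 < r"
  shows "absv (fps_nth (f * g) n) * r ^ n \<le> A * B"
proof -
  have AB: "0 \<le> A" "0 \<le> B"
    using f[of 0] g[of 0] absv_nonneg[of "fps_nth f 0"] absv_nonneg[of "fps_nth g 0"] by auto
  have rn: "0 < r ^ n" using r by simp
  have "absv (fps_nth (f * g) n) \<le> A * B / r ^ n"
    unfolding fps_mult_nth
  proof (rule absv_sum_le)
    show "0 \<le> A * B / r ^ n" using AB rn by simp
    fix i assume "i \<in> {0..n}"
    then have "absv (fps_nth f i) * absv (fps_nth g (n - i)) * r ^ n
        = (absv (fps_nth f i) * r ^ i) * (absv (fps_nth g (n - i)) * r ^ (n - i))"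
      by (simp add: power_add[symmetric])
    also have "\<dots> \<le> A * B"
      using AB f g r by (intro mult_mono) (auto simp: absv_nonneg)
    finally show "absv (fps_nth f i * fps_nth g (n - i)) \<le> A * B / r ^ n"
      using rn by (simp add: absv_mult field_simps)
  qed
  then show ?thesis using rn by (simp add: field_simps)
qed

lemma entire_mult:
  assumes "entire absv f" "entire absv g"
  shows "entire absv (f * g)"
proof (rule entireI_bounded)
  fix r :: real assume "1 \<le> r"
  then have "absv (fps_nth (f * g) n) * r ^ n \<le> gnorm f r * gnorm g r" for n
    by (intro absv_mult_coeff_le gnorm_upper assms) auto
  then show "\<exists>B. \<forall>n. absv (fps_nth (f * g) n) * r ^ n \<le> B" by blast
qed

text \<open>Gauss's lemma: for the least indices i and j at which the factors attain their norms,
  the product of these two terms strictly dominates every other summand of the coefficient i +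
  j.\<close>

lemma gnorm_mult:
  assumes "entire absv f" "entire absv g" "0 < r"
  shows "gnorm (f * g) r = gnorm f r * gnorm g r"
proof (rule antisym)
  show "gnorm (f * g) r \<le> gnorm f r * gnorm g r"
    using assms by (intro gnorm_least absv_mult_coeff_le gnorm_upper) auto
  show "gnorm f r * gnorm g r \<le> gnorm (f * g) r"
  proof (cases "f = 0 \<or> g = 0")
    case True
    have "gnorm 0 r = 0" by (simp add: gnorm_def)
    then show ?thesis using True by auto
  next
    case False
    define i where "i = (LEAST i. absv (fps_nth f i) * r ^ i = gnorm f r)"
    define j where "j = (LEAST j. absv (fps_nth g j) * r ^ j = gnorm g r)"
    have i: "absv (fps_nth f i) * r ^ i = gnorm f r"
      unfolding i_def using gnorm_attained[OF assms(1,3)] by (rule LeastI_ex)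
    have j: "absv (fps_nth g j) * r ^ j = gnorm g r"
      unfolding j_def using gnorm_attained[OF assms(2,3)] by (rule LeastI_ex)
    have i': "absv (fps_nth f k) * r ^ k < gnorm f r" if "k < i" for k
      using not_less_Least[OF that[unfolded i_def]] gnorm_upper[OF assms(1), of r k] assms(3)
      by (auto simp: less_le)
    have j': "absv (fps_nth g k) * r ^ k < gnorm g r" if "k < j" for k
      using not_less_Least[OF that[unfolded j_def]] gnorm_upper[OF assms(2), of r k] assms(3)
      by (auto simp: less_le)
    let ?B = "gnorm f r * gnorm g r"
    have pos: "0 < gnorm f r" "0 < gnorm g r" using gnorm_pos assms False by auto
    have small: "absv (fps_nth f k * fps_nth g (i + j - k)) * r ^ (i + j) < ?B"
      if "k \<le> i + j" "k \<noteq> i" for k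
    proof -
      have eq: "absv (fps_nth f k * fps_nth g (i + j - k)) * r ^ (i + j)
          = (absv (fps_nth f k) * r ^ k) * (absv (fps_nth g (i + j - k)) * r ^ (i + j - k))"
        using that(1) by (simp add: absv_mult power_add[symmetric])
      show ?thesis
      proof (cases "k < i")
        case True
        have "(absv (fps_nth f k) * r ^ k) * (absv (fps_nth g (i + j - k)) * r ^ (i + j - k))
            \<le> (absv (fps_nth f k) * r ^ k) * gnorm g r"
          using assms by (intro mult_left_mono gnorm_upper mult_nonneg_nonneg absv_nonneg) auto
        also have "\<dots> < ?B"
          using i'[OF True] pos by simp
        finally show ?thesis using eq by simp
      next
        case F: False
        then have "i + j - k < j" using that by auto
        note * = j'[OF this]
        have "(absv (fps_nth f k) * r ^ k) * (absv (fps_nth g (i + j - k)) * r ^ (i + j - k))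
            \<le> gnorm f r * (absv (fps_nth g (i + j - k)) * r ^ (i + j - k))"
          using assms by (intro mult_right_mono gnorm_upper mult_nonneg_nonneg absv_nonneg) auto
        also have "\<dots> < ?B"
          using * pos by simp
        finally show ?thesis using eq by simp
      qed
    qed
    have rp: "0 < r ^ (i + j)" using assms(3) by simp
    let ?m = "fps_nth f i * fps_nth g j"
    have m: "absv ?m * r ^ (i + j) = ?B"
      using i j by (simp add: absv_mult power_add mult_ac)
    let ?A = "{0..i + j} - {i}"
    have "fps_nth (f * g) (i + j) = ?m + (\<Sum>k\<in>?A. fps_nth f k * fps_nth g (i + j - k))"
      unfolding fps_mult_nth by (subst sum.remove[of _ i]) auto
    moreover have "absv (\<Sum>k\<in>?A. fps_nth f k * fps_nth g (i + j - k)) < absv ?m"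
    proof (cases "?A = {}")
      case True
      have "0 < absv ?m * r ^ (i + j)" unfolding m using pos by simp
      then have "0 < absv ?m" using rp by (rule zero_less_mult_pos2)
      then show ?thesis unfolding True by simp
    next
      case A: False
      define M where "M = Max ((\<lambda>k. absv (fps_nth f k * fps_nth g (i + j - k))) ` ?A)"
      have "M \<in> (\<lambda>k. absv (fps_nth f k * fps_nth g (i + j - k))) ` ?A"
        unfolding M_def using A by (intro Max_in) auto
      then obtain k where k: "k \<in> ?A" "M = absv (fps_nth f k * fps_nth g (i + j - k))" by blast
      have "M * r ^ (i + j) < absv ?m * r ^ (i + j)"
        using small[of k] k m by auto
      then have "M < absv ?m" using rp by simp
      moreover have "absv (\<Sum>k\<in>?A. fps_nth f k * fps_nth g (i + j - k)) \<le> M"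
      proof (rule absv_sum_le)
        show "0 \<le> M" unfolding k(2) by (rule absv_nonneg)
        show "absv (fps_nth f k * fps_nth g (i + j - k)) \<le> M" if "k \<in> ?A" for k
          unfolding M_def using that by (intro Max_ge) auto
      qed
      ultimately show ?thesis by simp
    qed
    ultimately have "absv (fps_nth (f * g) (i + j)) = absv ?m"
      by (simp add: absv_add_eq)
    then have "?B = absv (fps_nth (f * g) (i + j)) * r ^ (i + j)" using m by simp
    also have "\<dots> \<le> gnorm (f * g) r"
      using assms by (intro gnorm_upper entire_mult) auto
    finally show ?thesis .
  qed
qed

section \<open>The ring of entire functions\<close>

text \<open>Subtracting the partial sum as a polynomial leaves a series whose first \<open>N\<close>
  coefficients vanish, to which \<open>absv_limit_le\<close> applies.\<close>

lemma fps_tail_sums: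
  assumes "fps_sums_to absv f z y" and "\<And>k. N \<le> k \<Longrightarrow> absv (fps_nth f k) * absv z ^ k \<le> B" and "0 \<le> B"
  shows "absv (y - (\<Sum>n<N. fps_nth f n * z ^ n)) \<le> B"
proof -
  define Q where "Q = (\<Sum>n<N. monom (- fps_nth f n) n)"
  have coeff: "coeff Q k = (if k < N then - fps_nth f k else 0)" for k
    by (simp add: Q_def coeff_sum)
  have "poly Q z = - (\<Sum>n<N. fps_nth f n * z ^ n)"
    by (simp add: Q_def poly_sum poly_monom sum_negf)
  then have "fps_sums_to absv (f + fps_of_poly Q) z (y - (\<Sum>n<N. fps_nth f n * z ^ n))"
    using fps_sums_to_add[OF assms(1) fps_of_poly_sums, of Q] by simp
  then show ?thesis
    by (rule absv_limit_le) (use assms(2,3) in \<open>simp add: coeff\<close>)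
qed

text \<open>Formal division by X - z has partial sums of f(z) in its coefficients. As the whole sum
  is 0, a partial sum is minus a tail, and tails are small enough to make the quotient
  entire.\<close>

lemma entire_divide_root:
  assumes "entire absv f" and "entire_eval absv f z = 0"
  shows "\<exists>g. entire absv g \<and> f = (fps_X - fps_const z) * g"
proof (cases "z = 0")
  case True
  have "fps_sums_to absv f 0 0" using entire_eval_sums[OF assms(1), of 0] assms(2) True by simp
  then have "absv (0 - (\<Sum>n<1. fps_nth f n * 0 ^ n)) \<le> 0"
    by (rule fps_tail_sums) (auto simp: power_0_left)
  then have f0: "fps_nth f 0 = 0" using absv_pos[of "fps_nth f 0"] by auto
  then have f: "f = fps_X * fps_shift 1 f"
    by (simp add: fps_eq_iff fps_X_mult_nth)
  have "entire absv (fps_shift 1 f)"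
  proof (rule entireI_bounded)
    fix r :: real assume "1 \<le> r"
    show "\<exists>B. \<forall>n. absv (fps_nth (fps_shift 1 f) n) * r ^ n \<le> B"
    proof (intro exI allI)
      fix n
      have "absv (fps_nth (fps_shift 1 f) n) * r ^ n \<le> absv (fps_nth f (Suc n)) * r ^ Suc n"
        using \<open>1 \<le> r\<close> by (simp add: absv_nonneg mult_left_mono)
      also have "\<dots> \<le> gnorm f r" using \<open>1 \<le> r\<close> by (intro gnorm_upper assms) auto
      finally show "absv (fps_nth (fps_shift 1 f) n) * r ^ n \<le> gnorm f r" .
    qed
  qed
  then show ?thesis using f True by auto
next
  case False
  define S where "S = (\<lambda>N. \<Sum>n<N. fps_nth f n * z ^ n)"
  \<comment> \<open>Solves g_(n-1) - z g_n = f_n recursively, which requires z to be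
    nonzero.\<close>
  define g where "g = Abs_fps (\<lambda>n. - S (Suc n) / z ^ Suc n)"
  have "f = (fps_X - fps_const z) * g"
  proof (rule fps_ext)
    fix n show "fps_nth f n = fps_nth ((fps_X - fps_const z) * g) n"
      using False by (cases n) (simp_all add: left_diff_distrib g_def S_def field_simps)
  qed
  moreover have "entire absv g"
  proof (rule entireI_bounded)
    fix r :: real assume "1 \<le> r"
    \<comment> \<open>With \<open>absv z / R\<close> at most 1, its powers in the tail are largest
      at exponent n + 1, which cancels the division by z^(n + 1).\<close>
    define R where "R = max r (absv z)"
    have R: "1 \<le> R" "r \<le> R" "absv z \<le> R" using \<open>1 \<le> r\<close> by (auto simp: R_def)
    show "\<exists>B. \<forall>n. absv (fps_nth g n) * r ^ n \<le> B"
    proof (intro exI allI)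
      fix n
      let ?q = "absv z / R"
      have q: "0 \<le> ?q" "?q \<le> 1" using R by (auto simp: absv_nonneg)
      have "absv (0 - S (Suc n)) \<le> gnorm f R * ?q ^ Suc n"
        unfolding S_def
      proof (rule fps_tail_sums)
        show "fps_sums_to absv f z 0" using entire_eval_sums[OF assms(1), of z] assms(2) by simp
        show "0 \<le> gnorm f R * ?q ^ Suc n"
          using R by (intro mult_nonneg_nonneg[OF gnorm_nonneg zero_le_power] assms q(1)) auto
        fix k assume "Suc n \<le> k"
        have "absv (fps_nth f k) * absv z ^ k = (absv (fps_nth f k) * R ^ k) * ?q ^ k"
          using R by (simp add: power_divide)
        also have "\<dots> \<le> gnorm f R * ?q ^ Suc n"
          using R q \<open>Suc n \<le> k\<close> by (intro mult_mono gnorm_upper power_decreasing gnorm_nonneg assms) auto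
        finally show "absv (fps_nth f k) * absv z ^ k \<le> gnorm f R * ?q ^ Suc n" .
      qed
      moreover have zp: "0 < absv z ^ Suc n" using absv_pos[OF False] by simp
      ultimately have "absv (fps_nth g n) \<le> gnorm f R / R ^ Suc n"
        using R by (simp add: g_def absv_divide absv_mult absv_power power_divide field_simps)
      then have "absv (fps_nth g n) * r ^ n \<le> gnorm f R / R ^ Suc n * R ^ n"
        using R \<open>1 \<le> r\<close> by (intro mult_mono power_mono absv_nonneg divide_nonneg_nonneg gnorm_nonneg assms) auto
      also have "\<dots> = gnorm f R / R" using R by simp
      finally show "absv (fps_nth g n) * r ^ n \<le> gnorm f R / R" .
    qed
  qed
  ultimately show ?thesis by blast
qed

lemma entire_minus:
  assumes "entire absv f"
  shows "entire absv (- f)" "entire_eval absv (- f) x = - entire_eval absv f x"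
proof -
  have "entire absv (fps_const (-1) * f)" by (intro entire_mult entire_const assms)
  moreover have "fps_const (-1) * f = - f" by (simp add: fps_eq_iff)
  ultimately show e: "entire absv (- f)" by simp
  have "entire_eval absv (f + - f) x = entire_eval absv f x + entire_eval absv (- f) x"
    by (intro eval_add assms e)
  then show "entire_eval absv (- f) x = - entire_eval absv f x"
    by (simp add: minus_unique)
qed

lemma entire_diff: "entire absv f \<Longrightarrow> entire absv g \<Longrightarrow> entire absv (f - g)"
  using entire_add[of f "- g"] entire_minus(1)[of g] by simp

lemma eval_diff:
  "entire absv f \<Longrightarrow> entire absv g \<Longrightarrow>
    entire_eval absv (f - g) x = entire_eval absv f x - entire_eval absv g x"
  using eval_add[of f "- g" x] entire_minus[of g] by simp

abbreviation lin :: "'a \<Rightarrow> 'a fps" where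
  "lin z \<equiv> fps_X - fps_const z"

lemma entire_lin [simp]: "entire absv (lin z)"
  by (intro entire_diff) auto

lemma eval_lin [simp]: "entire_eval absv (lin z) x = x - z"
  by (simp add: eval_diff)

lemma lin_nonzero [simp]: "lin z \<noteq> 0"
  by (metis eval_0 eval_lin diff_add_cancel diff_eq_eq zero_neq_one add_0)

text \<open>Serves as a first-order Taylor expansion with entire remainder; continuity,
  multiplicativity of evaluation and the chain rule are read off from it.\<close>

lemma entire_expand:
  assumes "entire absv f"
  obtains g where "entire absv g" "f = fps_const (entire_eval absv f z) + lin z * g"
proof -
  have "entire_eval absv (f - fps_const (entire_eval absv f z)) z = 0"
    by (simp add: eval_diff assms)
  then obtain g where "entire absv g" "f - fps_const (entire_eval absv f z) = lin z * g"
    using entire_divide_root[OF entire_diff[OF assms entire_const]] by blast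
  then show thesis by (intro that[of g]) (auto simp: algebra_simps)
qed

text \<open>The partial sums at \<open>z\<close> telescope to a single term of \<open>h\<close>, up
  to a factor, and this tends to 0.\<close>

lemma eval_lin_mult:
  assumes "entire absv h"
  shows "entire_eval absv (lin z * h) z = 0"
proof (rule entire_eval_eqI)
  have "(\<Sum>n<N. fps_nth (lin z * h) n * z ^ n) = (if N = 0 then 0 else - fps_nth h (N - 1) * z ^ N)" for N
  proof (induction N)
    case (Suc N)
    then show ?case by (cases N) (simp_all add: left_diff_distrib algebra_simps)
  qed simp
  then have eq: "absv ((\<Sum>n<Suc N. fps_nth (lin z * h) n * z ^ n) - 0) = absv z * (absv (fps_nth h N) * absv z ^ N)" for N
    by (simp add: absv_mult absv_power)
  have "(\<lambda>N. absv z * (absv (fps_nth h N) * absv z ^ N)) \<longlonglongrightarrow> absv z * 0"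
    by (intro tendsto_mult_left entire_tendsto assms absv_nonneg)
  then show "fps_sums_to absv (lin z * h) z 0"
    unfolding fps_sums_to_iff by (subst filterlim_sequentially_Suc[symmetric], unfold eq) simp
qed

text \<open>After expanding both factors at \<open>x\<close>, everything in the product except the
  product of the two constants is a multiple of \<open>lin x\<close>.\<close>

lemma eval_mult:
  assumes "entire absv f" "entire absv g"
  shows "entire_eval absv (f * g) x = entire_eval absv f x * entire_eval absv g x"
proof -
  obtain f1 where f1: "entire absv f1" "f = fps_const (entire_eval absv f x) + lin x * f1"
    by (rule entire_expand[OF assms(1)])
  obtain g1 where g1: "entire absv g1" "g = fps_const (entire_eval absv g x) + lin x * g1"
    by (rule entire_expand[OF assms(2)])
  let ?c = "entire_eval absv f x" and ?d = "entire_eval absv g x"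
  define h where "h = f1 * g + fps_const ?c * g1"
  have h: "entire absv h" unfolding h_def by (intro entire_add entire_mult f1 g1 assms entire_const)
  have "f * g = (fps_const ?c + lin x * f1) * g" using f1(2) by simp
  also have "\<dots> = fps_const ?c * (fps_const ?d + lin x * g1) + lin x * f1 * g"
    using g1(2) by (simp add: distrib_right)
  also have "\<dots> = fps_const (?c * ?d) + lin x * h"
    by (simp add: h_def algebra_simps)
  finally show ?thesis
    by (simp add: eval_add eval_lin_mult h entire_mult)
qed

lemma entire_power: "entire absv f \<Longrightarrow> entire absv (f ^ n)"
  by (induction n) (auto intro: entire_mult)

lemma eval_power: "entire absv f \<Longrightarrow> entire_eval absv (f ^ n) x = entire_eval absv f x ^ n"
  by (induction n) (auto simp: eval_mult entire_power)

section \<open>Derivatives and Gauss norm estimates\<close>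

lemma entire_deriv:
  assumes "entire absv f"
  shows "entire absv (fps_deriv f)"
proof (rule entireI_bounded)
  fix r :: real assume r: "1 \<le> r"
  show "\<exists>B. \<forall>n. absv (fps_nth (fps_deriv f) n) * r ^ n \<le> B"
  proof (intro exI allI)
    fix n
    have "absv (fps_nth (fps_deriv f) n) \<le> 1 * absv (fps_nth f (Suc n))"
      using mult_right_mono[OF absv_of_nat_le absv_nonneg, of "Suc n" "fps_nth f (Suc n)"]
    by (simp add: absv_mult del: of_nat_Suc)
    then have "absv (fps_nth (fps_deriv f) n) * r ^ n \<le> absv (fps_nth f (Suc n)) * r ^ Suc n"
      using r by (intro mult_mono power_increasing) (auto simp: absv_nonneg)
    also have "\<dots> \<le> gnorm f r" using r by (intro gnorm_upper assms) auto
    finally show "absv (fps_nth (fps_deriv f) n) * r ^ n \<le> gnorm f r" .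
  qed
qed

text \<open>Integers have absolute value at most 1. The loss can be large when the dominant exponent
  is divisible by a high power of p.\<close>

lemma gnorm_deriv_le:
  assumes "entire absv f" "0 < r"
  shows "gnorm (fps_deriv f) r \<le> gnorm f r / r"
proof (rule gnorm_least)
  fix n
  have "absv (fps_nth (fps_deriv f) n) \<le> 1 * absv (fps_nth f (Suc n))"
    using mult_right_mono[OF absv_of_nat_le absv_nonneg, of "Suc n" "fps_nth f (Suc n)"]
    by (simp add: absv_mult del: of_nat_Suc)
  then have "absv (fps_nth (fps_deriv f) n) * r ^ Suc n \<le> absv (fps_nth f (Suc n)) * r ^ Suc n"
    using assms(2) by (intro mult_right_mono) auto
  also have "\<dots> \<le> gnorm f r" using assms by (intro gnorm_upper) auto
  finally show "absv (fps_nth (fps_deriv f) n) * r ^ n \<le> gnorm f r / r"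
    using assms(2) by (simp add: field_simps)
qed

lemma gnorm_add_le:
  assumes "entire absv f" "entire absv g" "0 \<le> r"
  shows "gnorm (f + g) r \<le> max (gnorm f r) (gnorm g r)"
proof (rule gnorm_least)
  fix n
  have "absv (fps_nth (f + g) n) * r ^ n \<le> max (absv (fps_nth f n)) (absv (fps_nth g n)) * r ^ n"
    using assms by (intro mult_right_mono) (auto simp: absv_add_le_max)
  also have "\<dots> \<le> max (gnorm f r) (gnorm g r)"
    using gnorm_upper[OF assms(1,3), of n] gnorm_upper[OF assms(2,3), of n] by (auto simp: max_def)
  finally show "absv (fps_nth (f + g) n) * r ^ n \<le> max (gnorm f r) (gnorm g r)" .
qed

lemma gnorm_minus: "gnorm (- f) r = gnorm f r"
  by (simp add: gnorm_def)

lemma gnorm_diff_le: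
  assumes "entire absv f" "entire absv g" "0 \<le> r"
  shows "gnorm (f - g) r \<le> max (gnorm f r) (gnorm g r)"
  using gnorm_add_le[OF assms(1) entire_minus(1)[OF assms(2)] assms(3)] by (simp add: gnorm_minus)

lemma gnorm_const: "0 \<le> r \<Longrightarrow> gnorm (fps_const c) r = absv c"
proof (rule antisym)
  assume r: "0 \<le> r"
  show "gnorm (fps_const c) r \<le> absv c"
    using r by (intro gnorm_least) (simp add: absv_nonneg)
  show "absv c \<le> gnorm (fps_const c) r"
    using gnorm_upper[OF entire_const[of c] r, of 0] by simp
qed

lemma gnorm_lin:
  assumes "absv z \<le> r"
  shows "gnorm (lin z) r = r"
proof (rule antisym)
  have r: "0 \<le> r" using assms absv_nonneg[of z] by linarith
  show "gnorm (lin z) r \<le> r"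
  proof (rule gnorm_least)
    fix n show "absv (fps_nth (lin z) n) * r ^ n \<le> r"
      using r assms by (cases "n \<le> 1") (auto simp: le_Suc_eq)
  qed
  show "r \<le> gnorm (lin z) r"
    using gnorm_upper[OF entire_lin[of z] r, of 1] by simp
qed

lemma gnorm_mono:
  assumes "entire absv f" "0 \<le> r" "r \<le> s"
  shows "gnorm f r \<le> gnorm f s"
proof (rule gnorm_least)
  fix n
  have "absv (fps_nth f n) * r ^ n \<le> absv (fps_nth f n) * s ^ n"
    using assms by (intro mult_left_mono power_mono absv_nonneg)
  also have "\<dots> \<le> gnorm f s" using assms by (intro gnorm_upper) auto
  finally show "absv (fps_nth f n) * r ^ n \<le> gnorm f s" .
qed

lemma deriv_expand:
  assumes "entire absv g" "f = fps_const c + lin z * g"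
  shows "entire_eval absv (fps_deriv f) z = entire_eval absv g z"
  by (simp add: assms(2) eval_add eval_mult entire_mult entire_deriv assms(1))

end

section \<open>Zeros of entire functions\<close>

text \<open>A list of roots records multiplicities, and \<open>l = 0\<close> represents the zero
  polynomial, so that \<open>poly_splits\<close> can cover every polynomial.\<close>

definition split_poly :: "'a::field \<Rightarrow> 'a list \<Rightarrow> 'a poly" where
  "split_poly l zs = smult l (\<Prod>z\<leftarrow>zs. [:-z, 1:])"

lemma split_poly_Nil: "split_poly l [] = [:l:]"
  by (simp add: split_poly_def)

lemma split_poly_Cons: "split_poly l (z # zs) = [:-z, 1:] * split_poly l zs"
  by (simp only: split_poly_def list.map prod_list.Cons mult_smult_right)

lemma poly_split_poly_eq_0: "z \<in> set zs \<Longrightarrow> poly (split_poly l zs) z = 0"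
  by (induction zs) (auto simp: split_poly_Cons simp del: mult_pCons_left)

lemma pcompose_split_poly:
  "pcompose (split_poly l zs) [:x, 1:] = split_poly l (map (\<lambda>z. z - x) zs)"
  by (induction zs) (simp_all add: split_poly_Nil split_poly_Cons pcompose_mult pcompose_pCons
      del: mult_pCons_left)

context padic_complex_field
begin

text \<open>Only coefficients from index n upwards contribute to the coefficient n of the translate,
  and \<open>absv x \<le> r\<close> keeps their terms from growing. This form allows a mere tail
  bound to be translated.\<close>

lemma coeff_translate_le:
  assumes "\<And>m. n \<le> m \<Longrightarrow> absv (coeff P m) * r ^ m \<le> B" "absv x \<le> r" "0 < r" "0 \<le> B"
  shows "absv (coeff (pcompose P [:x, 1:]) n) * r ^ n \<le> B"
  using assms(1,4)
proof (induction P arbitrary: n B)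
  case 0
  then show ?case by simp
next
  case (pCons a P)
  let ?Q = "pcompose P [:x, 1:]"
  have coeff: "coeff (pcompose (pCons a P) [:x, 1:]) i
      = (case i of 0 \<Rightarrow> a + x * coeff ?Q 0 | Suc j \<Rightarrow> x * coeff ?Q i + coeff ?Q j)" for i
    by (simp add: pcompose_pCons split: nat.split)
  have IH: "absv (coeff ?Q i) * r ^ i \<le> B / r" if "n \<le> Suc i" for i
  proof (rule pCons.IH)
    fix m assume "i \<le> m"
    then show "absv (coeff P m) * r ^ m \<le> B / r"
      using pCons.prems(1)[of "Suc m"] that assms(3) by (simp add: field_simps)
  qed (use pCons.prems(2) assms(3) in simp)
  have *: "absv (x * coeff ?Q i) \<le> B / r ^ i" if "n \<le> Suc i" for i
  proof -
    have "absv (x * coeff ?Q i) * r ^ i \<le> r * (absv (coeff ?Q i) * r ^ i)"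
      using mult_right_mono[OF assms(2), of "absv (coeff ?Q i) * r ^ i"] assms(3)
      by (simp add: absv_mult absv_nonneg mult.assoc)
    also have "\<dots> \<le> r * (B / r)" using IH[OF that] assms(3) by (intro mult_left_mono) auto
    finally show ?thesis using assms(3) by (simp add: field_simps)
  qed
  have "absv (coeff (pcompose (pCons a P) [:x, 1:]) n) \<le> B / r ^ n"
  proof (cases n)
    case 0
    then show ?thesis
      unfolding coeff using *[of 0] pCons.prems(1)[of 0] by (auto intro: absv_add_le)
  next
    case (Suc j)
    have "absv (coeff ?Q j) \<le> B / r ^ n" using IH[of j] Suc assms(3) by (simp add: field_simps)
    then show ?thesis
      unfolding coeff using *[of n] Suc by (auto intro: absv_add_le)
  qed
  then show ?case using assms(3) by (simp add: field_simps)
qed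

text \<open>Each factor X - z with \<open>d \<le> absv z\<close> has a dominant constant term at
  radius d, and products preserve this.\<close>

lemma coeff_split_poly_le:
  assumes "\<And>z. z \<in> set zs \<Longrightarrow> d \<le> absv z" "0 < d"
  shows "absv (coeff (split_poly l zs) n) * d ^ n \<le> absv (coeff (split_poly l zs) 0)"
  using assms(1)
proof (induction zs arbitrary: n)
  case Nil
  then show ?case by (cases n) (simp_all add: split_poly_Nil absv_nonneg)
next
  case (Cons z zs)
  let ?Q = "split_poly l zs"
  have IH: "absv (coeff ?Q i) * d ^ i \<le> absv (coeff ?Q 0)" for i using Cons by simp
  have z: "d \<le> absv z" using Cons.prems by simp
  have c: "coeff (split_poly l (z # zs)) i = - z * coeff ?Q i + (case i of 0 \<Rightarrow> 0 | Suc j \<Rightarrow> coeff ?Q j)" for i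
    by (simp add: split_poly_Cons split: nat.split)
  have dp: "0 < d ^ n" using assms(2) by simp
  have *: "absv (- z * coeff ?Q n) \<le> absv z * absv (coeff ?Q 0) / d ^ n"
    using mult_left_mono[OF IH[of n] absv_nonneg[of z]] dp by (simp add: absv_mult field_simps)
  have "absv (coeff (split_poly l (z # zs)) n) \<le> absv z * absv (coeff ?Q 0) / d ^ n"
  proof (cases n)
    case 0
    then show ?thesis using * c by simp
  next
    case (Suc j)
    have "d * (absv (coeff ?Q j) * d ^ j) \<le> absv z * absv (coeff ?Q 0)"
      using assms(2) z IH[of j] by (intro mult_mono) (auto simp: absv_nonneg)
    then have "absv (coeff ?Q j) \<le> absv z * absv (coeff ?Q 0) / d ^ n"
      using Suc dp by (simp add: field_simps)
    with * have "absv (- z * coeff ?Q n + coeff ?Q j) \<le> absv z * absv (coeff ?Q 0) / d ^ n"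
      by (rule absv_add_le)
    then show ?thesis by (simp only: c Suc nat.case)
  qed
  then show ?case using dp by (simp add: c absv_mult field_simps)
qed

lemma coeff_split_poly_less:
  assumes "\<And>z. z \<in> set zs \<Longrightarrow> r < absv z" "0 < r" "1 \<le> n" "coeff (split_poly l zs) 0 \<noteq> 0"
  shows "absv (coeff (split_poly l zs) n) * r ^ n < absv (coeff (split_poly l zs) 0)"
proof (cases "coeff (split_poly l zs) n = 0")
  case True
  then show ?thesis using assms(4) by (simp add: absv_pos)
next
  case False
  \<comment> \<open>The extra element r + 1 keeps the set nonempty when there are no roots.\<close>
  define d where "d = Min (insert (r + 1) (absv ` set zs))"
  have "d \<in> insert (r + 1) (absv ` set zs)" unfolding d_def by (intro Min_in) auto
  then have d: "r < d" using assms(1) by auto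
  have "absv (coeff (split_poly l zs) n) * r ^ n < absv (coeff (split_poly l zs) n) * d ^ n"
    using d assms(2,3) False by (intro mult_strict_left_mono power_strict_mono absv_pos) auto
  also have "\<dots> \<le> absv (coeff (split_poly l zs) 0)"
    using d assms(2) by (intro coeff_split_poly_le) (auto simp: d_def)
  finally show ?thesis .
qed

text \<open>
  If no root of \<open>P\<close> were close to \<open>x\<close>, then all coefficients of \<open>P\<close> expanded at \<open>x\<close> would be
  controlled by the small constant coefficient \<open>P(x)\<close>; but the Gauss norm is translation invariant.
\<close>

lemma split_poly_root_near:
  assumes r: "0 < r" "absv x \<le> r" and d: "0 < d" "d \<le> r"
    and tail: "\<And>m. N < m \<Longrightarrow> absv (coeff (split_poly l zs) m) * r ^ m \<le> B" and B: "0 \<le> B" "B < G"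
    and max: "G \<le> absv (coeff (split_poly l zs) k) * r ^ k"
    and small: "absv (poly (split_poly l zs) x) * (r / d) ^ N < G"
  shows "\<exists>z\<in>set zs. absv (z - x) < d"
proof (rule ccontr)
  assume "\<not> ?thesis"
  then have far: "d \<le> absv z" if "z \<in> set (map (\<lambda>z. z - x) zs)" for z using that by auto
  let ?P = "split_poly l zs"
  define Q where "Q = split_poly l (map (\<lambda>z. z - x) zs)"
  have Q: "Q = pcompose ?P [:x, 1:]" by (simp add: Q_def pcompose_split_poly)
  have Q0: "coeff Q 0 = poly ?P x"
    using poly_0_coeff_0[of Q] by (simp add: Q poly_pcompose)
  define B' where "B' = max B (absv (poly ?P x) * (r / d) ^ N)"
  have "B' < G" "0 \<le> B'" using B small by (auto simp: B'_def)
  have "absv (coeff Q n) * r ^ n \<le> B'" for n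
  \<comment> \<open>Up to index \<open>N\<close>, passing from radius d to r costs at most (r /
    d)^N; beyond it the tail bound takes over. The cost is thus independent of the degree, which is
    unbounded for approximants of an entire series.\<close>
  proof (cases "n \<le> N")
    case True
    have "absv (coeff Q n) * r ^ n = (absv (coeff Q n) * d ^ n) * (r / d) ^ n"
      using d by (simp add: power_divide)
    also have "\<dots> \<le> absv (coeff Q 0) * (r / d) ^ N"
      unfolding Q_def using d True far
      by (intro mult_mono coeff_split_poly_le power_increasing) (auto simp: absv_nonneg)
    finally show ?thesis by (simp add: Q0 B'_def)
  next
    case False
    then have "absv (coeff Q n) * r ^ n \<le> B"
      unfolding Q using r B by (intro coeff_translate_le tail) auto
    then show ?thesis by (simp add: B'_def)
  qed
  then have "absv (coeff (pcompose Q [:- x, 1:]) k) * r ^ k \<le> B'"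
    using r \<open>0 \<le> B'\<close> by (intro coeff_translate_le) auto
  moreover have "pcompose Q [:- x, 1:] = ?P"
    by (simp add: Q_def pcompose_split_poly o_def)
  ultimately show False using max \<open>B' < G\<close> by simp
qed

lemma poly_absv_le:
  assumes "\<And>n. absv (coeff P n) * r ^ n \<le> B" "absv x \<le> r"
  shows "absv (poly P x) \<le> B"
proof (rule absv_limit_le[OF fps_of_poly_sums])
  fix n
  have "absv (coeff P n) * absv x ^ n \<le> absv (coeff P n) * r ^ n"
    using assms(2) by (intro mult_left_mono power_mono absv_nonneg)
  also have "\<dots> \<le> B" by (rule assms)
  finally show "absv (fps_nth (fps_of_poly P) n) * absv x ^ n \<le> B" by simp
qed

lemma eval_at_0:
  assumes "entire absv f"
  shows "entire_eval absv f 0 = fps_nth f 0"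
proof -
  obtain g where g: "entire absv g" "f = fps_const (entire_eval absv f 0) + lin 0 * g"
    by (rule entire_expand[OF assms])
  show ?thesis by (subst (2) g(2)) simp
qed

text \<open>Every approximant has a root in the disc, and even one close to a given root of its
  predecessor; these roots converge to a zero of \<open>f\<close>. Approximability is a hypothesis
  so that the lemma serves twice: for polynomials before they are known to split, and for entire
  series through their truncations.\<close>

lemma entire_has_zero_approx:
  assumes f: "entire absv f" and r: "0 < r" and k: "1 \<le> k" "fps_nth f k \<noteq> 0"
    and dom: "absv (fps_nth f 0) \<le> absv (fps_nth f k) * r ^ k"
    and approx: "\<And>\<epsilon>. 0 < \<epsilon> \<Longrightarrow> \<exists>l zs. \<forall>n. absv (coeff (split_poly l zs) n - fps_nth f n) * r ^ n \<le> \<epsilon>"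
  shows "\<exists>x. absv x \<le> r \<and> entire_eval absv f x = 0"
proof (cases "fps_nth f 0 = 0")
  case True
  then show ?thesis using r by (intro exI[of _ 0]) (simp add: eval_at_0 f)
next
  case f0: False
  define G where "G = gnorm f r"
  have G: "0 < G" unfolding G_def using f r k by (intro gnorm_pos) auto
  have "\<forall>\<^sub>F n in sequentially. absv (fps_nth f n) * r ^ n < G / 2"
    using f r G by (intro order_tendstoD[OF entire_tendsto]) auto
  then obtain N0 where N0: "\<And>n. n \<ge> N0 \<Longrightarrow> absv (fps_nth f n) * r ^ n < G / 2"
    by (auto simp: eventually_sequentially)
  \<comment> \<open>The successor makes \<open>N\<close> positive, so that (1/2)^N < 1 and the
    errors below tend to 0.\<close>
  define N where "N = Suc N0"
  \<comment> \<open>The first bound preserves the size of the constant coefficient; the second pays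
    for the loss (2^j)^N in \<open>split_poly_root_near\<close> at distance r / 2^j.\<close>
  define e where "e j = min (absv (fps_nth f 0) / 2) (G / 2 * ((1/2) ^ N) ^ j)" for j
  have e_pos: "0 < e j" for j using f0 G by (simp add: e_def absv_pos)
  have e_G: "e j * (2 ^ j) ^ N \<le> G / 2" for j
  proof -
    have "e j * (2 ^ j) ^ N \<le> G / 2 * ((1/2) ^ N) ^ j * (2 ^ j) ^ N"
      by (intro mult_right_mono) (auto simp: e_def)
    also have "\<dots> = G / 2"
      by (simp add: power_mult[symmetric] mult.commute[of N] power_one_over)
    finally show ?thesis .
  qed
  have q3: "(1/2 :: real) ^ N < 1" unfolding N_def by (rule power_Suc_less_one) auto
  then have q: "(1/2 :: real) ^ N \<le> 1" "0 \<le> (1/2 :: real) ^ N" by auto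
  have e_mono: "e (Suc j) \<le> e j" for j
  proof -
    have "((1/2 :: real) ^ N) ^ Suc j \<le> ((1/2) ^ N) ^ j" using q by (intro power_decreasing) auto
    then have "G / 2 * ((1/2) ^ N) ^ Suc j \<le> G / 2 * ((1/2) ^ N) ^ j" using G by (intro mult_left_mono) auto
    then show ?thesis unfolding e_def by linarith
  qed
  have e_le_G: "e j \<le> G / 2" for j
  proof -
    have "((1/2 :: real) ^ N) ^ j \<le> 1" by (rule power_le_one[OF q(2,1)])
    then have "G / 2 * ((1/2) ^ N) ^ j \<le> G / 2 * 1" using G by (intro mult_left_mono) auto
    then show ?thesis unfolding e_def by linarith
  qed
  have "\<forall>j. \<exists>lz. \<forall>n. absv (coeff (split_poly (fst lz) (snd lz)) n - fps_nth f n) * r ^ n \<le> e j"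
    using approx[OF e_pos] by force
  then obtain lz where "\<forall>j. \<forall>n. absv (coeff (split_poly (fst (lz j)) (snd (lz j))) n - fps_nth f n) * r ^ n \<le> e j"
    by (rule choice[THEN exE])
  note lz = this
  define l where "l j = fst (lz j)" for j
  define zs where "zs j = snd (lz j)" for j
  define P where "P j = split_poly (l j) (zs j)" for j
  have P: "absv (coeff (P j) n - fps_nth f n) * r ^ n \<le> e j" for j n
    using lz by (simp add: P_def l_def zs_def)
  have coeff_eq: "absv (coeff (P j) n) = absv (fps_nth f n)" if "e j < absv (fps_nth f n) * r ^ n" for j n
  proof (rule absv_eqI)
    have "absv (coeff (P j) n - fps_nth f n) * r ^ n < absv (fps_nth f n) * r ^ n"
      using P[of j n] that by linarith
    then show "absv (coeff (P j) n - fps_nth f n) < absv (fps_nth f n)"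
      using r by simp
  qed
  have e_f0: "e j < absv (fps_nth f 0)" for j
    using absv_pos[OF f0] by (simp add: e_def)
  obtain m where m: "absv (fps_nth f m) * r ^ m = G"
    unfolding G_def using gnorm_attained[OF f r] by blast
  have max: "G \<le> absv (coeff (P j) m) * r ^ m" for j
    using coeff_eq[of j m] e_le_G[of j] G m by simp
  have tail: "absv (coeff (P j) n) * r ^ n \<le> G / 2" if "N < n" for j n
  proof -
    have "absv (coeff (P j) n - fps_nth f n) \<le> G / 2 / r ^ n"
      using P[of j n] e_le_G[of j] r by (simp add: field_simps)
    moreover have "absv (fps_nth f n) \<le> G / 2 / r ^ n"
      using N0[of n] that r by (simp add: field_simps N_def)
    ultimately have "absv (coeff (P j) n - fps_nth f n + fps_nth f n) \<le> G / 2 / r ^ n"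
      by (rule absv_add_le)
    then show ?thesis using r by (simp add: field_simps)
  qed
  \<comment> \<open>With all roots outside the disc the constant coefficient would strictly
    dominate, but the coefficients 0 and k have the same sizes as those of \<open>f\<close>.\<close>
  have root0: "\<exists>x. absv x \<le> r \<and> poly (P j) x = 0" for j
  proof (rule ccontr)
    assume "\<not> ?thesis"
    then have far: "r < absv z" if "z \<in> set (zs j)" for z
      using poly_split_poly_eq_0[OF that, of "l j"] by (auto simp: P_def not_le)
    have 0: "absv (coeff (P j) 0) = absv (fps_nth f 0)"
      using coeff_eq[of j 0] e_f0 by simp
    have "absv (coeff (P j) k) = absv (fps_nth f k)"
      using dom e_f0[of j] by (intro coeff_eq) linarith
    then have "absv (coeff (P j) 0) \<le> absv (coeff (P j) k) * r ^ k"
      using dom 0 by simp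
    moreover have "absv (coeff (P j) k) * r ^ k < absv (coeff (P j) 0)"
      unfolding P_def using far r k 0 f0 by (intro coeff_split_poly_less) (auto simp: P_def absv_eq_0_iff)
    ultimately show False by simp
  qed
  have step: "\<exists>y. (absv y \<le> r \<and> poly (P (Suc j)) y = 0) \<and> absv (y - x) \<le> r / 2 ^ j"
    if x: "absv x \<le> r \<and> poly (P j) x = 0" for x j
  proof -
    \<comment> \<open>As \<open>x\<close> is a root of \<open>P j\<close>, this bounds the value of
      the next approximant at \<open>x\<close>.\<close>
    have "absv (poly (P (Suc j) - P j) x) \<le> e j"
    proof (rule poly_absv_le)
      fix n
      have "absv (coeff (P (Suc j)) n - fps_nth f n) \<le> e j / r ^ n"
        using P[of "Suc j" n] e_mono[of j] r by (simp add: field_simps)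
      moreover have "absv (coeff (P j) n - fps_nth f n) \<le> e j / r ^ n"
        using P[of j n] r by (simp add: field_simps)
      ultimately have "absv ((coeff (P (Suc j)) n - fps_nth f n) - (coeff (P j) n - fps_nth f n)) \<le> e j / r ^ n"
        by (rule absv_diff_le)
      then show "absv (coeff (P (Suc j) - P j) n) * r ^ n \<le> e j"
        using r by (simp add: field_simps)
    qed (use x in simp)
    then have small: "absv (poly (P (Suc j)) x) \<le> e j" using x by simp
    have "\<exists>z\<in>set (zs (Suc j)). absv (z - x) < r / 2 ^ j"
    proof (rule split_poly_root_near[where r = r and N = N and B = "G / 2" and G = G and k = m])
      show "absv (poly (split_poly (l (Suc j)) (zs (Suc j))) x) * (r / (r / 2 ^ j)) ^ N < G"
      proof -
        have "absv (poly (P (Suc j)) x) * (2 ^ j) ^ N \<le> e j * (2 ^ j) ^ N"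
          using small by (intro mult_right_mono) auto
        also have "\<dots> < G" using e_G[of j] G by linarith
        finally show ?thesis using r by (simp add: P_def)
      qed
      show "G \<le> absv (coeff (split_poly (l (Suc j)) (zs (Suc j))) m) * r ^ m"
        using max by (simp add: P_def)
      show "absv (coeff (split_poly (l (Suc j)) (zs (Suc j))) n) * r ^ n \<le> G / 2" if "N < n" for n
        using tail[OF that] by (simp add: P_def)
    qed (use r G x in \<open>auto simp: field_simps\<close>)
    then obtain z where z: "z \<in> set (zs (Suc j))" "absv (z - x) < r / 2 ^ j" by blast
    have "r / 2 ^ j \<le> r" using r by (simp add: field_simps)
    then have "absv (z - x + x) \<le> r"
      using z(2) x by (intro absv_add_le) auto
    then show ?thesis
      using z poly_split_poly_eq_0[OF z(1)] by (intro exI[of _ z]) (auto simp: P_def)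
  qed
  obtain x where x: "\<And>j. absv (x j) \<le> r \<and> poly (P j) (x j) = 0"
    and x_step: "\<And>j. absv (x (Suc j) - x j) \<le> r / 2 ^ j"
    using dependent_nat_choice[of "\<lambda>j x. absv x \<le> r \<and> poly (P j) x = 0" "\<lambda>j x y. absv (y - x) \<le> r / 2 ^ j"]
      root0 step by blast
  have "(\<lambda>j. r * (1/2) ^ j) \<longlonglongrightarrow> r * 0"
    by (intro tendsto_mult_left LIMSEQ_power_zero) simp
  then have "(\<lambda>j. r / 2 ^ j) \<longlonglongrightarrow> 0" by (simp add: power_one_over field_simps)
  then obtain y where y: "(\<lambda>j. absv (x j - y)) \<longlonglongrightarrow> 0"
    using ultrametric_cauchy[of "\<lambda>j. r / 2 ^ j" x] x_step by metis
  have "absv y \<le> r"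
  proof -
    obtain j where "absv (x j - y) < r"
      using order_tendstoD(2)[OF y r] by (auto simp: eventually_sequentially)
    then show ?thesis using absv_diff_le[of "x j" r "x j - y"] x[of j] by simp
  qed
  obtain g where g: "entire absv g" "f = fps_const (entire_eval absv f y) + lin y * g"
    by (rule entire_expand[OF f])
  \<comment> \<open>The value at y is compared with the value at \<open>x j\<close>, where
    \<open>f\<close> agrees with the small series \<open>f - P j\<close>.\<close>
  have bound: "absv (entire_eval absv f y) \<le> e j + absv (x j - y) * gnorm g r" for j
  proof -
    have "entire_eval absv f (x j) = entire_eval absv f y + (x j - y) * entire_eval absv g (x j)"
      by (subst g(2)) (simp add: eval_add eval_mult entire_mult g(1))
    then have eq: "entire_eval absv f y = entire_eval absv f (x j) - (x j - y) * entire_eval absv g (x j)"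
      by simp
    have "entire_eval absv (f - fps_of_poly (P j)) (x j) = entire_eval absv f (x j)"
      using x[of j] by (simp add: eval_diff f)
    moreover have "absv (entire_eval absv (f - fps_of_poly (P j)) (x j)) \<le> gnorm (f - fps_of_poly (P j)) r"
      using x[of j] by (intro absv_eval_le entire_diff f) auto
    moreover have "gnorm (f - fps_of_poly (P j)) r \<le> e j"
      using P[of j] by (intro gnorm_least) (simp add: absv_diff_commute)
    ultimately have 1: "absv (entire_eval absv f (x j)) \<le> e j" by simp
    have 2: "absv ((x j - y) * entire_eval absv g (x j)) \<le> absv (x j - y) * gnorm g r"
      using x[of j] by (simp add: absv_mult absv_nonneg mult_left_mono absv_eval_le g(1))
    show ?thesis
      unfolding eq using 1 2 absv_diff_le_max[of "entire_eval absv f (x j)" "(x j - y) * entire_eval absv g (x j)"]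
        e_pos[of j] absv_nonneg[of "(x j - y) * entire_eval absv g (x j)"] by linarith
  qed
  have "(\<lambda>j. G / 2 * ((1/2) ^ N) ^ j) \<longlonglongrightarrow> G / 2 * 0"
    using q3 by (intro tendsto_mult_left LIMSEQ_power_zero) auto
  then have "(\<lambda>j. G / 2 * ((1/2) ^ N) ^ j) \<longlonglongrightarrow> 0" by simp
  then have e_lim: "e \<longlonglongrightarrow> 0"
  proof (rule Lim_null_comparison[rotated])
    show "\<forall>\<^sub>F j in sequentially. norm (e j) \<le> G / 2 * ((1/2) ^ N) ^ j"
      using e_pos by (intro always_eventually allI) (simp add: abs_of_pos, simp add: e_def)
  qed
  have "(\<lambda>j. e j + absv (x j - y) * gnorm g r) \<longlonglongrightarrow> 0 + 0 * gnorm g r"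
    by (intro tendsto_add e_lim tendsto_mult_right y)
  then have "absv (entire_eval absv f y) \<le> 0 + 0 * gnorm g r"
    by (rule LIMSEQ_le_const) (use bound in blast)
  then show ?thesis using \<open>absv y \<le> r\<close> absv_pos[of "entire_eval absv f y"] by fastforce
qed

section \<open>Algebraic closedness and separability of the field; the criterion for zeros\<close>

lemma absv_closure_of:
  "absv_topology absv closure_of A = {x. \<forall>\<epsilon>>0. \<exists>y\<in>A. absv (y - x) < \<epsilon>}"
proof -
  interpret Metric_space UNIV "absv_dist absv"
    by (rule Metric_space_absv_dist)
  show ?thesis
    by (simp add: metric_closure_of in_mball absv_dist_def absv_diff_commute)
qed

lemma padic_number_approx:
  assumes "x \<in> padic_numbers absv" "0 < \<epsilon>"
  obtains q where "absv (of_rat q - x) < \<epsilon>"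
  using assms unfolding padic_numbers_def absv_closure_of by blast

lemma of_rat_padic_number: "of_rat q \<in> padic_numbers absv"
  unfolding padic_numbers_def absv_closure_of by (auto intro!: exI[of _ q])

lemma algebraic_over_approx:
  assumes "0 < \<epsilon>"
  obtains y where "y \<in> algebraic_over (padic_numbers absv)" "absv (y - x) < \<epsilon>"
proof -
  have "x \<in> absv_topology absv closure_of algebraic_over (padic_numbers absv)"
    using dense by simp
  then show thesis using assms that unfolding absv_closure_of by blast
qed

text \<open>\<open>algebraically_closed_in\<close> constrains all coefficients, including the zeros
  beyond the degree.\<close>

lemma zero_algebraic_over: "0 \<in> algebraic_over (padic_numbers absv)"
proof -
  have "coeff [:0, 1 :: 'a:] i = of_rat (coeff [:0, 1:] i)" for i
    by (simp add: coeff_pCons split: nat.split)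
  then have "\<forall>i. coeff [:0, 1 :: 'a:] i \<in> padic_numbers absv"
    using of_rat_padic_number by metis
  then show ?thesis by (auto simp: algebraic_over_def intro!: exI[of _ "[:0, 1:]"])
qed

lemma dominating_radius:
  assumes "1 \<le> k" "c \<noteq> 0"
  obtains r where "1 \<le> r" "b \<le> absv c * r ^ k"
proof -
  define r where "r = max 1 (b / absv c)"
  have r: "1 \<le> r" by (simp add: r_def)
  have "b / absv c \<le> r" by (simp add: r_def)
  also have "r \<le> r ^ k" using r assms(1) by (intro self_le_power) auto
  finally have "b \<le> absv c * r ^ k" using absv_pos[OF assms(2)] by (simp add: field_simps)
  then show thesis using that r by blast
qed

text \<open>
  Krasner: approximate the coefficients by elements of the algebraic closure of \<open>\<rat>\<^sub>p\<close>. The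
  approximating polynomial has a root there, so it splits by the induction hypothesis.
\<close>

lemma poly_splits: "\<exists>l zs. (P :: 'a poly) = split_poly l zs"
proof (induction "degree P" arbitrary: P rule: less_induct)
  case less
  let ?K = "algebraic_over (padic_numbers absv)"
  have split_root: "\<exists>l zs. Q = split_poly l zs" if "poly Q a = 0" "degree Q \<le> degree P" "Q \<noteq> 0" for Q :: "'a poly" and a
  proof -
    obtain R where R: "Q = [:-a, 1:] * R" using \<open>poly Q a = 0\<close> by (metis poly_eq_0_iff_dvd dvdE)
    then have "R \<noteq> 0" using that by auto
    then have "degree Q = Suc (degree R)" unfolding R by (subst degree_mult_eq) auto
    then have "degree R < degree P" using \<open>degree Q \<le> degree P\<close> by simp
    then obtain l zs where "R = split_poly l zs" using less by blast
    then have "Q = split_poly l (a # zs)" by (simp add: split_poly_Cons R)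
    then show ?thesis by blast
  qed
  show ?case
  proof (cases "degree P = 0")
    case True
    then obtain c where "P = [:c:]" by (rule degree_eq_zeroE)
    then have "P = split_poly c []" by (simp add: split_poly_Nil)
    then show ?thesis by blast
  next
    case False
    define n where "n = degree P"
    have n: "1 \<le> n" using False by (simp add: n_def)
    have cn: "coeff P n \<noteq> 0" using False by (auto simp: n_def leading_coeff_0_iff)
    obtain r where r: "1 \<le> r" "absv (coeff P 0) \<le> absv (coeff P n) * r ^ n"
      using dominating_radius[OF n cn] by blast
    have "\<exists>x. absv x \<le> r \<and> entire_eval absv (fps_of_poly P) x = 0"
    proof (rule entire_has_zero_approx[where k = n])
      fix \<epsilon> :: real assume "0 < \<epsilon>"
      \<comment> \<open>The second bound keeps the leading coefficient of the approximant nonzero,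
        so that its degree is exactly n.\<close>
      define \<epsilon>' where "\<epsilon>' = min (\<epsilon> / r ^ n) (absv (coeff P n))"
      have e': "0 < \<epsilon>'" using r \<open>0 < \<epsilon>\<close> cn by (simp add: \<epsilon>'_def absv_pos)
      have "\<exists>c. \<forall>i. c i \<in> ?K \<and> absv (c i - coeff P i) < \<epsilon>'"
        by (rule choice, rule allI, rule algebraic_over_approx[OF e']) blast
      then obtain c where c: "\<And>i. c i \<in> ?K" "\<And>i. absv (c i - coeff P i) < \<epsilon>'" by blast
      define Q where "Q = (\<Sum>i\<le>n. monom (c i) i)"
      have coeff_Q: "coeff Q i = (if i \<le> n then c i else 0)" for i
        by (simp add: Q_def coeff_sum)
      have "c n \<noteq> 0" using c(2)[of n] by (auto simp: \<epsilon>'_def)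
      then have "degree Q = n"
        by (intro antisym degree_le le_degree) (auto simp: coeff_Q)
      then have "\<exists>x\<in>?K. poly Q x = 0"
        using algebraic_closure n c(1) zero_algebraic_over
        unfolding algebraically_closed_in_def by (auto simp: coeff_Q)
      then obtain l zs where Q: "Q = split_poly l zs"
        using split_root[of Q] \<open>degree Q = n\<close> n by (force simp: n_def)
      have "absv (coeff Q i - fps_nth (fps_of_poly P) i) * r ^ i \<le> \<epsilon>" for i
      proof (cases "i \<le> n")
        case True
        have "absv (coeff Q i - coeff P i) \<le> \<epsilon> / r ^ n"
          using c(2)[of i] True by (simp add: coeff_Q \<epsilon>'_def)
        then have "absv (coeff Q i - coeff P i) * r ^ i \<le> \<epsilon> / r ^ n * r ^ n"
          using True r \<open>0 < \<epsilon>\<close> by (intro mult_mono power_increasing) auto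
        then show ?thesis using r by simp
      next
        case False
        then show ?thesis using \<open>0 < \<epsilon>\<close> by (simp add: coeff_Q n_def coeff_eq_0)
      qed
      then show "\<exists>l zs. \<forall>i. absv (coeff (split_poly l zs) i - fps_nth (fps_of_poly P) i) * r ^ i \<le> \<epsilon>"
        unfolding Q by blast
    qed (use r n cn in auto)
    then obtain x where "poly P x = 0" by auto
    then show ?thesis by (rule split_root) (use False in auto)
  qed
qed

lemma countable_poly: "countable (UNIV :: rat poly set)"
proof -
  have "(UNIV :: rat poly set) \<subseteq> Poly ` UNIV"
    by (auto intro!: range_eqI[of _ _ "coeffs _"] simp: Poly_coeffs)
  then show ?thesis by (rule countable_subset) auto
qed

text \<open>Roots of rational polynomials are dense: an element algebraic over the p-adic numbers is
  almost a root of a polynomial with nearby rational coefficients, and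
  \<open>split_poly_root_near\<close> finds a true root close to it.\<close>

lemma countable_dense:
  obtains D :: "'a set" where "countable D" "\<And>x \<epsilon>. 0 < \<epsilon> \<Longrightarrow> \<exists>d\<in>D. absv (d - x) < \<epsilon>"
proof
  define D :: "'a set" where "D = (\<Union>P\<in>{P :: rat poly. P \<noteq> 0}. {x. poly (map_poly of_rat P) x = 0})"
  have map0: "map_poly of_rat P \<noteq> (0 :: 'a poly)" if "P \<noteq> 0" for P :: "rat poly"
    using that by (auto simp: poly_eq_iff coeff_map_poly)
  show "countable D"
    unfolding D_def
    by (intro countable_UN countable_subset[OF subset_UNIV countable_poly] countable_finite poly_roots_finite)
      (auto simp: map0)
  fix x and \<epsilon> :: real assume "0 < \<epsilon>"
  obtain k where k: "k \<in> algebraic_over (padic_numbers absv)" "absv (k - x) < \<epsilon>"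
    using algebraic_over_approx[OF \<open>0 < \<epsilon>\<close>] by blast
  then obtain P where P: "P \<noteq> 0" "\<And>i. coeff P i \<in> padic_numbers absv" "poly P k = 0"
    by (auto simp: algebraic_over_def)
  define n where "n = degree P"
  define r where "r = max 1 (absv k)"
  define d where "d = min \<epsilon> r"
  have r: "1 \<le> r" "absv k \<le> r" and d: "0 < d" "d \<le> r" "d \<le> \<epsilon>"
    using \<open>0 < \<epsilon>\<close> by (auto simp: r_def d_def)
  define G where "G = absv (coeff P n) * r ^ n"
  have G: "0 < G" using P(1) r by (simp add: G_def n_def absv_pos)
  \<comment> \<open>A value of size e at \<open>k\<close> survives the loss (r / d)^n in
    \<open>split_poly_root_near\<close>; being below \<open>G\<close>, the error also preserves the
    size of the leading coefficient.\<close>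
  define e where "e = G / 2 / (r / d) ^ n"
  have e: "0 < e" "e * (r / d) ^ n < G" using G r d by (auto simp: e_def)
  have "1 \<le> (r / d) ^ n" using r d by (intro one_le_power) auto
  then have eG: "e < G" using G by (simp add: e_def divide_less_eq)
  have "0 < e / r ^ n" using e(1) r by simp
  then have "\<forall>i. \<exists>q. absv (of_rat q - coeff P i) < e / r ^ n"
    using padic_number_approx[OF P(2)] by metis
  then have "\<exists>c. \<forall>i. absv (of_rat (c i) - coeff P i) < e / r ^ n"
    by (rule choice)
  then obtain c where c: "\<And>i. absv (of_rat (c i) - coeff P i) < e / r ^ n" by blast
  define Q where "Q = (\<Sum>i\<le>n. monom (c i) i)"
  define R :: "'a poly" where "R = map_poly of_rat Q"
  have coeff_R: "coeff R i = (if i \<le> n then of_rat (c i) else 0)" for i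
    by (simp add: R_def Q_def coeff_map_poly coeff_sum)
  have approx: "absv (coeff (R - P) i) * r ^ i \<le> e" for i
  proof (cases "i \<le> n")
    case True
    have "absv (coeff (R - P) i) * r ^ i \<le> e / r ^ n * r ^ n"
      using c[of i] True r e by (intro mult_mono power_increasing) (auto simp: coeff_R)
    then show ?thesis using r by simp
  next
    case False
    then show ?thesis using e by (simp add: coeff_R n_def coeff_eq_0)
  qed
  have "absv (coeff R n - coeff P n) * r ^ n < absv (coeff P n) * r ^ n"
    using approx[of n] eG by (simp add: G_def)
  then have "absv (coeff R n - coeff P n) < absv (coeff P n)" using r by simp
  then have Rn: "absv (coeff R n) = absv (coeff P n)" by (rule absv_eqI)
  have Rk: "absv (poly R k) \<le> e"
    using poly_absv_le[OF approx r(2)] P(3) by simp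
  obtain l zs where R: "R = split_poly l zs" using poly_splits by blast
  have "\<exists>z\<in>set zs. absv (z - k) < d"
  proof (rule split_poly_root_near[where r = r and N = n and B = 0 and G = G and k = n])
    show "absv (poly (split_poly l zs) k) * (r / d) ^ n < G"
    proof -
      have "absv (poly R k) * (r / d) ^ n \<le> e * (r / d) ^ n"
        using Rk r d by (intro mult_right_mono) auto
      then show ?thesis using e by (simp add: R)
    qed
    show "absv (coeff (split_poly l zs) m) * r ^ m \<le> 0" if "n < m" for m
      using coeff_R[of m] that by (simp add: R)
    show "G \<le> absv (coeff (split_poly l zs) n) * r ^ n"
      using Rn by (simp add: R G_def)
  qed (use r d G in auto)
  then obtain z where z: "z \<in> set zs" "absv (z - k) < d" by blast
  have "poly R z = 0" unfolding R using z(1) by (rule poly_split_poly_eq_0)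
  moreover have "Q \<noteq> 0" using Rn P(1) by (auto simp: R_def n_def absv_eq_0_iff)
  ultimately have "z \<in> D" by (auto simp: D_def R_def)
  moreover have "absv (z - x) < \<epsilon>"
    using absv_diff_less[of "z - k" \<epsilon> "x - k"] z(2) d k(2) by (simp add: absv_diff_commute)
  ultimately show "\<exists>d\<in>D. absv (d - x) < \<epsilon>" by auto
qed

text \<open>The truncations of \<open>f\<close> approximate it in Gauss norm, and they split by
  \<open>poly_splits\<close>.\<close>

lemma entire_has_zero:
  assumes f: "entire absv f" and r: "0 < r" and k: "1 \<le> k" "fps_nth f k \<noteq> 0"
    and dom: "absv (fps_nth f 0) \<le> absv (fps_nth f k) * r ^ k"
  shows "\<exists>x. absv x \<le> r \<and> entire_eval absv f x = 0"
proof (rule entire_has_zero_approx[OF assms])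
  fix \<epsilon> :: real assume "0 < \<epsilon>"
  then obtain N where N: "\<And>n. N \<le> n \<Longrightarrow> absv (fps_nth f n) * r ^ n < \<epsilon>"
    using order_tendstoD(2)[OF entire_tendsto[OF f], of r \<epsilon>] r by (auto simp: eventually_sequentially)
  define Q where "Q = (\<Sum>i<N. monom (fps_nth f i) i)"
  have coeff_Q: "coeff Q i = (if i < N then fps_nth f i else 0)" for i
    by (simp add: Q_def coeff_sum)
  obtain l zs where Q: "Q = split_poly l zs" using poly_splits by blast
  have "absv (coeff Q i - fps_nth f i) * r ^ i \<le> \<epsilon>" for i
    using N[of i] \<open>0 < \<epsilon>\<close> by (cases "i < N") (auto simp: coeff_Q)
  then show "\<exists>l zs. \<forall>n. absv (coeff (split_poly l zs) n - fps_nth f n) * r ^ n \<le> \<epsilon>"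
    unfolding Q by blast
qed

text \<open>Subtracting y changes only the constant coefficient, and the k-th term dominates that
  one at a large radius.\<close>

lemma entire_surj:
  assumes f: "entire absv f" and "1 \<le> k" "fps_nth f k \<noteq> 0"
  shows "\<exists>x. entire_eval absv f x = y"
proof -
  obtain r where "1 \<le> r" "absv (fps_nth f 0 - y) \<le> absv (fps_nth f k) * r ^ k"
    using dominating_radius[OF assms(2,3)] by blast
  then obtain x where "entire_eval absv (f - fps_const y) x = 0"
    using entire_has_zero[of "f - fps_const y" r k] assms by (auto simp: entire_diff)
  then show ?thesis by (auto simp: eval_diff f)
qed

section \<open>Division of entire functions\<close>

lemma coeff_less_of_zero_free:
  assumes g: "entire absv g" and r: "0 < r" and zf: "\<And>x. absv x \<le> r \<Longrightarrow> entire_eval absv g x \<noteq> 0"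
    and n: "1 \<le> n"
  shows "absv (fps_nth g n) * r ^ n < absv (fps_nth g 0)"
proof (cases "fps_nth g n = 0")
  case True
  have "fps_nth g 0 \<noteq> 0" using zf[of 0] r by (simp add: eval_at_0 g)
  then show ?thesis using True by (simp add: absv_pos)
next
  case False
  then show ?thesis using entire_has_zero[OF g r n False] zf by fastforce
qed

section \<open>Zeros in a disc and exact division\<close>

abbreviation linprod :: "'a list \<Rightarrow> 'a fps" where
  "linprod zs \<equiv> (\<Prod>z\<leftarrow>zs. lin z)"

lemma entire_linprod: "entire absv (linprod zs)"
  by (induction zs) (auto intro: entire_mult)

lemma linprod_replicate: "linprod (replicate m z) = lin z ^ m"
  by (induction m) auto

lemma gnorm_linprod:
  "0 < r \<Longrightarrow> (\<And>z. z \<in> set zs \<Longrightarrow> absv z \<le> r) \<Longrightarrow> gnorm (linprod zs) r = r ^ length zs"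
proof (induction zs)
  case Nil
  then show ?case using gnorm_const[of r 1] by simp
next
  case (Cons z zs)
  then show ?case by (simp add: gnorm_mult entire_linprod gnorm_lin)
qed

text \<open>Doubling the radius contributes a factor 2 to the Gauss norm for each linear factor and
  does not decrease that of the cofactor, so 2^length is at most the ratio of the norms at 2 r and
  r.\<close>

lemma linprod_length_bounded:
  assumes f: "entire absv f" "f \<noteq> 0" and r: "0 < r"
  shows "\<exists>N. \<forall>zs g. entire absv g \<and> f = linprod zs * g \<and> (\<forall>z\<in>set zs. absv z \<le> r) \<longrightarrow> length zs \<le> N"
proof -
  define N where "N = nat \<lceil>gnorm f (2 * r) / gnorm f r\<rceil>"
  have "length zs \<le> N" if g: "entire absv g" "f = linprod zs * g" "\<forall>z\<in>set zs. absv z \<le> r" for zs g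
  proof -
    have pos: "0 < gnorm f r" by (rule gnorm_pos[OF f(1) r f(2)])
    have 1: "gnorm f r = r ^ length zs * gnorm g r"
      using g r by (simp add: gnorm_mult entire_linprod gnorm_linprod)
    have "absv z \<le> 2 * r" if "z \<in> set zs" for z using g(3) that r by fastforce
    then have "gnorm f (2 * r) = (2 * r) ^ length zs * gnorm g (2 * r)"
      using g(1,2) r by (simp add: gnorm_mult entire_linprod gnorm_linprod)
    moreover have "(2 * r) ^ length zs * gnorm g r \<le> (2 * r) ^ length zs * gnorm g (2 * r)"
      using r by (intro mult_left_mono gnorm_mono g) auto
    ultimately have "2 ^ length zs * gnorm f r \<le> gnorm f (2 * r)"
      using 1 by (simp add: power_mult_distrib mult.assoc)
    then have "2 ^ length zs \<le> gnorm f (2 * r) / gnorm f r" using pos by (simp add: field_simps)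
    moreover have "real (length zs) \<le> 2 ^ length zs" using of_nat_less_two_power[of "length zs"] by (simp add: less_imp_le)
    ultimately show ?thesis unfolding N_def by linarith
  qed
  then show ?thesis by blast
qed

text \<open>In a factorization with the longest list, a zero left in the disc would lengthen the
  list.\<close>

lemma disc_factor:
  assumes f: "entire absv f" "f \<noteq> 0" and r: "0 < r"
  obtains zs g where "entire absv g" "f = linprod zs * g" "\<And>z. z \<in> set zs \<Longrightarrow> absv z \<le> r"
    "\<And>x. absv x \<le> r \<Longrightarrow> entire_eval absv g x \<noteq> 0"
proof -
  let ?P = "\<lambda>(zs, g). entire absv g \<and> f = linprod zs * g \<and> (\<forall>z\<in>set zs. absv z \<le> r)"
  obtain N where N: "\<And>zs g. ?P (zs, g) \<Longrightarrow> length zs \<le> N"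
    using linprod_length_bounded[OF assms] by auto
  have "\<exists>x. ?P x \<and> (\<forall>y. ?P y \<longrightarrow> length (fst y) \<le> length (fst x))"
  proof (rule ex_has_greatest_nat[where b = "Suc N" and k = "([], f)"])
    show "\<forall>y. ?P y \<longrightarrow> length (fst y) < Suc N" using N by (auto simp: less_Suc_eq_le)
  qed (simp add: f)
  then obtain x where x: "?P x" "\<And>y. ?P y \<Longrightarrow> length (fst y) \<le> length (fst x)" by blast
  define zs where "zs = fst x"
  define g where "g = snd x"
  have zs: "?P (zs, g)" using x(1) by (simp add: zs_def g_def case_prod_beta)
  have max: "length zs' \<le> length zs" if "?P (zs', g')" for zs' g'
    using x(2)[OF that] by (simp add: zs_def)
  have "entire_eval absv g x \<noteq> 0" if "absv x \<le> r" for x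
  proof
    assume "entire_eval absv g x = 0"
    then obtain h where "entire absv h" "g = lin x * h"
      using entire_divide_root zs by auto
    then have "?P (x # zs, h)" using zs that by (auto simp: mult_ac)
    then show False using max[of "x # zs" h] by simp
  qed
  then show thesis using that zs by auto
qed

lemma eval_linprod_eq_0_iff: "entire_eval absv (linprod zs) x = 0 \<longleftrightarrow> x \<in> set zs"
  by (induction zs) (auto simp: eval_mult entire_linprod)

lemma finite_zeros_disc:
  assumes "entire absv f" "f \<noteq> 0"
  shows "finite {x. absv x \<le> r \<and> entire_eval absv f x = 0}"
proof -
  obtain zs g where *: "entire absv g" "f = linprod zs * g"
    "\<And>x. absv x \<le> max 1 r \<Longrightarrow> entire_eval absv g x \<noteq> 0"
    by (rule disc_factor[OF assms, of "max 1 r"]) auto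
  have "{x. absv x \<le> r \<and> entire_eval absv f x = 0} \<subseteq> set zs"
    using * by (auto simp: eval_mult entire_linprod eval_linprod_eq_0_iff)
  then show ?thesis by (rule finite_subset) simp
qed

lemma countable_zeros:
  assumes "entire absv f" "f \<noteq> 0"
  shows "countable {x. entire_eval absv f x = 0}"
proof -
  have "{x. entire_eval absv f x = 0} \<subseteq> (\<Union>n. {x. absv x \<le> real n \<and> entire_eval absv f x = 0})"
    using real_arch_simple by blast
  then show ?thesis
    by (rule countable_subset) (intro countable_UN countable_finite finite_zeros_disc assms countableI_type)
qed

text \<open>The natural numbers lie in the unit disc and are distinct in characteristic 0, so a
  nonzero difference would have infinitely many zeros there.\<close>

lemma entire_eqI:
  assumes "entire absv f" "entire absv g" "\<And>x. entire_eval absv f x = entire_eval absv g x"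
  shows "f = g"
proof (rule ccontr)
  assume "f \<noteq> g"
  then have "finite {x. absv x \<le> 1 \<and> entire_eval absv (f - g) x = 0}"
    using assms by (intro finite_zeros_disc entire_diff) auto
  moreover have "range of_nat \<subseteq> {x. absv x \<le> 1 \<and> entire_eval absv (f - g) x = 0}"
    using assms by (auto simp: absv_of_nat_le eval_diff)
  ultimately have "finite (range (of_nat :: nat \<Rightarrow> 'a))" by (rule rev_finite_subset)
  then show False using finite_imageD[of "of_nat :: nat \<Rightarrow> 'a" UNIV] by (simp add: inj_of_nat)
qed

lemma order_factor:
  assumes "entire absv f" "f \<noteq> 0"
  obtains m g where "entire absv g" "f = lin z ^ m * g" "entire_eval absv g z \<noteq> 0"
proof -
  let ?P = "\<lambda>(m, g). entire absv g \<and> f = lin z ^ m * g"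
  have "0 < max 1 (absv z)" by simp
  from linprod_length_bounded[OF assms this]
  obtain N where N: "\<And>zs g. entire absv g \<and> f = linprod zs * g \<and> (\<forall>y\<in>set zs. absv y \<le> max 1 (absv z)) \<Longrightarrow> length zs \<le> N"
    by blast
  have "\<exists>x. ?P x \<and> (\<forall>y. ?P y \<longrightarrow> fst y \<le> fst x)"
  proof (rule ex_has_greatest_nat[where b = "Suc N" and k = "(0, f)"])
    have "m \<le> N" if "entire absv g" "f = lin z ^ m * g" for m g
      using N[of g "replicate m z"] that by (simp add: linprod_replicate)
    then show "\<forall>y. ?P y \<longrightarrow> fst y < Suc N" by (auto simp: less_Suc_eq_le)
  qed (simp add: assms)
  then obtain x where x: "?P x" "\<And>y. ?P y \<Longrightarrow> fst y \<le> fst x" by blast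
  define m where "m = fst x"
  define g where "g = snd x"
  have m: "?P (m, g)" using x(1) by (simp add: m_def g_def case_prod_beta)
  have max: "m' \<le> m" if "?P (m', g')" for m' g'
    using x(2)[OF that] by (simp add: m_def)
  have "entire_eval absv g z \<noteq> 0"
  proof
    assume "entire_eval absv g z = 0"
    then obtain h where "entire absv h" "g = lin z * h"
      using entire_divide_root m by auto
    then have "?P (Suc m, h)" using m by (auto simp: mult_ac)
    then show False using max[of "Suc m" h] by simp
  qed
  then show thesis using that m by auto
qed

text \<open>The hypothesis says that \<open>g\<close> has no zeros in the open disc of radius \<open>r\<close>.\<close>

lemma inverse_coeff_le:
  assumes dom: "\<And>n. 1 \<le> n \<Longrightarrow> absv (fps_nth g n) * r ^ n \<le> absv (fps_nth g 0)"
    and g0: "fps_nth g 0 \<noteq> 0" and r: "0 < r"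
  shows "absv (fps_nth (inverse g) n) * r ^ n \<le> 1 / absv (fps_nth g 0)"
proof (induction n rule: less_induct)
  case (less n)
  have pos: "0 < absv (fps_nth g 0)" using g0 by (rule absv_pos)
  show ?case
  proof (cases "n = 0")
    case True
    then show ?thesis by (simp add: absv_inverse divide_inverse)
  next
    case False
    have "fps_nth (g * inverse g) n = 0"
      using False g0 by (simp add: inverse_mult_eq_1')
    then have eq: "fps_nth g 0 * fps_nth (inverse g) n = - (\<Sum>i = 1..n. fps_nth g i * fps_nth (inverse g) (n - i))"
      by (simp add: fps_mult_nth sum.atLeast_Suc_atMost add_eq_0_iff)
    have "absv (fps_nth g 0 * fps_nth (inverse g) n) \<le> 1 / r ^ n"
      unfolding eq absv_minus
    proof (rule absv_sum_le)
      fix i assume i: "i \<in> {1..n}"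
      have "absv (fps_nth g i * fps_nth (inverse g) (n - i)) * r ^ n
          = (absv (fps_nth g i) * r ^ i) * (absv (fps_nth (inverse g) (n - i)) * r ^ (n - i))"
        using i by (simp add: absv_mult power_add[symmetric])
      also have "\<dots> \<le> absv (fps_nth g 0) * (1 / absv (fps_nth g 0))"
        using i r by (intro mult_mono dom less) (auto simp: absv_nonneg)
      also have "\<dots> = 1" using pos by simp
      finally show "absv (fps_nth g i * fps_nth (inverse g) (n - i)) \<le> 1 / r ^ n"
        using r by (simp add: field_simps)
    qed (use r in simp)
    then show ?thesis using r pos by (simp add: absv_mult field_simps)
  qed
qed

text \<open>The local hypothesis says that \<open>f\<close> divided by \<open>linprod zs * g\<close>
  has no pole. It makes \<open>f\<close> vanish at the first listed point and survives cancelling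
  that factor.\<close>

lemma linprod_divides:
  assumes "entire absv f" "entire absv g"
    and "\<And>x. \<exists>a b. entire absv a \<and> entire absv b \<and> entire_eval absv b x \<noteq> 0 \<and> f * b = linprod zs * g * a"
  shows "\<exists>f1. entire absv f1 \<and> f = linprod zs * f1"
  using assms(1,3)
proof (induction zs arbitrary: f)
  case Nil
  then show ?case by (intro exI[of _ f]) simp
next
  case (Cons z zs)
  obtain a b where ab: "entire absv a" "entire absv b" "entire_eval absv b z \<noteq> 0" "f * b = linprod (z # zs) * g * a"
    using Cons.prems(2) by blast
  have "entire_eval absv (f * b) z = 0"
    unfolding ab(4) by (simp add: eval_mult entire_mult entire_linprod assms(2) ab)
  then have "entire_eval absv f z = 0" using ab(3) by (simp add: eval_mult[OF Cons.prems(1) ab(2)])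
  then obtain f' where f': "entire absv f'" "f = lin z * f'"
    using entire_divide_root Cons.prems(1) by blast
  have "\<exists>f1. entire absv f1 \<and> f' = linprod zs * f1"
  proof (rule Cons.IH[OF f'(1)])
    fix x
    obtain a b where ab: "entire absv a" "entire absv b" "entire_eval absv b x \<noteq> 0" "f * b = linprod (z # zs) * g * a"
      using Cons.prems(2) by blast
    have "lin z * (f' * b) = lin z * (linprod zs * g * a)"
      using ab(4) by (simp add: f'(2) mult.assoc)
    then have "f' * b = linprod zs * g * a" by (simp only: mult_left_cancel[OF lin_nonzero])
    then show "\<exists>a b. entire absv a \<and> entire absv b \<and> entire_eval absv b x \<noteq> 0 \<and> f' * b = linprod zs * g * a"
      using ab by blast
  qed
  then show ?case using f' by (auto simp: mult.assoc)
qed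

text \<open>On each disc the zeros of \<open>g\<close> are cancelled and the zero-free rest has a
  bounded inverse. Quotients are unique in the domain of power series, so one and the same series is
  bounded at every radius.\<close>

theorem entire_divide:
  assumes f: "entire absv f" and g: "entire absv g" "g \<noteq> 0"
    and loc: "\<And>x. \<exists>a b. entire absv a \<and> entire absv b \<and> entire_eval absv b x \<noteq> 0 \<and> f * b = g * a"
  shows "\<exists>h. entire absv h \<and> f = g * h"
proof -
  have *: "\<exists>h. f = g * h \<and> (\<exists>B. \<forall>n. absv (fps_nth h n) * r ^ n \<le> B)" if r: "1 \<le> r" for r
  proof -
    obtain zs g1 where g1: "entire absv g1" "g = linprod zs * g1"
      "\<And>x. absv x \<le> r \<Longrightarrow> entire_eval absv g1 x \<noteq> 0"
      by (rule disc_factor[OF g, of r]) (use r in auto)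
    obtain f1 where f1: "entire absv f1" "f = linprod zs * f1"
      using linprod_divides[OF f g1(1), of zs] loc g1(2) by auto
    have g10: "fps_nth g1 0 \<noteq> 0" using g1(3)[of 0] r by (simp add: eval_at_0 g1(1))
    have "absv (fps_nth g1 n) * r ^ n \<le> absv (fps_nth g1 0)" if "1 \<le> n" for n
      using coeff_less_of_zero_free[OF g1(1) _ g1(3) that, of r] r by simp
    then have inv: "absv (fps_nth (inverse g1) n) * r ^ n \<le> 1 / absv (fps_nth g1 0)" for n
      using g10 r by (intro inverse_coeff_le) auto
    define h where "h = f1 * inverse g1"
    have "g * h = linprod zs * f1 * (g1 * inverse g1)"
      by (simp add: h_def g1(2) mult_ac)
    then have "f = g * h" using g10 f1(2) by (simp add: inverse_mult_eq_1')
    moreover have "absv (fps_nth h n) * r ^ n \<le> gnorm f1 r * (1 / absv (fps_nth g1 0))" for n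
      unfolding h_def using r f1(1) inv by (intro absv_mult_coeff_le gnorm_upper) auto
    ultimately show ?thesis by blast
  qed
  obtain h where h: "f = g * h" using *[of 1] by auto
  have "entire absv h"
  proof (rule entireI_bounded)
    fix r :: real assume "1 \<le> r"
    from *[OF this] obtain h' where h': "f = g * h'" "\<exists>B. \<forall>n. absv (fps_nth h' n) * r ^ n \<le> B"
      by blast
    then have "h' = h" using h g(2) by simp
    then show "\<exists>B. \<forall>n. absv (fps_nth h n) * r ^ n \<le> B" using h' by simp
  qed
  then show ?thesis using h by blast
qed

text \<open>A nonzero coefficient of index at least 1 would make \<open>f\<close> surjective; there
  is no entire analogue of the exponential function.\<close>

lemma zero_free_const:
  assumes "entire absv f" "\<And>x. entire_eval absv f x \<noteq> 0"
  shows "f = fps_const (fps_nth f 0)"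
proof (rule fps_ext)
  fix n show "fps_nth f n = fps_nth (fps_const (fps_nth f 0)) n"
    using entire_surj[OF assms(1), of n 0] assms(2) by (cases "n = 0") auto
qed

lemma single_zero:
  assumes f: "entire absv f" "f \<noteq> 0" and "\<And>x. entire_eval absv f x = 0 \<Longrightarrow> x = z"
  obtains c m where "c \<noteq> 0" "f = lin z ^ m * fps_const c"
proof -
  obtain m g where g: "entire absv g" "f = lin z ^ m * g" "entire_eval absv g z \<noteq> 0"
    by (rule order_factor[OF f])
  have "entire_eval absv g x \<noteq> 0" for x
  proof
    assume "entire_eval absv g x = 0"
    then have "entire_eval absv f x = 0" by (simp add: g(2) eval_mult entire_power g(1))
    then show False using assms(3) g(3) \<open>entire_eval absv g x = 0\<close> by auto
  qed
  then have "g = fps_const (fps_nth g 0)" using zero_free_const g(1) by blast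
  then show thesis using that[of "fps_nth g 0" m] g f(2) by (metis fps_const_0_eq_0 mult_zero_right)
qed

lemma entire_continuous:
  assumes f: "entire absv f" and "0 < \<epsilon>"
  obtains d where "0 < d" "\<And>x. absv (x - z) < d \<Longrightarrow> absv (entire_eval absv f x - entire_eval absv f z) < \<epsilon>"
proof -
  obtain g where g: "entire absv g" "f = fps_const (entire_eval absv f z) + lin z * g"
    by (rule entire_expand[OF f])
  define R where "R = max 1 (absv z)"
  define M where "M = gnorm g R + 1"
  have M: "0 < M" using gnorm_nonneg[OF g(1), of R] by (simp add: M_def R_def add_nonneg_pos)
  define d where "d = min 1 (\<epsilon> / M)"
  show thesis
  proof
    show "0 < d" using M assms by (simp add: d_def)
    fix x assume x: "absv (x - z) < d"
    have "absv (x - z + z) \<le> R" using x by (intro absv_add_le) (auto simp: d_def R_def)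
    then have "absv x \<le> R" by simp
    then have gx: "absv (entire_eval absv g x) \<le> M"
      using absv_eval_le[OF g(1)] by (fastforce simp: M_def)
    have "entire_eval absv f x = entire_eval absv f z + (x - z) * entire_eval absv g x"
      by (subst g(2)) (simp add: eval_add eval_mult entire_mult g(1))
    then have "absv (entire_eval absv f x - entire_eval absv f z) = absv (x - z) * absv (entire_eval absv g x)"
      by (simp add: absv_mult)
    also have "\<dots> \<le> absv (x - z) * M" using gx by (intro mult_left_mono absv_nonneg)
    also have "\<dots> < d * M" using x M by (intro mult_strict_right_mono)
    also have "\<dots> \<le> \<epsilon> / M * M" using M by (intro mult_right_mono) (auto simp: d_def)
    finally show "absv (entire_eval absv f x - entire_eval absv f z) < \<epsilon>" using M by simp
  qed
qed

end

section \<open>Meromorphic functions\<close>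

lemma fls_fraction_eq_iff:
  fixes a b c d :: "'a::field fps"
  assumes "b \<noteq> 0" "d \<noteq> 0"
  shows "fps_to_fls a / fps_to_fls b = fps_to_fls c / fps_to_fls d \<longleftrightarrow> a * d = b * c"
  using assms by (simp add: frac_eq_eq flip: fls_times_fps_to_fls) (auto simp: mult.commute)

context padic_complex_field
begin

lemma nonzero_of_eval: "entire_eval absv b x \<noteq> 0 \<Longrightarrow> b \<noteq> 0"
  by auto

lemma has_finite_value_unique:
  assumes "has_finite_value absv F x y" "has_finite_value absv F x y'"
  shows "y = y'"
proof -
  obtain a b where 1: "entire absv a" "entire absv b" "entire_eval absv b x \<noteq> 0"
    "F = fps_to_fls a / fps_to_fls b" "y = entire_eval absv a x / entire_eval absv b x"
    using assms(1) by (auto simp: has_finite_value_def)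
  obtain a' b' where 2: "entire absv a'" "entire absv b'" "entire_eval absv b' x \<noteq> 0"
    "F = fps_to_fls a' / fps_to_fls b'" "y' = entire_eval absv a' x / entire_eval absv b' x"
    using assms(2) by (auto simp: has_finite_value_def)
  have "a * b' = b * a'"
    using fls_fraction_eq_iff[OF nonzero_of_eval[OF 1(3)] nonzero_of_eval[OF 2(3)]] 1 2 by metis
  then have "entire_eval absv a x * entire_eval absv b' x = entire_eval absv b x * entire_eval absv a' x"
    using eval_mult 1 2 by metis
  then show ?thesis unfolding 1(5) 2(5) using 1(3) 2(3) by (simp add: frac_eq_eq mult.commute)
qed

lemma mero_eval_Some_iff: "mero_eval absv F x = Some y \<longleftrightarrow> has_finite_value absv F x y"
  using has_finite_value_unique by (auto simp: mero_eval_def intro: theI2)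

lemma mero_eval_frac:
  assumes "entire absv a" "entire absv b" "entire_eval absv b x \<noteq> 0"
  shows "mero_eval absv (fps_to_fls a / fps_to_fls b) x = Some (entire_eval absv a x / entire_eval absv b x)"
  unfolding mero_eval_Some_iff has_finite_value_def using assms by blast

lemma mero_eval_entire:
  assumes "entire absv h"
  shows "mero_eval absv (fps_to_fls h) x = Some (entire_eval absv h x)"
  using mero_eval_frac[OF assms entire_1, of x] by simp

text \<open>A finite value at \<open>x\<close> supplies exactly the local fraction that
  \<open>entire_divide\<close> asks for.\<close>

lemma entire_of_no_poles:
  assumes "F \<in> meromorphic_functions absv" "\<And>x. mero_eval absv F x \<noteq> None"
  obtains h where "entire absv h" "F = fps_to_fls h"
proof -
  obtain A B where AB: "entire absv A" "entire absv B" "B \<noteq> 0" "F = fps_to_fls A / fps_to_fls B"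
    using assms(1) by (auto simp: meromorphic_functions_def)
  have "\<exists>a b. entire absv a \<and> entire absv b \<and> entire_eval absv b x \<noteq> 0 \<and> A * b = B * a" for x
  proof -
    obtain y where "has_finite_value absv F x y" using assms(2)[of x] mero_eval_Some_iff by blast
    then obtain a b where ab: "entire absv a" "entire absv b" "entire_eval absv b x \<noteq> 0"
      "F = fps_to_fls a / fps_to_fls b" by (auto simp: has_finite_value_def)
    then have "A * b = B * a"
      using fls_fraction_eq_iff[OF AB(3) nonzero_of_eval[OF ab(3)]] AB(4) by metis
    then show ?thesis using ab by blast
  qed
  then obtain h where h: "entire absv h" "A = B * h"
    using entire_divide[OF AB(1-3)] by blast
  then have "F = fps_to_fls h" using AB by (simp add: fls_times_fps_to_fls)
  then show thesis using h that by blast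
qed

text \<open>The common power of \<open>lin x\<close> is cancelled; coprimality is obtained at the
  single point \<open>x\<close>.\<close>

lemma mero_local_rep:
  assumes "F \<in> meromorphic_functions absv"
  obtains a b where "entire absv a" "entire absv b" "b \<noteq> 0" "F = fps_to_fls a / fps_to_fls b"
    "entire_eval absv a x \<noteq> 0 \<or> entire_eval absv b x \<noteq> 0"
proof -
  obtain A B where AB: "entire absv A" "entire absv B" "B \<noteq> 0" "F = fps_to_fls A / fps_to_fls B"
    using assms(1) by (auto simp: meromorphic_functions_def)
  show thesis
  proof (cases "A = 0")
    case True
    then show ?thesis using AB by (intro that[of 0 1]) auto
  next
    case False
    obtain m a where a: "entire absv a" "A = lin x ^ m * a" "entire_eval absv a x \<noteq> 0"
      by (rule order_factor[OF AB(1) False])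
    obtain n b where b: "entire absv b" "B = lin x ^ n * b" "entire_eval absv b x \<noteq> 0"
      by (rule order_factor[OF AB(2,3)])
    have nz: "lin x ^ k * b \<noteq> 0" "b \<noteq> 0" for k using b(3) by auto
    show ?thesis
    proof (cases "m \<le> n")
      case True
      then have "lin x ^ n = lin x ^ m * lin x ^ (n - m)" by (simp flip: power_add)
      then have "A * (lin x ^ (n - m) * b) = B * a" by (simp add: a b mult_ac)
      then have "F = fps_to_fls a / fps_to_fls (lin x ^ (n - m) * b)"
        unfolding AB(4) using fls_fraction_eq_iff[OF AB(3) nz(1)] by blast
      then show ?thesis using a b nz
        by (intro that[of a "lin x ^ (n - m) * b"]) (auto intro!: entire_mult entire_power entire_lin)
    next
      case False
      then have "lin x ^ m = lin x ^ n * lin x ^ (m - n)" by (simp flip: power_add)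
      then have "A * b = B * (lin x ^ (m - n) * a)" by (simp add: a b mult_ac)
      then have "F = fps_to_fls (lin x ^ (m - n) * a) / fps_to_fls b"
        unfolding AB(4) using fls_fraction_eq_iff[OF AB(3) nz(2)] by blast
      then show ?thesis using a b nz
        by (intro that[of "lin x ^ (m - n) * a" b]) (auto intro!: entire_mult entire_power entire_lin)
    qed
  qed
qed

text \<open>Converse of \<open>entire_has_zero\<close>: at the zero the non-constant part takes the
  value \<open>- fps_nth D 0\<close>, so its Gauss norm, attained at some k \<ge> 1, is at least the
  size of that coefficient.\<close>

lemma coeff_ge_of_zero:
  assumes D: "entire absv D" "D \<noteq> 0" and r: "0 < r" "absv x \<le> r" "entire_eval absv D x = 0"
  shows "\<exists>k\<ge>1. fps_nth D k \<noteq> 0 \<and> absv (fps_nth D 0) \<le> absv (fps_nth D k) * r ^ k"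
proof -
  define E where "E = D - fps_const (fps_nth D 0)"
  have E: "entire absv E" unfolding E_def by (intro entire_diff D entire_const)
  have "entire_eval absv E x = - fps_nth D 0" by (simp add: E_def eval_diff D r)
  then have le: "absv (fps_nth D 0) \<le> gnorm E r" using absv_eval_le[OF E r(2)] by simp
  have "E \<noteq> 0"
  proof
    assume "E = 0"
    then have "D = fps_const (fps_nth D 0)" by (simp add: E_def)
    then show False using D(2) r(3) eval_const by (metis fps_const_0_eq_0)
  qed
  then have pos: "0 < gnorm E r" using E r by (intro gnorm_pos)
  obtain k where k: "absv (fps_nth E k) * r ^ k = gnorm E r" using gnorm_attained[OF E r(1)] by blast
  then have "fps_nth E k \<noteq> 0" using pos by auto
  moreover from this have "1 \<le> k" by (cases k) (auto simp: E_def)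
  moreover from this have "fps_nth E k = fps_nth D k" by (simp add: E_def)
  ultimately show ?thesis using k le by metis
qed

text \<open>
  The zero of \<open>D - C / y\<close> found near the pole solves \<open>C / D = y\<close> only if it is not a common zero of
  \<open>C\<close> and \<open>D\<close>; so the common zeros in the disc are cancelled first.
\<close>

lemma large_values_near_pole:
  assumes v: "v \<in> meromorphic_functions absv" "mero_eval absv v x0 = None"
  obtains r M where "0 < r" "0 < M"
    "\<And>y. M \<le> absv y \<Longrightarrow> \<exists>x. absv x \<le> r \<and> mero_eval absv v x = Some y"
proof -
  define r where "r = max 1 (absv x0)"
  have r: "0 < r" "absv x0 \<le> r" by (auto simp: r_def)
  obtain C0 D0 where CD0: "entire absv C0" "entire absv D0" "D0 \<noteq> 0" "v = fps_to_fls C0 / fps_to_fls D0"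
    using v(1) by (auto simp: meromorphic_functions_def)
  let ?P = "\<lambda>(zs, C, D). entire absv C \<and> entire absv D \<and> C0 = linprod zs * C \<and> D0 = linprod zs * D \<and>
    (\<forall>z\<in>set zs. absv z \<le> r)"
  obtain N where N: "\<And>zs g. entire absv g \<and> D0 = linprod zs * g \<and> (\<forall>y\<in>set zs. absv y \<le> r) \<Longrightarrow> length zs \<le> N"
    using linprod_length_bounded[OF CD0(2,3) r(1)] by blast
  have "\<exists>x. ?P x \<and> (\<forall>y. ?P y \<longrightarrow> length (fst y) \<le> length (fst x))"
  proof (rule ex_has_greatest_nat[where b = "Suc N" and k = "([], C0, D0)"])
    show "\<forall>y. ?P y \<longrightarrow> length (fst y) < Suc N" using N by (auto simp: less_Suc_eq_le)
  qed (simp add: CD0)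
  then obtain x where x: "?P x" "\<And>y. ?P y \<Longrightarrow> length (fst y) \<le> length (fst x)" by blast
  obtain zs C D where zsCD: "x = (zs, C, D)" by (cases x)
  have P: "?P (zs, C, D)" using x(1) zsCD by simp
  then have C: "entire absv C" "C0 = linprod zs * C" and D: "entire absv D" "D0 = linprod zs * D"
    and zs: "\<forall>z\<in>set zs. absv z \<le> r" by auto
  have max: "length zs' \<le> length zs" if "?P (zs', C', D')" for zs' C' D'
    using x(2)[OF that] zsCD by simp
  have coprime: "\<not> (entire_eval absv C x = 0 \<and> entire_eval absv D x = 0)" if "absv x \<le> r" for x
  proof
    assume "entire_eval absv C x = 0 \<and> entire_eval absv D x = 0"
    then obtain C' D' where "entire absv C'" "C = lin x * C'" "entire absv D'" "D = lin x * D'"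
      using entire_divide_root C D by metis
    then have "?P (x # zs, C', D')" using C(2) D(2) zs that by (auto simp: mult_ac)
    then show False using max[of "x # zs" C' D'] by simp
  qed
  have D_nz: "D \<noteq> 0" using D(2) CD0(3) by auto
  have "C0 * D = D0 * C" by (simp add: C(2) D(2) mult_ac)
  then have v_eq: "v = fps_to_fls C / fps_to_fls D"
    unfolding CD0(4) using fls_fraction_eq_iff[OF CD0(3) D_nz] by blast
  have Dx0: "entire_eval absv D x0 = 0"
  proof (rule ccontr)
    assume "entire_eval absv D x0 \<noteq> 0"
    from mero_eval_frac[OF C(1) D(1) this] show False using v(2) v_eq by simp
  qed
  obtain k where k: "1 \<le> k" "fps_nth D k \<noteq> 0" "absv (fps_nth D 0) \<le> absv (fps_nth D k) * r ^ k"
    using coeff_ge_of_zero[OF D(1) D_nz r Dx0] by blast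
  define M0 where "M0 = absv (fps_nth D k) * r ^ k"
  have M0: "0 < M0" using k r by (simp add: M0_def absv_pos)
  \<comment> \<open>For \<open>M \<le> absv y\<close>, division by y brings the norm of
    \<open>C\<close> below \<open>M0\<close>. Then D - C / y keeps the size of its k-th coefficient,
    its constant coefficient is at most \<open>M0\<close>, and the criterion for a zero
    applies.\<close>
  define M where "M = (gnorm C r + 1) / M0"
  show thesis
  proof
    show "0 < r" by fact
    show "0 < M" using M0 gnorm_nonneg[OF C(1), of r] r by (simp add: M_def add_nonneg_pos)
    fix y assume y: "M \<le> absv y"
    then have "y \<noteq> 0" using \<open>0 < M\<close> by auto
    define z where "z = inverse y"
    have z: "absv z * gnorm C r < M0"
    proof -
      have "gnorm C r + 1 \<le> absv y * M0" using y M0 by (simp add: M_def field_simps)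
      then show ?thesis using absv_pos[OF \<open>y \<noteq> 0\<close>] by (simp add: z_def absv_divide field_simps)
    qed
    have zC: "absv (z * fps_nth C n) * r ^ n < M0" for n
    proof -
      have "absv z * (absv (fps_nth C n) * r ^ n) \<le> absv z * gnorm C r"
        using r C by (intro mult_left_mono gnorm_upper) (auto simp: absv_nonneg)
      then show ?thesis using z by (simp add: absv_mult mult.assoc)
    qed
    define E where "E = D - fps_const z * C"
    have E: "entire absv E" unfolding E_def by (intro entire_diff entire_mult D C entire_const)
    have "absv (z * fps_nth C k) < absv (fps_nth D k)"
      using zC[of k] r by (simp add: M0_def)
    then have Ek: "absv (fps_nth E k) = absv (fps_nth D k)"
      by (intro absv_eqI) (simp add: E_def)
    have "absv (fps_nth E 0) \<le> M0"
      using k(3) zC[of 0] absv_diff_le[of "fps_nth D 0" M0 "z * fps_nth C 0"] by (simp add: E_def M0_def)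
    then obtain x where x: "absv x \<le> r" "entire_eval absv E x = 0"
      using entire_has_zero[OF E r(1) k(1)] Ek k(2) by (auto simp: M0_def absv_eq_0_iff[symmetric])
    then have eq: "entire_eval absv D x = z * entire_eval absv C x"
      by (simp add: E_def eval_diff eval_mult entire_mult C D)
    then have nz: "entire_eval absv D x \<noteq> 0"
      using coprime[OF x(1)] \<open>y \<noteq> 0\<close> by (auto simp: z_def)
    have "entire_eval absv C x = y * entire_eval absv D x"
      using eq \<open>y \<noteq> 0\<close> by (simp add: z_def)
    then have "mero_eval absv v x = Some y"
      using mero_eval_frac[OF C(1) D(1) nz] v_eq nz by simp
    then show "\<exists>x. absv x \<le> r \<and> mero_eval absv v x = Some y" using x by blast
  qed
qed

end

section \<open>Reduction to compositions of entire functions\<close>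

lemma fps_affine_eq:
  fixes U :: "'a::field fps"
  assumes "\<And>n. 2 \<le> n \<Longrightarrow> fps_nth U n = 0"
  shows "U = fps_const (fps_nth U 1) * fps_X + fps_const (fps_nth U 0)"
proof (rule fps_ext)
  fix n :: nat
  consider "n = 0" | "n = 1" | "2 \<le> n" by linarith
  then show "fps_nth U n = fps_nth (fps_const (fps_nth U 1) * fps_X + fps_const (fps_nth U 0)) n"
    by cases (auto simp: assms)
qed

lemma fps_to_fls_affine:
  "fps_to_fls (fps_const a * fps_X + fps_const b) = fls_const a * fls_X + fls_const (b :: 'a::field)"
  by (simp add: fls_times_fps_to_fls fps_to_fls_plus)

lemma linear_rational_frac:
  fixes a b c d :: "'a::field"
  assumes "a * d - b * c \<noteq> 0"
  shows "linear_rational (fps_to_fls (fps_const a * fps_X + fps_const b) /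
    fps_to_fls (fps_const c * fps_X + fps_const d))"
  unfolding linear_rational_def fps_to_fls_affine using assms by blast

lemma linear_rational_affine:
  fixes U :: "'a::field fps"
  assumes "\<And>n. 2 \<le> n \<Longrightarrow> fps_nth U n = 0" "fps_nth U 1 \<noteq> 0"
  shows "linear_rational (fps_to_fls U)"
proof -
  have "linear_rational (fps_to_fls (fps_const (fps_nth U 1) * fps_X + fps_const (fps_nth U 0)))"
    using linear_rational_frac[of "fps_nth U 1" 1 "fps_nth U 0" 0] assms(2) by simp
  then show ?thesis by (simp only: fps_affine_eq[OF assms(1), symmetric])
qed

context padic_complex_field
begin

text \<open>A Cauchy estimate from values: for s as large as the k-th term at radius r,
  \<open>entire_has_zero\<close> gives a point of the disc where \<open>A\<close> takes the value
  \<open>fps_nth A 0 + s\<close>. Growth of order r^m with m < k rules this out for large r.\<close>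

lemma polynomial_growth:
  assumes A: "entire absv A" and R0: "0 < R0"
    and growth: "\<And>y. R0 \<le> absv y \<Longrightarrow> absv (entire_eval absv A y) \<le> \<Phi> * absv y ^ m"
    and k: "m < k"
  shows "fps_nth A k = 0"
proof (rule ccontr)
  assume Ak: "fps_nth A k \<noteq> 0"
  obtain y0 where y0: "R0 \<le> absv y0" "y0 \<noteq> 0" using exists_absv_ge by blast
  have \<Phi>: "0 \<le> \<Phi>"
  proof -
    have "0 \<le> \<Phi> * absv y0 ^ m"
      using growth[OF y0(1)] absv_nonneg order_trans by blast
    then show ?thesis using zero_less_power[OF absv_pos[OF y0(2)], of m] by (auto simp: zero_le_mult_iff)
  qed
  define C where "C = gnorm A R0"
  have C: "0 \<le> C" "absv (fps_nth A 0) \<le> C"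
    using gnorm_nonneg[OF A, of R0] gnorm_upper[OF A, of R0 0] R0 by (auto simp: C_def)
  define B where "B = (\<Phi> + C) / absv (fps_nth A k)"
  \<comment> \<open>The radius is the absolute value of an element, so that an s of the required
    size exists.\<close>
  obtain \<rho> where \<rho>: "max 1 (B + 1) \<le> absv \<rho>" using exists_absv_ge by blast
  define r where "r = absv \<rho>"
  have r: "1 \<le> r" "B < r" using \<rho> by (auto simp: r_def)
  define s where "s = fps_nth A k * \<rho> ^ k"
  have s: "absv s = absv (fps_nth A k) * r ^ k" by (simp add: s_def r_def absv_mult absv_power)
  have "\<exists>y. absv y \<le> r \<and> entire_eval absv (A - fps_const (fps_nth A 0 + s)) y = 0"
    by (rule entire_has_zero[where k = k]) (use A r k Ak s in \<open>auto intro: entire_diff\<close>)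
  then obtain y where y: "absv y \<le> r" "entire_eval absv A y = fps_nth A 0 + s"
    by (auto simp: eval_diff A)
  have Ay: "absv (entire_eval absv A y) \<le> (\<Phi> + C) * r ^ m"
  proof (cases "R0 \<le> absv y")
    case True
    have "absv (entire_eval absv A y) \<le> \<Phi> * absv y ^ m" using growth True by blast
    also have "\<dots> \<le> (\<Phi> + C) * r ^ m"
      using y \<Phi> C by (intro mult_mono power_mono) (auto simp: absv_nonneg)
    finally show ?thesis .
  next
    case False
    then have "absv (entire_eval absv A y) \<le> C * 1"
      using absv_eval_le[OF A, of y R0] by (simp add: C_def)
    also have "\<dots> \<le> (\<Phi> + C) * r ^ m" using r \<Phi> C by (intro mult_mono) auto
    finally show ?thesis .
  qed
  have A0: "absv (fps_nth A 0) \<le> (\<Phi> + C) * r ^ m"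
  proof -
    have "absv (fps_nth A 0) \<le> C * 1" using C by simp
    also have "\<dots> \<le> (\<Phi> + C) * r ^ m" using r \<Phi> C by (intro mult_mono) auto
    finally show ?thesis .
  qed
  have "absv s \<le> (\<Phi> + C) * r ^ m"
    using absv_diff_le[OF Ay A0] y(2) by simp
  moreover have "absv (fps_nth A k) * (r * r ^ m) \<le> absv s"
    unfolding s using r k power_increasing[of "Suc m" k r] by (intro mult_left_mono) (auto simp: absv_nonneg)
  ultimately have "(absv (fps_nth A k) * r) * r ^ m \<le> (\<Phi> + C) * r ^ m" by simp
  then have "absv (fps_nth A k) * r \<le> \<Phi> + C" using r by simp
  then have "r \<le> B" using absv_pos[OF Ak] by (simp add: B_def field_simps)
  then show False using r by simp
qed

lemma fps_eq_const:
  assumes "\<And>k. 1 \<le> k \<Longrightarrow> fps_nth f k = 0"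
  shows "f = fps_const (fps_nth f 0)"
proof (rule fps_ext)
  fix n show "fps_nth f n = fps_nth (fps_const (fps_nth f 0)) n"
    using assms[of n] by (cases "n = 0") auto
qed

text \<open>Constants count as affine. They are not linear rational, so they have to be excluded
  separately, through the non-constant composite.\<close>

definition nonaffine :: "'a fps \<Rightarrow> bool" where
  "nonaffine U \<longleftrightarrow> (\<exists>n\<ge>2. fps_nth U n \<noteq> 0)"

text \<open>\<open>V\<close> is non-constant, hence surjective, so \<open>u\<close> is finite
  everywhere and therefore entire.\<close>

lemma entire_decomposition:
  assumes u: "u \<in> meromorphic_functions absv" "\<not> linear_rational u"
    and V: "entire absv V" "\<not> linear_rational (fps_to_fls V)"
    and comp: "\<And>x. mero_eval absv u (entire_eval absv V x) = Some (entire_eval absv \<phi> x)"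
    and \<phi>: "entire absv \<phi>" "\<And>c. \<phi> \<noteq> fps_const c"
  shows "\<exists>U. entire absv U \<and> (\<forall>x. entire_eval absv \<phi> x = entire_eval absv U (entire_eval absv V x))
    \<and> nonaffine U \<and> nonaffine V"
proof -
  have "\<exists>k\<ge>1. fps_nth V k \<noteq> 0"
  proof (rule ccontr)
    assume "\<not> ?thesis"
    then have Vc: "V = fps_const (fps_nth V 0)" by (intro fps_eq_const) auto
    have "entire_eval absv V x = fps_nth V 0" for x by (subst Vc) simp
    then have "Some (entire_eval absv \<phi> x) = Some (entire_eval absv \<phi> 0)" for x using comp by metis
    then have "\<phi> = fps_const (entire_eval absv \<phi> 0)" by (intro entire_eqI \<phi>) auto
    then show False using \<phi>(2) by blast
  qed
  then obtain k where k: "1 \<le> k" "fps_nth V k \<noteq> 0" by blast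
  have "mero_eval absv u y \<noteq> None" for y
    using entire_surj[OF V(1) k, of y] comp by auto
  then obtain U where U: "entire absv U" "u = fps_to_fls U"
    using entire_of_no_poles[OF u(1)] by blast
  have \<phi>_eq: "entire_eval absv \<phi> x = entire_eval absv U (entire_eval absv V x)" for x
    using comp[of x] mero_eval_entire[OF U(1)] U(2) by simp
  have "nonaffine V"
  proof (rule ccontr)
    assume "\<not> nonaffine V"
    then have *: "\<And>n. 2 \<le> n \<Longrightarrow> fps_nth V n = 0" by (auto simp: nonaffine_def)
    then have "k = 1" using k by (cases "2 \<le> k") auto
    then show False using linear_rational_affine[OF *] k V(2) by blast
  qed
  moreover have "nonaffine U"
  proof (rule ccontr)
    assume "\<not> nonaffine U"
    then have *: "\<And>n. 2 \<le> n \<Longrightarrow> fps_nth U n = 0" by (auto simp: nonaffine_def)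
    then have "fps_nth U 1 = 0" using linear_rational_affine[OF *] u(2) U(2) by blast
    then have "fps_nth U n = 0" if "1 \<le> n" for n using * that by (cases "n = 1") auto
    then have Uc: "U = fps_const (fps_nth U 0)" using fps_eq_const by blast
    have "entire_eval absv U y = fps_nth U 0" for y by (subst Uc) simp
    then have "\<phi> = fps_const (fps_nth U 0)" using \<phi>_eq by (intro entire_eqI \<phi>) auto
    then show False using \<phi>(2) by blast
  qed
  ultimately show ?thesis using U(1) \<phi>_eq by blast
qed

text \<open>
  If \<open>v\<close> has a pole, then \<open>u\<close> is bounded at infinity, so it has a pole \<open>c\<close>, which \<open>v\<close> omits. Replacing
  \<open>v\<close> by \<open>W = 1 / (v - c)\<close> and \<open>u\<close> by \<open>z \<mapsto> u (c + 1 / z)\<close> gives entire functions.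
\<close>

lemma pole_decomposition:
  assumes u: "u \<in> meromorphic_functions absv" "\<not> linear_rational u"
    and v: "v \<in> meromorphic_functions absv" "\<not> linear_rational v" "mero_eval absv v x0 = None"
    and comp: "\<And>x y. mero_eval absv v x = Some y \<Longrightarrow> mero_eval absv u y = Some (entire_eval absv \<phi> x)"
    and \<phi>: "entire absv \<phi>" "\<And>c. \<phi> \<noteq> fps_const c"
  shows "\<exists>U W. entire absv U \<and> entire absv W \<and>
    (\<forall>x. entire_eval absv \<phi> x = entire_eval absv U (entire_eval absv W x)) \<and> nonaffine U \<and> nonaffine W"
proof -
  obtain r M where rM: "0 < r" "0 < M"
    "\<And>y. M \<le> absv y \<Longrightarrow> \<exists>x. absv x \<le> r \<and> mero_eval absv v x = Some y"
    using large_values_near_pole[OF v(1,3)] by blast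
  define \<Phi> where "\<Phi> = gnorm \<phi> r"
  have bound: "\<exists>t. mero_eval absv u y = Some t \<and> absv t \<le> \<Phi>" if y: "M \<le> absv y" for y
  proof -
    obtain x where x: "absv x \<le> r" "mero_eval absv v x = Some y" using rM(3)[OF y] by blast
    then show ?thesis using comp[OF x(2)] absv_eval_le[OF \<phi>(1) x(1)] by (auto simp: \<Phi>_def)
  qed
  obtain C D where CD: "entire absv C" "entire absv D" "D \<noteq> 0" "v = fps_to_fls C / fps_to_fls D"
    using v(1) by (auto simp: meromorphic_functions_def)
  \<comment> \<open>An entire \<open>u\<close> bounded at infinity would be constant, and \<phi>
    with it.\<close>
  have "\<exists>c. mero_eval absv u c = None"
  proof (rule ccontr)
    assume "\<not> ?thesis"
    then obtain U where U: "entire absv U" "u = fps_to_fls U"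
      using entire_of_no_poles[OF u(1)] by auto
    have "fps_nth U k = 0" if "0 < k" for k
    proof (rule polynomial_growth[OF U(1) rM(2), of \<Phi> 0])
      fix y assume "M \<le> absv y"
      then show "absv (entire_eval absv U y) \<le> \<Phi> * absv y ^ 0"
        using bound[of y] mero_eval_entire[OF U(1), of y] U(2) by auto
    qed (use that in simp)
    then have Uc: "U = fps_const (fps_nth U 0)" by (intro fps_eq_const) auto
    have Uy: "entire_eval absv U y = fps_nth U 0" for y by (subst Uc) simp
    \<comment> \<open>The factor \<open>D\<close> gives equality also at the poles of
      \<open>v\<close>, where the composition says nothing.\<close>
    have "\<phi> * D = fps_const (fps_nth U 0) * D"
    proof (rule entire_eqI)
      fix x
      show "entire_eval absv (\<phi> * D) x = entire_eval absv (fps_const (fps_nth U 0) * D) x"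
      proof (cases "entire_eval absv D x = 0")
        case True
        then show ?thesis by (simp add: eval_mult \<phi>(1) CD)
      next
        case False
        then have "mero_eval absv u (entire_eval absv C x / entire_eval absv D x) = Some (entire_eval absv \<phi> x)"
          using comp mero_eval_frac[OF CD(1,2)] CD(4) by blast
        then show ?thesis using Uy by (simp add: U mero_eval_entire eval_mult \<phi>(1) CD)
      qed
    qed (auto intro: entire_mult \<phi> CD entire_const)
    then have "\<phi> = fps_const (fps_nth U 0)" using CD(3) by simp
    then show False using \<phi>(2) by blast
  qed
  then obtain c where c: "mero_eval absv u c = None" by blast
  have omits: "mero_eval absv v x \<noteq> Some c" for x using comp[of x c] c by auto
  define N where "N = C - fps_const c * D"
  have N: "entire absv N" unfolding N_def by (intro entire_diff entire_mult CD entire_const)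
  have "N \<noteq> 0"
  proof
    assume "N = 0"
    then have "v = fps_to_fls (fps_const c) / fps_to_fls 1"
      using CD(3) unfolding CD(4) by (subst fls_fraction_eq_iff) (auto simp: N_def mult.commute)
    then show False using mero_eval_frac[of "fps_const c" 1 x0] v(3) by simp
  qed
  define w where "w = fps_to_fls D / fps_to_fls N"
  have "w \<in> meromorphic_functions absv"
    unfolding w_def meromorphic_functions_def using CD(2) N \<open>N \<noteq> 0\<close> by blast
  moreover have "mero_eval absv w x \<noteq> None" for x
  proof -
    obtain a b where ab: "entire absv a" "entire absv b" "b \<noteq> 0" "v = fps_to_fls a / fps_to_fls b"
      "entire_eval absv a x \<noteq> 0 \<or> entire_eval absv b x \<noteq> 0"
      using mero_local_rep[OF v(1)] by blast
    define n where "n = a - fps_const c * b"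
    have n: "entire absv n" unfolding n_def by (intro entire_diff entire_mult ab entire_const)
    have nx: "entire_eval absv n x = entire_eval absv a x - c * entire_eval absv b x"
      by (simp add: n_def eval_diff eval_mult entire_mult ab)
    have nz: "entire_eval absv n x \<noteq> 0"
    proof (cases "entire_eval absv b x = 0")
      case True
      then show ?thesis using ab(5) nx by simp
    next
      case False
      then have "entire_eval absv a x / entire_eval absv b x \<noteq> c"
        using omits[of x] mero_eval_frac[OF ab(1,2) False] ab(4) by auto
      then show ?thesis using nx False by (auto simp: field_simps)
    qed
    have "C * b = D * a"
      using fls_fraction_eq_iff[OF CD(3) ab(3)] CD(4) ab(4) by metis
    then have "D * n = N * b" by (simp add: n_def N_def algebra_simps)
    then have "w = fps_to_fls b / fps_to_fls n"
      unfolding w_def using fls_fraction_eq_iff[OF \<open>N \<noteq> 0\<close> nonzero_of_eval[OF nz]] by blast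
    then show ?thesis using mero_eval_frac[OF ab(2) n nz] by simp
  qed
  ultimately obtain W where W: "entire absv W" "w = fps_to_fls W"
    using entire_of_no_poles by blast
  have D_eq: "D = N * W"
    using W(2) fls_fraction_eq_iff[OF \<open>N \<noteq> 0\<close>, of 1 D W] by (simp add: w_def)
  then have "W \<noteq> 0" using CD(3) by auto
  define W1 where "W1 = 1 + fps_const c * W"
  have W1: "entire absv W1" unfolding W1_def by (intro entire_add entire_mult W entire_const entire_1)
  have "C * W = D * W1"
    using D_eq by (simp add: W1_def N_def algebra_simps)
  then have v_eq: "v = fps_to_fls W1 / fps_to_fls W"
    unfolding CD(4) using fls_fraction_eq_iff[OF CD(3) \<open>W \<noteq> 0\<close>] by blast
  have vW: "mero_eval absv v x = Some (c + 1 / entire_eval absv W x)" if "entire_eval absv W x \<noteq> 0" for x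
    using mero_eval_frac[OF W1 W(1) that] that
    by (simp add: v_eq W1_def eval_add eval_mult entire_mult W(1) add_divide_distrib)
  have "\<exists>k\<ge>1. fps_nth W k \<noteq> 0"
  proof (rule ccontr)
    assume "\<not> ?thesis"
    then have Wc: "W = fps_const (fps_nth W 0)" by (intro fps_eq_const) auto
    have "fps_nth W 0 \<noteq> 0" using \<open>W \<noteq> 0\<close> Wc by (metis fps_const_0_eq_0)
    moreover have "entire_eval absv W x0 = fps_nth W 0" by (subst Wc) simp
    ultimately show False using vW[of x0] v(3) by simp
  qed
  then obtain k where k: "1 \<le> k" "fps_nth W k \<noteq> 0" by blast
  have W_surj: "\<exists>x. entire_eval absv W x = z" for z using entire_surj[OF W(1) k] .
  \<comment> \<open>Every y other than \<open>c\<close> is a value of \<open>v\<close>, because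
    \<open>W\<close> is surjective; so \<open>c\<close> is the only pole of
    \<open>u\<close>.\<close>
  have u_finite: "mero_eval absv u y \<noteq> None" if "y \<noteq> c" for y
  proof -
    obtain x where x: "entire_eval absv W x = 1 / (y - c)" using W_surj by blast
    then have "mero_eval absv v x = Some y" using vW[of x] that by simp
    then show ?thesis using comp by simp
  qed
  obtain a b where ab: "entire absv a" "entire absv b" "b \<noteq> 0" "u = fps_to_fls a / fps_to_fls b"
    "entire_eval absv a c \<noteq> 0 \<or> entire_eval absv b c \<noteq> 0"
    using mero_local_rep[OF u(1)] by blast
  have bc: "entire_eval absv b c = 0"
  proof (rule ccontr)
    assume "entire_eval absv b c \<noteq> 0"
    from mero_eval_frac[OF ab(1,2) this] show False using c ab(4) by simp
  qed
  obtain m b1 where b1: "entire absv b1" "b = lin c ^ m * b1" "entire_eval absv b1 c \<noteq> 0"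
    by (rule order_factor[OF ab(2,3)])
  have m: "1 \<le> m" using bc b1 by (cases m) auto
  have b1_nz: "b1 \<noteq> 0" using b1(3) by auto
  \<comment> \<open>This is \<open>u\<close> times (X - c)^m with m the order of the pole, hence
    pole-free.\<close>
  define G where "G = fps_to_fls a / fps_to_fls b1"
  have "G \<in> meromorphic_functions absv"
    unfolding G_def meromorphic_functions_def using ab(1) b1(1) b1_nz by blast
  moreover have "mero_eval absv G y \<noteq> None" for y
  proof (cases "y = c")
    case True
    then show ?thesis using mero_eval_frac[OF ab(1) b1(1,3)] by (simp add: G_def)
  next
    case False
    then obtain t where "has_finite_value absv u y t" using u_finite mero_eval_Some_iff by blast
    then obtain a' b' where ab': "entire absv a'" "entire absv b'" "entire_eval absv b' y \<noteq> 0"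
      "u = fps_to_fls a' / fps_to_fls b'" by (auto simp: has_finite_value_def)
    have "a * b' = b * a'"
      using fls_fraction_eq_iff[OF ab(3) nonzero_of_eval[OF ab'(3)]] ab(4) ab'(4) by metis
    then have "a * b' = b1 * (lin c ^ m * a')" by (simp add: b1(2) mult_ac)
    then have "G = fps_to_fls (lin c ^ m * a') / fps_to_fls b'"
      unfolding G_def using fls_fraction_eq_iff[OF b1_nz nonzero_of_eval[OF ab'(3)]] by blast
    then show ?thesis
      using mero_eval_frac[OF entire_mult[OF entire_power[OF entire_lin] ab'(1)] ab'(2,3)] by simp
  qed
  ultimately obtain A where A: "entire absv A" "G = fps_to_fls A"
    using entire_of_no_poles by blast
  have a_eq: "a = b1 * A"
    using A(2) fls_fraction_eq_iff[OF b1_nz, of 1 a A] by (simp add: G_def)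
  then have "a * lin c ^ m = b * A" by (simp add: b1(2) mult_ac)
  then have u_eq: "u = fps_to_fls A / fps_to_fls (lin c ^ m)"
    unfolding ab(4) using fls_fraction_eq_iff[OF ab(3), of "lin c ^ m"] by simp
  have Ac: "entire_eval absv A c \<noteq> 0"
    using ab(5) bc by (auto simp: a_eq eval_mult b1(1) A(1))
  have uA: "mero_eval absv u y = Some (entire_eval absv A y / (y - c) ^ m)" if "y \<noteq> c" for y
    using mero_eval_frac[OF A(1) entire_power[OF entire_lin], of c m y] that
    by (simp add: u_eq eval_power)
  \<comment> \<open>\<open>u\<close> is bounded at infinity, so \<open>A\<close> grows at most like
    the denominator (X - c)^m.\<close>
  have A_coeff: "fps_nth A k = 0" if "m < k" for k
  proof (rule polynomial_growth[OF A(1) _ _ that])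
    show "0 < max M (absv c + 1)" using rM(2) by simp
    fix y assume y: "max M (absv c + 1) \<le> absv y"
    then have "y \<noteq> c" by auto
    have yc: "absv (y - c) \<le> absv y" using y by (intro absv_diff_le) auto
    have "absv (entire_eval absv A y / (y - c) ^ m) \<le> \<Phi>"
      using bound[of y] y uA[OF \<open>y \<noteq> c\<close>] by auto
    then have "absv (entire_eval absv A y) \<le> \<Phi> * absv (y - c) ^ m"
      using \<open>y \<noteq> c\<close> by (simp add: absv_divide absv_power absv_pos divide_le_eq)
    also have "\<dots> \<le> \<Phi> * absv y ^ m"
      using yc gnorm_nonneg[OF \<phi>(1), of r] rM(1)
      by (intro mult_left_mono power_mono) (auto simp: \<Phi>_def absv_nonneg)
    finally show "absv (entire_eval absv A y) \<le> \<Phi> * absv y ^ m" .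
  qed
  define PA where "PA = (\<Sum>i\<le>m. monom (fps_nth A i) i)"
  have A_PA: "A = fps_of_poly PA"
    using A_coeff by (intro fps_ext) (auto simp: PA_def coeff_sum not_le)
  define PB where "PB = pcompose PA [:c, 1:]"
  have "degree PA \<le> m" by (intro degree_le) (auto simp: PA_def coeff_sum)
  then have deg: "degree PB \<le> m" using degree_pcompose_le[of PA "[:c, 1:]"] by (simp add: PB_def)
  have PB0: "coeff PB 0 \<noteq> 0"
    using Ac by (simp add: A_PA PB_def poly_pcompose flip: poly_0_coeff_0)
  \<comment> \<open>The reversal z^m PB(1 / z) of the expansion of \<open>A\<close> at
    \<open>c\<close>, which equals u(c + 1 / z). Its coefficient of index m is A(c), hence
    nonzero.\<close>
  define U where "U = (\<Sum>i\<le>m. monom (coeff PB i) (m - i))"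
  have U_eval: "poly U z = z ^ m * poly PB (1 / z)" if "z \<noteq> 0" for z
  proof -
    have "poly PB (1 / z) = (\<Sum>i\<le>m. coeff PB i * (1 / z) ^ i)"
      using deg unfolding poly_altdef by (intro sum.mono_neutral_left) (auto simp: coeff_eq_0)
    then have "z ^ m * poly PB (1 / z) = (\<Sum>i\<le>m. coeff PB i * (z ^ m * (1 / z) ^ i))"
      by (simp add: sum_distrib_left mult_ac)
    also have "\<dots> = (\<Sum>i\<le>m. coeff PB i * z ^ (m - i))"
      using that by (intro sum.cong) (auto simp: power_diff power_one_over)
    finally show ?thesis by (simp add: U_def poly_sum poly_monom)
  qed
  have coeff_U: "coeff U m = coeff PB 0"
  proof -
    have "coeff U m = (\<Sum>i\<le>m. if m - i = m then coeff PB i else 0)"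
      by (simp add: U_def coeff_sum)
    also have "\<dots> = (\<Sum>i\<le>m. if i = 0 then coeff PB i else 0)"
      using m by (intro sum.cong) auto
    finally show ?thesis by simp
  qed
  have \<phi>U: "entire_eval absv \<phi> x = poly U (entire_eval absv W x)" if "entire_eval absv W x \<noteq> 0" for x
  proof -
    let ?z = "entire_eval absv W x"
    have "Some (entire_eval absv \<phi> x) = mero_eval absv u (c + 1 / ?z)" using comp[OF vW[OF that]] by simp
    also have "\<dots> = Some (entire_eval absv A (c + 1 / ?z) / (1 / ?z) ^ m)"
      using uA[of "c + 1 / ?z"] that by simp
    also have "entire_eval absv A (c + 1 / ?z) = poly PB (1 / ?z)"
      by (simp add: A_PA PB_def poly_pcompose)
    finally show ?thesis using U_eval[OF that] that by (simp add: power_one_over)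
  qed
  define \<psi> where "\<psi> = (\<Sum>i\<le>m. fps_const (coeff U i) * W ^ i)"
  have "degree U \<le> m" by (intro degree_le) (auto simp: U_def coeff_sum intro!: sum.neutral)
  have \<psi>_aux: "entire absv (\<Sum>i\<le>n. fps_const (coeff U i) * W ^ i) \<and>
      entire_eval absv (\<Sum>i\<le>n. fps_const (coeff U i) * W ^ i) x = (\<Sum>i\<le>n. coeff U i * entire_eval absv W x ^ i)" for n x
    by (induction n) (auto simp: eval_add eval_mult eval_power entire_add entire_mult entire_power W(1))
  have "poly U z = (\<Sum>i\<le>m. coeff U i * z ^ i)" for z
    using \<open>degree U \<le> m\<close> unfolding poly_altdef by (intro sum.mono_neutral_left) (auto simp: coeff_eq_0)
  then have \<psi>: "entire absv \<psi>" "entire_eval absv \<psi> x = poly U (entire_eval absv W x)" for x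
    using \<psi>_aux[of m] by (auto simp: \<psi>_def)
  \<comment> \<open>The factor \<open>W\<close> covers the zeros of \<open>W\<close>, that is, the
    poles of \<open>v\<close>.\<close>
  have "\<phi> * W = \<psi> * W"
  proof (rule entire_eqI)
    fix x
    show "entire_eval absv (\<phi> * W) x = entire_eval absv (\<psi> * W) x"
      using \<phi>U[of x] by (cases "entire_eval absv W x = 0") (simp_all add: eval_mult \<phi>(1) \<psi> W(1))
  qed (intro entire_mult \<phi>(1) \<psi>(1) W(1))+
  then have "\<phi> = \<psi>" using \<open>W \<noteq> 0\<close> by simp
  then have "entire_eval absv \<phi> x = entire_eval absv (fps_of_poly U) (entire_eval absv W x)" for x
    using \<psi>(2) by simp
  moreover have "nonaffine (fps_of_poly U)"
  proof -
    \<comment> \<open>A simple pole would make \<open>u\<close> the quotient of an affine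
      \<open>A\<close> by X - c, hence linear rational.\<close>
    have "2 \<le> m"
    proof (rule ccontr)
      assume "\<not> 2 \<le> m"
      then have "m = 1" using m by simp
      have A_eq: "A = fps_const (fps_nth A 1) * fps_X + fps_const (fps_nth A 0)"
        using A_coeff \<open>m = 1\<close> by (intro fps_affine_eq) auto
      moreover have "lin c ^ m = fps_const 1 * fps_X + fps_const (- c)"
        unfolding \<open>m = 1\<close> by (intro fps_ext) simp
      moreover have "fps_nth A 1 * (- c) - fps_nth A 0 * 1 \<noteq> 0"
      proof -
        have "entire_eval absv A c = fps_nth A 1 * c + fps_nth A 0"
          by (subst A_eq) (simp add: eval_add eval_mult entire_mult)
        then have "fps_nth A 1 * (- c) - fps_nth A 0 * 1 = - entire_eval absv A c" by simp
        then show ?thesis using Ac by simp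
      qed
      moreover note A_eq
      ultimately show False
        using linear_rational_frac u_eq u(2) by metis
    qed
    then show ?thesis using PB0 coeff_U by (auto simp: nonaffine_def)
  qed
  moreover have "nonaffine W"
  proof (rule ccontr)
    assume "\<not> nonaffine W"
    then have *: "\<And>n. 2 \<le> n \<Longrightarrow> fps_nth W n = 0" by (auto simp: nonaffine_def)
    then have "k = 1" using k by (cases "2 \<le> k") auto
    define p where "p = fps_nth W 1"
    define q where "q = fps_nth W 0"
    have W_eq: "W = fps_const p * fps_X + fps_const q" unfolding p_def q_def by (rule fps_affine_eq[OF *])
    have "W1 = fps_const (c * p) * fps_X + fps_const (1 + c * q)"
      unfolding W1_def W_eq by (intro fps_ext) (simp add: algebra_simps)
    moreover have "c * p * q - (1 + c * q) * p \<noteq> 0"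
      using k \<open>k = 1\<close> by (simp add: algebra_simps p_def)
    ultimately show False
      using linear_rational_frac v_eq W_eq v(2) by metis
  qed
  ultimately show ?thesis using W(1) by (intro exI[of _ "fps_of_poly U"] exI[of _ W]) auto
qed

theorem decomposition_entire:
  assumes u: "u \<in> meromorphic_functions absv" "\<not> linear_rational u"
    and v: "v \<in> meromorphic_functions absv" "\<not> linear_rational v"
    and comp: "is_composition absv (fps_to_fls \<phi>) u v"
    and \<phi>: "entire absv \<phi>" "\<And>c. \<phi> \<noteq> fps_const c"
  obtains U V where "entire absv U" "entire absv V" "nonaffine U" "nonaffine V"
    "\<And>x. entire_eval absv \<phi> x = entire_eval absv U (entire_eval absv V x)"
proof -
  have comp': "mero_eval absv u y = Some (entire_eval absv \<phi> x)" if "mero_eval absv v x = Some y" for x y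
    using comp that mero_eval_entire[OF \<phi>(1)] unfolding is_composition_def by metis
  show thesis
  proof (cases "\<exists>x. mero_eval absv v x = None")
    case True
    then show ?thesis using pole_decomposition[OF u v _ comp' \<phi>] that by blast
  next
    case False
    then obtain V where V: "entire absv V" "v = fps_to_fls V"
      using entire_of_no_poles[OF v(1)] False by metis
    have "mero_eval absv u (entire_eval absv V x) = Some (entire_eval absv \<phi> x)" for x
      using comp' mero_eval_entire[OF V(1)] V(2) by simp
    then show ?thesis using entire_decomposition[OF u V(1) _ _ \<phi>] V v(2) that by blast
  qed
qed

section \<open>Composition of entire functions\<close>

lemma gnorm_power: "entire absv f \<Longrightarrow> 0 < r \<Longrightarrow> gnorm (f ^ n) r = gnorm f r ^ n"
proof (induction n)
  case 0
  then show ?case using gnorm_const[of r 1] by simp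
next
  case (Suc n)
  then show ?case by (simp add: gnorm_mult entire_power)
qed

lemma eval_sums_limit:
  assumes "entire absv f"
  shows "(\<lambda>N. absv ((\<Sum>n<N. fps_nth f n * x ^ n) - entire_eval absv f x)) \<longlonglongrightarrow> 0"
  using entire_eval_sums[OF assms, of x] by (simp add: fps_sums_to_iff)

text \<open>The constant coefficient of \<open>V\<close> may be nonzero, so each coefficient of the
  composite is a limit. The summands U_n V^n have Gauss norm
  \<open>absv (fps_nth U n) * gnorm V r ^ n\<close>, which tends to 0 at every radius and controls
  all coefficients at once.\<close>

lemma entire_compose:
  assumes U: "entire absv U" and V: "entire absv V"
  obtains W where "entire absv W" "\<And>x. entire_eval absv W x = entire_eval absv U (entire_eval absv V x)"
proof -
  define P where "P N = (\<Sum>n<N. fps_const (fps_nth U n) * V ^ n)" for N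
  have P: "entire absv (P N)" for N
    by (induction N) (auto simp: P_def intro!: entire_add entire_mult entire_power V)
  have P_eval: "entire_eval absv (P N) x = (\<Sum>n<N. fps_nth U n * entire_eval absv V x ^ n)" for N x
  proof (induction N)
    case (Suc N)
    have "P (Suc N) = P N + fps_const (fps_nth U N) * V ^ N" by (simp add: P_def)
    then show ?case by (simp add: eval_add eval_mult eval_power entire_mult entire_power V P Suc)
  qed (simp add: P_def)
  have term_le: "absv (fps_nth (fps_const (fps_nth U n) * V ^ n) k) * r ^ k \<le> absv (fps_nth U n) * gnorm V r ^ n"
    if "0 < r" for n k r
    using gnorm_upper[of "fps_const (fps_nth U n) * V ^ n" r k] that
    by (simp add: gnorm_mult gnorm_power gnorm_const entire_mult entire_power V)
  have tail: "absv (fps_nth (P N') k - fps_nth (P N) k) * r ^ k \<le> B"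
    if r: "0 < r" and B: "0 \<le> B" "\<And>n. N \<le> n \<Longrightarrow> absv (fps_nth U n) * gnorm V r ^ n \<le> B" and "N \<le> N'" for r B N N' k
    using \<open>N \<le> N'\<close>
  proof (induction N' rule: dec_induct)
    case base
    then show ?case using B by simp
  next
    case (step n)
    let ?t = "fps_nth (fps_const (fps_nth U n) * V ^ n) k"
    have rk: "0 < r ^ k" using r by simp
    have "absv (fps_nth (P n) k - fps_nth (P N) k) \<le> B / r ^ k" using step.IH rk by (simp add: field_simps)
    moreover have "absv ?t \<le> B / r ^ k"
      using order_trans[OF term_le[OF r] B(2)[OF step.hyps(1)]] rk by (simp add: field_simps)
    ultimately have "absv ((fps_nth (P n) k - fps_nth (P N) k) + ?t) \<le> B / r ^ k" by (rule absv_add_le)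
    moreover have "fps_nth (P (Suc n)) k = fps_nth (P n) k + ?t" by (simp add: P_def)
    ultimately show ?case using rk by (simp add: field_simps)
  qed
  have "\<exists>c. (\<lambda>N. absv (fps_nth (P N) k - c)) \<longlonglongrightarrow> 0" for k
  proof -
    have le: "absv (fps_nth (P (Suc N)) k - fps_nth (P N) k) \<le> absv (fps_nth U N) * gnorm V 1 ^ N" for N
      using term_le[of 1 N k] by (simp add: P_def)
    have "(\<lambda>N. absv (fps_nth U N) * gnorm V 1 ^ N) \<longlonglongrightarrow> 0"
      using entire_tendsto[OF U] gnorm_nonneg[OF V, of 1] by simp
    then show ?thesis using le by (rule ultrametric_cauchy[of _ "\<lambda>N. fps_nth (P N) k"]) blast
  qed
  then obtain c where c: "\<And>k. (\<lambda>N. absv (fps_nth (P N) k - c k)) \<longlonglongrightarrow> 0" by metis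
  define W where "W = Abs_fps c"
  have lim: "absv (fps_nth W k - fps_nth (P N) k) * r ^ k \<le> B"
    if r: "0 < r" and B: "0 \<le> B" "\<And>n. N \<le> n \<Longrightarrow> absv (fps_nth U n) * gnorm V r ^ n \<le> B" for r B N k
  proof (rule ccontr)
    have rk: "0 < r ^ k" using r by simp
    assume "\<not> ?thesis"
    then have gt: "B / r ^ k < absv (c k - fps_nth (P N) k)" using rk by (simp add: W_def field_simps)
    then have "0 < absv (c k - fps_nth (P N) k)" using B(1) rk by (smt (verit) divide_nonneg_nonneg)
    from order_tendstoD(2)[OF c this]
    obtain N0 where N0: "\<And>n. N0 \<le> n \<Longrightarrow> absv (fps_nth (P n) k - c k) < absv (c k - fps_nth (P N) k)"
      unfolding eventually_sequentially by blast
    define n where "n = max N0 N"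
    have "absv ((fps_nth (P n) k - c k) + (c k - fps_nth (P N) k)) = absv (c k - fps_nth (P N) k)"
      using N0[of n] by (subst add.commute, intro absv_add_eq) (simp add: n_def)
    moreover have "absv (fps_nth (P n) k - fps_nth (P N) k) \<le> B / r ^ k"
      using tail[where N = N and N' = n and k = k, OF r B] rk by (simp add: n_def field_simps)
    ultimately show False using gt by simp
  qed
  have W: "entire absv W"
  proof (rule entireI_bounded)
    fix r :: real assume "1 \<le> r"
    then have r: "0 < r" by simp
    obtain B where B: "\<And>n. absv (fps_nth U n) * gnorm V r ^ n \<le> B"
      using entire_bounded[OF U] gnorm_nonneg[OF V, of r] r by fastforce
    have "0 \<le> B" using B[of 0] absv_nonneg[of "fps_nth U 0"] by simp
    then have "absv (fps_nth W k) * r ^ k \<le> B" for k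
      using lim[where N = 0 and k = k, OF r _ B] by (simp add: P_def)
    then show "\<exists>B. \<forall>k. absv (fps_nth W k) * r ^ k \<le> B" by blast
  qed
  have "entire_eval absv W x = entire_eval absv U (entire_eval absv V x)" for x
  proof (rule ccontr)
    let ?u = "entire_eval absv U (entire_eval absv V x)" and ?w = "entire_eval absv W x"
    assume "?w \<noteq> ?u"
    then have pos: "0 < absv (?w - ?u)" by (intro absv_pos) simp
    define r where "r = max 1 (absv x)"
    have r: "0 < r" "absv x \<le> r" by (auto simp: r_def)
    have "(\<lambda>n. absv (fps_nth U n) * gnorm V r ^ n) \<longlonglongrightarrow> 0"
      using entire_tendsto[OF U] gnorm_nonneg[OF V, of r] r by simp
    then obtain N1 where N1: "\<And>n. N1 \<le> n \<Longrightarrow> absv (fps_nth U n) * gnorm V r ^ n < absv (?w - ?u) / 2"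
      using order_tendstoD(2)[of _ 0 sequentially "absv (?w - ?u) / 2"] pos by (auto simp: eventually_sequentially)
    obtain N2 where N2: "\<And>n. N2 \<le> n \<Longrightarrow> absv (entire_eval absv (P n) x - ?u) < absv (?w - ?u)"
      using order_tendstoD(2)[OF eval_sums_limit[OF U] pos] by (auto simp: eventually_sequentially P_eval)
    \<comment> \<open>At \<open>x\<close> the approximant \<open>P N\<close> is closer to each of
      the two values than they are to each other, against the strong triangle inequality.\<close>
    define N where "N = max N1 N2"
    have "absv (fps_nth W k - fps_nth (P N) k) * r ^ k \<le> absv (?w - ?u) / 2" for k
    proof (rule lim[OF r(1)])
      fix n assume "N \<le> n"
      then show "absv (fps_nth U n) * gnorm V r ^ n \<le> absv (?w - ?u) / 2"
        using N1[of n] by (simp add: N_def less_imp_le)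
    qed (use pos in simp)
    then have "gnorm (W - P N) r \<le> absv (?w - ?u) / 2" by (intro gnorm_least) simp
    then have "absv (?w - entire_eval absv (P N) x) < absv (?w - ?u)"
      using absv_eval_le[OF entire_diff[OF W P[of N]] r(2)] pos by (simp add: eval_diff W P)
    moreover have "absv (entire_eval absv (P N) x - ?u) < absv (?w - ?u)" using N2[of N] by (simp add: N_def)
    ultimately show False
      using absv_add_le_max[of "?w - entire_eval absv (P N) x" "entire_eval absv (P N) x - ?u"] by simp
  qed
  then show thesis using W that by blast
qed

text \<open>Writing U = U(w) + (X - w) H with w = V(x), the composite is U(w) + (V - w) G with G the
  composite of H and V; in its formal derivative the term with V - w vanishes at x.\<close>

lemma eval_deriv_compose:
  assumes U: "entire absv U" and V: "entire absv V" and \<phi>: "entire absv \<phi>"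
    and comp: "\<And>x. entire_eval absv \<phi> x = entire_eval absv U (entire_eval absv V x)"
  shows "entire_eval absv (fps_deriv \<phi>) x =
    entire_eval absv (fps_deriv U) (entire_eval absv V x) * entire_eval absv (fps_deriv V) x"
proof -
  define w where "w = entire_eval absv V x"
  obtain H where H: "entire absv H" "U = fps_const (entire_eval absv U w) + lin w * H"
    by (rule entire_expand[OF U])
  obtain G where G: "entire absv G" "\<And>x. entire_eval absv G x = entire_eval absv H (entire_eval absv V x)"
    using entire_compose[OF H(1) V] by blast
  have "\<phi> = fps_const (entire_eval absv U w) + (V - fps_const w) * G"
  proof (rule entire_eqI)
    fix y
    have "entire_eval absv \<phi> y = entire_eval absv U w + (entire_eval absv V y - w) * entire_eval absv H (entire_eval absv V y)"
      unfolding comp by (subst H(2)) (simp add: eval_add eval_mult entire_mult H(1))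
    then show "entire_eval absv \<phi> y = entire_eval absv (fps_const (entire_eval absv U w) + (V - fps_const w) * G) y"
      by (simp add: eval_add eval_mult eval_diff entire_diff entire_mult G V)
  qed (intro \<phi> entire_add entire_mult entire_diff V G(1) entire_const)+
  then have "fps_deriv \<phi> = fps_deriv V * G + (V - fps_const w) * fps_deriv G"
    by simp
  then have "entire_eval absv (fps_deriv \<phi>) x = entire_eval absv (fps_deriv V) x * entire_eval absv H w"
    by (simp add: eval_add eval_mult eval_diff entire_add entire_diff entire_mult entire_deriv G V w_def)
  then show ?thesis using deriv_expand[OF H] by (simp add: w_def)
qed

text \<open>With a single preimage x, V - w would be a constant times a power of X - x, hence a
  polynomial.\<close>

lemma transcendental_two_preimages:
  assumes V: "entire absv V" "V \<notin> range fps_of_poly"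
  obtains x y where "x \<noteq> y" "entire_eval absv V x = w" "entire_eval absv V y = w"
proof -
  have "\<exists>k\<ge>1. fps_nth V k \<noteq> 0"
  proof (rule ccontr)
    assume "\<not> ?thesis"
    then have "V = fps_const (fps_nth V 0)" by (intro fps_eq_const) auto
    then have "V = fps_of_poly [:fps_nth V 0:]" unfolding fps_of_poly_const .
    then show False using V(2) by blast
  qed
  then obtain x where x: "entire_eval absv V x = w" using entire_surj[OF V(1)] by blast
  have "\<exists>y. y \<noteq> x \<and> entire_eval absv V y = w"
  proof (rule ccontr)
    assume "\<not> ?thesis"
    then have *: "y = x" if "entire_eval absv V y = w" for y using that by blast
    have "V - fps_const w \<noteq> 0"
    proof
      assume "V - fps_const w = 0"
      then have "V = fps_of_poly [:w:]" by simp
      then show False using V(2) by blast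
    qed
    moreover have "y = x" if "entire_eval absv (V - fps_const w) y = 0" for y
      using that * by (simp add: eval_diff V(1))
    ultimately obtain c m where "V - fps_const w = lin x ^ m * fps_const c"
      by (rule single_zero[OF entire_diff[OF V(1) entire_const]])
    then have "V = lin x ^ m * fps_const c + fps_const w" by (simp add: diff_eq_eq)
    moreover have "lin x = fps_of_poly [:- x, 1:]"
      by (simp add: fps_of_poly_pCons)
    ultimately have "V = fps_of_poly ([:- x, 1:] ^ m * [:c:] + [:w:])"
      by (simp only: fps_of_poly_add fps_of_poly_mult fps_of_poly_power fps_of_poly_const)
    then show False using V(2) by blast
  qed
  then show thesis using x that by blast
qed

text \<open>Each point is encoded by an isolation radius 1 / (n + 1) and a dense point within it of
  each coordinate. Points with the same code are that close to each other by the ultrametric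
  inequality, so the encoding is injective.\<close>

lemma countable_isolated:
  fixes T :: "('a \<times> 'a \<times> 'a) set"
  assumes "\<And>x y a. (x, y, a) \<in> T \<Longrightarrow> \<exists>\<rho>>0. \<forall>x' y' a'. (x', y', a') \<in> T \<longrightarrow>
    absv (x' - x) < \<rho> \<longrightarrow> absv (y' - y) < \<rho> \<longrightarrow> absv (a' - a) < \<rho> \<longrightarrow> (x', y', a') = (x, y, a)"
  shows "countable T"
proof -
  obtain D :: "'a set" where D: "countable D" "\<And>x \<epsilon>. 0 < \<epsilon> \<Longrightarrow> \<exists>d\<in>D. absv (d - x) < \<epsilon>"
    using countable_dense by blast
  let ?N = "\<lambda>n x d. d \<in> D \<and> absv (d - x) < 1 / real (Suc n)"
  let ?Q = "\<lambda>(x, y, a) (n, d1, d2, d3). ?N n x d1 \<and> ?N n y d2 \<and> ?N n a d3 \<and>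
    (\<forall>x' y' a'. (x', y', a') \<in> T \<longrightarrow> absv (x' - x) < 1 / real (Suc n) \<longrightarrow> absv (y' - y) < 1 / real (Suc n) \<longrightarrow>
      absv (a' - a) < 1 / real (Suc n) \<longrightarrow> (x', y', a') = (x, y, a))"
  have "\<forall>t\<in>T. \<exists>q. ?Q t q"
  proof
    fix t assume t: "t \<in> T"
    obtain x y a where txy: "t = (x, y, a)" by (cases t)
    obtain \<rho> where \<rho>: "0 < \<rho>" "\<And>x' y' a'. (x', y', a') \<in> T \<Longrightarrow> absv (x' - x) < \<rho> \<Longrightarrow> absv (y' - y) < \<rho> \<Longrightarrow>
      absv (a' - a) < \<rho> \<Longrightarrow> (x', y', a') = (x, y, a)"
      using assms t txy by blast
    obtain n where n: "1 / real (Suc n) < \<rho>" using nat_approx_posE[OF \<rho>(1)] by blast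
    have "0 < 1 / real (Suc n)" by simp
    then obtain d1 d2 d3 where d: "?N n x d1" "?N n y d2" "?N n a d3" using D(2) by meson
    have "(x', y', a') = (x, y, a)" if "(x', y', a') \<in> T" "absv (x' - x) < 1 / real (Suc n)"
      "absv (y' - y) < 1 / real (Suc n)" "absv (a' - a) < 1 / real (Suc n)" for x' y' a'
      by (rule \<rho>(2)) (use that n in linarith)+
    then have "?Q t (n, d1, d2, d3)" using d txy by simp
    then show "\<exists>q. ?Q t q" by blast
  qed
  then obtain q where "\<forall>t\<in>T. ?Q t (q t)" by (rule bchoice[THEN exE])
  then have q: "?Q t (q t)" if "t \<in> T" for t using that by (rule bspec)
  have near: "absv (x' - x) < e" if "absv (d - x) < e" "absv (d - x') < e" for d x x' e
    using absv_diff_less[OF that] by simp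
  have "inj_on q T"
  proof (rule inj_onI)
    fix s t assume st: "s \<in> T" "t \<in> T" "q s = q t"
    obtain n d1 d2 d3 where qs: "q s = (n, d1, d2, d3)" by (cases "q s")
    obtain x y a where s: "s = (x, y, a)" by (cases s)
    obtain x' y' a' where t: "t = (x', y', a')" by (cases t)
    have "?Q s (n, d1, d2, d3)" "?Q t (n, d1, d2, d3)"
      using q[OF st(1)] q[OF st(2)] unfolding st(3)[symmetric] qs .
    then have "?Q (x, y, a) (n, d1, d2, d3)" "?Q (x', y', a') (n, d1, d2, d3)"
      unfolding s t .
    then have "(x', y', a') = (x, y, a)"
      using st(2) t near[of d1 x _ x'] near[of d2 y _ y'] near[of d3 a _ a'] by simp
    then show "s = t" using s t by simp
  qed
  moreover have "q ` T \<subseteq> UNIV \<times> D \<times> D \<times> D" using q by fastforce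
  then have "countable (q ` T)"
    by (rule countable_subset) (intro countable_SIGMA D(1) countableI_type)
  ultimately show ?thesis using countable_image_inj_on by blast
qed

section \<open>Critical points\<close>

lemma deriv_mult_lin: "fps_deriv (f * lin a) = fps_deriv f * lin a + f"
  by (simp add: add.commute)

lemma shift_parameter: "f * lin a = f * lin b - fps_const (a - b) * f"
  by (simp add: algebra_simps flip: fps_const_sub)

text \<open>Near z the derivative of F = f (X - b) is (X - z) q with |q| constant. A nearby critical
  point x for the parameter a satisfies (x - z) q(x) = (a - b) f'(x), which bounds x - z linearly;
  as F - F(z) is quadratic in x - z, the critical value moves by -(a - b) f(z) up to second
  order.\<close>

lemma nearby_critical_point:
  assumes f: "entire absv f"
    and crit: "entire_eval absv (fps_deriv (f * lin b)) z = 0"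
    and nondeg: "entire_eval absv (fps_deriv (fps_deriv (f * lin b))) z \<noteq> 0"
  obtains d C where "0 < d" "0 \<le> C"
    "\<And>x a. absv (x - z) < d \<Longrightarrow> entire_eval absv (fps_deriv (f * lin a)) x = 0 \<Longrightarrow>
      absv (x - z) \<le> C * absv (a - b) \<and>
      absv (entire_eval absv (f * lin a) x - entire_eval absv (f * lin b) z + (a - b) * entire_eval absv f z)
        \<le> C * absv (a - b) ^ 2"
proof -
  define F where "F = f * lin b"
  have F: "entire absv F" unfolding F_def by (intro entire_mult f entire_lin)
  obtain q where q: "entire absv q" "fps_deriv F = lin z * q"
    using entire_divide_root[OF entire_deriv[OF F]] crit unfolding F_def by blast
  have qz: "entire_eval absv q z \<noteq> 0"
    using deriv_expand[OF q(1), of "fps_deriv F" 0 z] q(2) nondeg by (simp add: F_def)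
  obtain G where G: "entire absv G" "F = fps_const (entire_eval absv F z) + lin z * G"
    by (rule entire_expand[OF F])
  have "entire_eval absv G z = 0" using deriv_expand[OF G] crit by (simp add: F_def)
  then obtain s where s: "entire absv s" "G = lin z * s" using entire_divide_root G(1) by blast
  obtain f1 where f1: "entire absv f1" "f = fps_const (entire_eval absv f z) + lin z * f1"
    by (rule entire_expand[OF f])
  define R where "R = max 1 (absv z)"
  have R: "0 \<le> R" by (simp add: R_def)
  define \<kappa> where "\<kappa> = absv (entire_eval absv q z)"
  have \<kappa>: "0 < \<kappa>" using qz by (simp add: \<kappa>_def absv_pos)
  obtain d1 where d1: "0 < d1" "\<And>x. absv (x - z) < d1 \<Longrightarrow> absv (entire_eval absv q x - entire_eval absv q z) < \<kappa>"
    using entire_continuous[OF q(1) \<kappa>, of z] by blast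
  define C1 where "C1 = gnorm (fps_deriv f) R / \<kappa>"
  have C1: "0 \<le> C1" using gnorm_nonneg[OF entire_deriv[OF f] R] \<kappa> by (simp add: C1_def)
  define C2 where "C2 = max (C1 ^ 2 * gnorm s R) (C1 * gnorm f1 R)"
  have C2: "0 \<le> C2" using C1 gnorm_nonneg[OF s(1) R] by (simp add: C2_def le_max_iff_disj)
  show thesis
  proof (rule that[of "min d1 1" "max C1 C2"])
    show "0 < min d1 1" "0 \<le> max C1 C2" using d1 C1 by auto
    fix x a assume x: "absv (x - z) < min d1 1" and cx: "entire_eval absv (fps_deriv (f * lin a)) x = 0"
    let ?\<delta> = "absv (a - b)" and ?h = "x - z"
    have "absv (?h + z) \<le> R" using x by (intro absv_add_le) (auto simp: R_def)
    then have xR: "absv x \<le> R" by simp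
    have qx: "absv (entire_eval absv q x) = \<kappa>"
      using absv_eqI[of "entire_eval absv q x" "entire_eval absv q z"] d1(2)[of x] x by (simp add: \<kappa>_def)
    have "fps_deriv (f * lin a) = lin z * q - fps_const (a - b) * fps_deriv f"
      unfolding shift_parameter[of f a b] q(2)[symmetric] F_def by simp
    then have eq1: "?h * entire_eval absv q x = (a - b) * entire_eval absv (fps_deriv f) x"
      using cx by (simp add: eval_diff eval_mult entire_mult entire_deriv f q(1))
    have "absv ?h * \<kappa> = ?\<delta> * absv (entire_eval absv (fps_deriv f) x)"
      using arg_cong[OF eq1, of absv] qx by (simp add: absv_mult)
    also have "\<dots> \<le> ?\<delta> * gnorm (fps_deriv f) R"
      by (intro mult_left_mono absv_eval_le entire_deriv f xR absv_nonneg)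
    finally have h: "absv ?h \<le> C1 * ?\<delta>" using \<kappa> by (simp add: C1_def field_simps)
    have Fx: "entire_eval absv F x = entire_eval absv F z + ?h * (?h * entire_eval absv s x)"
      by (subst G(2)) (simp add: s(2) eval_add eval_mult entire_mult s(1))
    have fx: "entire_eval absv f x = entire_eval absv f z + ?h * entire_eval absv f1 x"
      by (subst f1(2)) (simp add: eval_add eval_mult entire_mult f1(1))
    have "entire_eval absv (f * lin a) x = entire_eval absv F x - (a - b) * entire_eval absv f x"
      unfolding shift_parameter[of f a b] F_def by (simp add: eval_diff eval_mult entire_mult f)
    then have eq2: "entire_eval absv (f * lin a) x - entire_eval absv F z + (a - b) * entire_eval absv f z
        = ?h * (?h * entire_eval absv s x) - (a - b) * (?h * entire_eval absv f1 x)"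
      unfolding Fx fx by (simp add: algebra_simps)
    have "absv (?h * (?h * entire_eval absv s x)) = absv ?h ^ 2 * absv (entire_eval absv s x)"
      by (simp add: absv_mult power2_eq_square)
    also have "\<dots> \<le> (C1 * ?\<delta>) ^ 2 * gnorm s R"
      using h by (intro mult_mono power_mono absv_eval_le s(1) xR) (auto simp: absv_nonneg)
    also have "\<dots> = C1 ^ 2 * gnorm s R * ?\<delta> ^ 2" by (simp add: power_mult_distrib)
    also have "\<dots> \<le> C2 * ?\<delta> ^ 2" by (intro mult_right_mono) (auto simp: C2_def)
    finally have t1: "absv (?h * (?h * entire_eval absv s x)) \<le> C2 * ?\<delta> ^ 2" .
    have "absv ((a - b) * (?h * entire_eval absv f1 x)) = ?\<delta> * (absv ?h * absv (entire_eval absv f1 x))"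
      by (simp add: absv_mult)
    also have "\<dots> \<le> ?\<delta> * ((C1 * ?\<delta>) * gnorm f1 R)"
      using h C1 by (intro mult_left_mono mult_mono absv_eval_le f1(1) xR) (auto simp: absv_nonneg)
    also have "\<dots> = C1 * gnorm f1 R * ?\<delta> ^ 2" by (simp add: power2_eq_square)
    also have "\<dots> \<le> C2 * ?\<delta> ^ 2" by (intro mult_right_mono) (auto simp: C2_def)
    finally have "absv (entire_eval absv (f * lin a) x - entire_eval absv F z + (a - b) * entire_eval absv f z) \<le> C2 * ?\<delta> ^ 2"
      unfolding eq2 by (rule absv_diff_le[OF t1])
    moreover have "C2 * ?\<delta> ^ 2 \<le> max C1 C2 * ?\<delta> ^ 2" "C1 * ?\<delta> \<le> max C1 C2 * ?\<delta>"
      by (intro mult_right_mono; simp add: absv_nonneg)+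
    ultimately show "absv ?h \<le> max C1 C2 * ?\<delta> \<and>
      absv (entire_eval absv (f * lin a) x - entire_eval absv (f * lin b) z + (a - b) * entire_eval absv f z)
        \<le> max C1 C2 * ?\<delta> ^ 2"
      using h unfolding F_def by linarith
  qed
qed

text \<open>
  As \<open>a\<close> varies, the critical value of \<open>f (X - a)\<close> at a nondegenerate critical point \<open>x\<close> moves with
  velocity \<open>- f x\<close>. If \<open>x\<close> and \<open>y\<close> share the nonzero critical value \<open>f x (x - a) = f y (y - a)\<close>,
  then \<open>f x \<noteq> f y\<close>, so the coincidence is destroyed by moving \<open>a\<close>.
\<close>

lemma countable_coincident_critical_values:
  assumes f: "entire absv f"
  shows "countable {(x, y, a). x \<noteq> y \<and>
    entire_eval absv (fps_deriv (f * lin a)) x = 0 \<and> entire_eval absv (fps_deriv (f * lin a)) y = 0 \<and>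
    entire_eval absv (fps_deriv (fps_deriv (f * lin a))) x \<noteq> 0 \<and>
    entire_eval absv (fps_deriv (fps_deriv (f * lin a))) y \<noteq> 0 \<and>
    entire_eval absv (f * lin a) x = entire_eval absv (f * lin a) y \<and> entire_eval absv (f * lin a) x \<noteq> 0}"
    (is "countable ?T")
proof (rule countable_isolated)
  fix x y a assume T: "(x, y, a) \<in> ?T"
  obtain d C where d: "0 < d" "0 \<le> C"
    "\<And>x' a'. absv (x' - x) < d \<Longrightarrow> entire_eval absv (fps_deriv (f * lin a')) x' = 0 \<Longrightarrow>
      absv (x' - x) \<le> C * absv (a' - a) \<and>
      absv (entire_eval absv (f * lin a') x' - entire_eval absv (f * lin a) x + (a' - a) * entire_eval absv f x)
        \<le> C * absv (a' - a) ^ 2"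
    using nearby_critical_point[OF f, of a x] T by auto
  obtain d' C' where d': "0 < d'" "0 \<le> C'"
    "\<And>x' a'. absv (x' - y) < d' \<Longrightarrow> entire_eval absv (fps_deriv (f * lin a')) x' = 0 \<Longrightarrow>
      absv (x' - y) \<le> C' * absv (a' - a) \<and>
      absv (entire_eval absv (f * lin a') x' - entire_eval absv (f * lin a) y + (a' - a) * entire_eval absv f y)
        \<le> C' * absv (a' - a) ^ 2"
    using nearby_critical_point[OF f, of a y] T by auto
  let ?fx = "entire_eval absv f x" and ?fy = "entire_eval absv f y"
  have val: "entire_eval absv (f * lin a) t = entire_eval absv f t * (t - a)" for t
    by (simp add: eval_mult f)
  have "?fx \<noteq> ?fy"
  proof
    assume "?fx = ?fy"
    then show False using T by (auto simp: val)
  qed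
  then have \<eta>: "0 < absv (?fx - ?fy)" by (intro absv_pos) simp
  define K where "K = C + C' + 1"
  have K: "0 < K" "C \<le> K" "C' \<le> K" using d d' by (auto simp: K_def)
  \<comment> \<open>Within this distance the second-order error K |a' - a|^2 is smaller than the
    first-order separation |a' - a| |f(x) - f(y)|.\<close>
  define \<rho> where "\<rho> = min (min d d') (absv (?fx - ?fy) / K)"
  have "0 < \<rho>" using d d' \<eta> K by (simp add: \<rho>_def)
  moreover have "(x', y', a') = (x, y, a)"
    if T': "(x', y', a') \<in> ?T" and near: "absv (x' - x) < \<rho>" "absv (y' - y) < \<rho>" "absv (a' - a) < \<rho>" for x' y' a'
  proof -
    let ?\<delta> = "absv (a' - a)"
    have X: "absv (x' - x) \<le> C * ?\<delta>"
      "absv (entire_eval absv (f * lin a') x' - entire_eval absv (f * lin a) x + (a' - a) * ?fx) \<le> C * ?\<delta> ^ 2"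
      using d(3)[of x' a'] T' near by (auto simp: \<rho>_def)
    have Y: "absv (y' - y) \<le> C' * ?\<delta>"
      "absv (entire_eval absv (f * lin a') y' - entire_eval absv (f * lin a) y + (a' - a) * ?fy) \<le> C' * ?\<delta> ^ 2"
      using d'(3)[of y' a'] T' near by (auto simp: \<rho>_def)
    have "a' = a"
    proof (rule ccontr)
      assume "a' \<noteq> a"
      then have \<delta>: "0 < ?\<delta>" by (intro absv_pos) simp
      have "C * ?\<delta> ^ 2 \<le> K * ?\<delta> ^ 2" "C' * ?\<delta> ^ 2 \<le> K * ?\<delta> ^ 2"
        using K by (auto intro!: mult_right_mono)
      then have "absv ((entire_eval absv (f * lin a') x' - entire_eval absv (f * lin a) x + (a' - a) * ?fx)
          - (entire_eval absv (f * lin a') y' - entire_eval absv (f * lin a) y + (a' - a) * ?fy)) \<le> K * ?\<delta> ^ 2"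
        using X(2) Y(2) by (intro absv_diff_le[of "_ - _ + _" _ "_ - _ + _"]) linarith+
      moreover have "(entire_eval absv (f * lin a') x' - entire_eval absv (f * lin a) x + (a' - a) * ?fx)
          - (entire_eval absv (f * lin a') y' - entire_eval absv (f * lin a) y + (a' - a) * ?fy) = (a' - a) * (?fx - ?fy)"
        using T T' by (simp add: algebra_simps)
      ultimately have "?\<delta> * absv (?fx - ?fy) \<le> ?\<delta> * (K * ?\<delta>)"
        by (simp add: absv_mult power2_eq_square mult_ac)
      then have "absv (?fx - ?fy) \<le> K * ?\<delta>" using \<delta> by simp
      moreover have "K * ?\<delta> < absv (?fx - ?fy)"
        using near(3) K by (simp add: \<rho>_def pos_less_divide_eq mult.commute)
      ultimately show False by simp
    qed
    then have "absv (x' - x) \<le> 0" "absv (y' - y) \<le> 0" using X(1) Y(1) by auto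
    then show ?thesis
      using \<open>a' = a\<close> absv_pos[of "x' - x"] absv_pos[of "y' - y"] by fastforce
  qed
  ultimately show "\<exists>\<rho>>0. \<forall>x' y' a'. (x', y', a') \<in> ?T \<longrightarrow> absv (x' - x) < \<rho> \<longrightarrow> absv (y' - y) < \<rho> \<longrightarrow>
      absv (a' - a) < \<rho> \<longrightarrow> (x', y', a') = (x, y, a)"
    by blast
qed

text \<open>At a zero of order m the leading coefficient is m (m - 1) - 2 m^2 = -m (m + 1) times a
  nonzero square, hence nonzero in characteristic 0.\<close>

lemma degenerate_discriminant_nonzero:
  assumes f: "entire absv f" "f \<noteq> 0" and z: "entire_eval absv f z = 0"
  shows "f * fps_deriv (fps_deriv f) - 2 * fps_deriv f ^ 2 \<noteq> 0"
proof
  assume D: "f * fps_deriv (fps_deriv f) - 2 * fps_deriv f ^ 2 = 0"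
  obtain m g where g: "entire absv g" "f = lin z ^ m * g" "entire_eval absv g z \<noteq> 0"
    by (rule order_factor[OF f])
  have m: "m \<noteq> 0" using z g by (cases m) auto
  let ?L = "lin z"
  \<comment> \<open>Differentiation followed by multiplication with \<open>lin z\<close> keeps the
    power m, which avoids the exponents m - 1 and m - 2.\<close>
  define g1 where "g1 = of_nat m * g + ?L * fps_deriv g"
  define g2 where "g2 = of_nat m * g1 + ?L * fps_deriv g1 - g1"
  have of_nat_eq: "of_nat k = fps_const (of_nat k :: 'a)" for k by (simp add: fps_of_nat)
  have g1: "entire absv g1" unfolding g1_def of_nat_eq
    by (intro entire_add entire_mult entire_const entire_lin entire_deriv g(1))
  have g2: "entire absv g2" unfolding g2_def of_nat_eq
    by (intro entire_add entire_diff entire_mult entire_const entire_lin entire_deriv g1)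
  have Lm: "?L * (of_nat k * ?L ^ (k - 1)) = of_nat k * ?L ^ k" for k :: nat
    by (cases k) auto
  have d1: "?L * fps_deriv (?L ^ m * h) = ?L ^ m * (of_nat m * h + ?L * fps_deriv h)" for h
  proof -
    have "?L * fps_deriv (?L ^ m * h) = (?L * (of_nat m * ?L ^ (m - 1))) * h + ?L ^ m * (?L * fps_deriv h)"
      by (simp add: fps_deriv_power algebra_simps of_nat_eq)
    then show ?thesis unfolding Lm by (simp add: algebra_simps)
  qed
  have f1: "?L * fps_deriv f = ?L ^ m * g1"
    unfolding g(2) g1_def by (rule d1)
  have "?L * fps_deriv (?L * fps_deriv f) = ?L * ?L * fps_deriv (fps_deriv f) + ?L * fps_deriv f"
    by (simp add: distrib_left mult.assoc)
  then have "?L * ?L * fps_deriv (fps_deriv f) = ?L * fps_deriv (?L * fps_deriv f) - ?L * fps_deriv f"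
    by (simp only: add_diff_cancel_right')
  also have "\<dots> = ?L ^ m * (of_nat m * g1 + ?L * fps_deriv g1) - ?L ^ m * g1"
    unfolding f1 d1 ..
  finally have f2: "?L * ?L * fps_deriv (fps_deriv f) = ?L ^ m * g2"
    by (simp only: g2_def right_diff_distrib)
  have "0 = ?L * ?L * (f * fps_deriv (fps_deriv f) - 2 * fps_deriv f ^ 2)" by (simp only: D mult_zero_right)
  also have "\<dots> = f * (?L * ?L * fps_deriv (fps_deriv f)) - 2 * (?L * fps_deriv f) * (?L * fps_deriv f)"
    by (simp add: algebra_simps power2_eq_square)
  also have "\<dots> = (?L ^ m * ?L ^ m) * (g * g2 - 2 * (g1 * g1))"
    unfolding f1 f2 by (subst g(2)) (simp add: algebra_simps)
  finally have "g * g2 - 2 * (g1 * g1) = 0" by simp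
  then have "g * g2 = g1 * g1 + g1 * g1" by simp
  then have "entire_eval absv (g * g2) z = entire_eval absv (g1 * g1 + g1 * g1) z" by simp
  then have ev: "entire_eval absv g z * entire_eval absv g2 z = 2 * entire_eval absv g1 z ^ 2"
    by (simp only: eval_add eval_mult entire_mult g(1) g1 g2 power2_eq_square mult_2 distrib_right)
  have e1: "entire_eval absv g1 z = of_nat m * entire_eval absv g z"
    by (simp add: g1_def of_nat_eq eval_add eval_mult entire_mult entire_deriv g(1))
  have e2: "entire_eval absv g2 z = of_nat m * entire_eval absv g1 z - entire_eval absv g1 z"
    by (simp add: g2_def of_nat_eq eval_add eval_diff eval_mult entire_add entire_mult entire_deriv g1)
  have "entire_eval absv g z ^ 2 * (of_nat m * (of_nat m + 1)) = 0"
    using ev unfolding e2 e1 by (simp add: algebra_simps power2_eq_square)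
  then have "of_nat m * (of_nat m + 1 :: 'a) = 0" using g(3) by simp
  then show False using m by (metis mult_eq_0_iff of_nat_0_eq_iff of_nat_Suc add.commute nat.distinct(2))
qed

text \<open>Eliminating a from the two equations puts x among the zeros of the discriminant, and the
  first equation recovers a = x + f(x) / f'(x).\<close>

lemma countable_degenerate_parameters:
  assumes f: "entire absv f" "f \<noteq> 0" and z: "entire_eval absv f z = 0"
  shows "countable {a. \<exists>x. entire_eval absv f x \<noteq> 0 \<and> entire_eval absv (fps_deriv (f * lin a)) x = 0 \<and>
    entire_eval absv (fps_deriv (fps_deriv (f * lin a))) x = 0}" (is "countable ?S")
proof -
  define D where "D = f * fps_deriv (fps_deriv f) - 2 * fps_deriv f ^ 2"
  have two: "(2 :: 'a fps) = fps_const 2" by (simp add: numeral_fps_const)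
  have D: "entire absv D" "D \<noteq> 0"
    unfolding D_def using degenerate_discriminant_nonzero[OF assms]
    by (auto simp: two intro!: entire_diff entire_mult entire_power entire_deriv f(1))
  have "?S \<subseteq> (\<lambda>x. x + entire_eval absv f x / entire_eval absv (fps_deriv f) x) ` {x. entire_eval absv D x = 0}"
  proof
    fix a assume "a \<in> ?S"
    then obtain x where x: "entire_eval absv f x \<noteq> 0" "entire_eval absv (fps_deriv (f * lin a)) x = 0"
      "entire_eval absv (fps_deriv (fps_deriv (f * lin a))) x = 0" by blast
    let ?f = "entire_eval absv f x" and ?f1 = "entire_eval absv (fps_deriv f) x"
      and ?f2 = "entire_eval absv (fps_deriv (fps_deriv f)) x"
    have e1: "?f1 * (x - a) + ?f = 0"
      using x(2) unfolding deriv_mult_lin by (simp add: eval_add eval_mult entire_mult entire_deriv f(1))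
    have "fps_deriv (fps_deriv (f * lin a)) = fps_deriv (fps_deriv f) * lin a + fps_deriv f + fps_deriv f"
      unfolding deriv_mult_lin by (simp add: add.commute)
    then have e2: "?f2 * (x - a) + ?f1 + ?f1 = 0"
      using x(3) by (simp only: eval_add eval_mult entire_add entire_mult entire_deriv f(1) entire_lin eval_lin)
    have "?f1 \<noteq> 0" using e1 x(1) by auto
    then have a: "a = x + ?f / ?f1" using e1 by (simp add: field_simps)
    have "?f2 * (?f1 * (x - a)) + 2 * ?f1 * ?f1 = ?f1 * (?f2 * (x - a) + ?f1 + ?f1)" by (simp add: algebra_simps)
    also have "\<dots> = 0" by (simp only: e2 mult_zero_right)
    finally have "?f2 * (- ?f) + 2 * ?f1 * ?f1 = 0" using e1 by (simp add: add_eq_0_iff2)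
    then have "entire_eval absv D x = 0"
      unfolding D_def two
      by (simp add: eval_diff eval_mult eval_power entire_mult entire_power entire_deriv f(1) power2_eq_square algebra_simps)
    then show "a \<in> (\<lambda>x. x + entire_eval absv f x / entire_eval absv (fps_deriv f) x) ` {x. entire_eval absv D x = 0}"
      using a by blast
  qed
  then show ?thesis by (rule countable_subset) (intro countable_image countable_zeros D)
qed

section \<open>Decay of the logarithmic derivative\<close>

lemma gnorm_diff_const:
  assumes V: "entire absv V" and r: "0 \<le> r" and big: "absv c < gnorm V r"
  shows "gnorm V r \<le> gnorm (V - fps_const c) r"
proof -
  have "gnorm V r = gnorm ((V - fps_const c) + fps_const c) r" by simp
  also have "\<dots> \<le> max (gnorm (V - fps_const c) r) (absv c)"
    using gnorm_add_le[OF entire_diff[OF V entire_const[of c]] entire_const[of c] r] by (simp add: gnorm_const r)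
  finally show ?thesis using big by linarith
qed

text \<open>The logarithmic derivative of \<open>f * lin a\<close> is o(r^-2) in Gauss norm, with
  the quotient multiplied out.\<close>

definition flat_parameter :: "'a fps \<Rightarrow> 'a \<Rightarrow> bool" where
  "flat_parameter f a \<longleftrightarrow> (\<forall>\<epsilon>>0. \<exists>R. \<forall>r\<ge>R.
     gnorm (fps_deriv (f * lin a)) r * r ^ 2 \<le> \<epsilon> * gnorm (f * lin a) r)"

lemma flat_parameter_unique:
  assumes f: "entire absv f" "f \<noteq> 0" and a: "flat_parameter f a" and b: "flat_parameter f b"
  shows "a = b"
proof (rule ccontr)
  assume "a \<noteq> b"
  then have ab: "0 < absv (a - b)" by (intro absv_pos) simp
  define \<epsilon> where "\<epsilon> = absv (a - b) / 2"
  have \<epsilon>: "0 < \<epsilon>" using ab by (simp add: \<epsilon>_def)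
  obtain R1 where R1: "\<And>r. R1 \<le> r \<Longrightarrow> gnorm (fps_deriv (f * lin a)) r * r ^ 2 \<le> \<epsilon> * gnorm (f * lin a) r"
    using a \<epsilon> unfolding flat_parameter_def by blast
  obtain R2 where R2: "\<And>r. R2 \<le> r \<Longrightarrow> gnorm (fps_deriv (f * lin b)) r * r ^ 2 \<le> \<epsilon> * gnorm (f * lin b) r"
    using b \<epsilon> unfolding flat_parameter_def by blast
  define r where "r = max (max R1 R2) (max 1 (max (absv a) (absv b)))"
  have r: "R1 \<le> r" "R2 \<le> r" "0 < r" "absv a \<le> r" "absv b \<le> r" by (auto simp: r_def)
  have norm: "gnorm (f * lin c) r = gnorm f r * r" if "absv c \<le> r" for c
    using that r by (simp add: gnorm_mult gnorm_lin f)
  have small: "gnorm (fps_deriv (f * lin c)) r * r \<le> \<epsilon> * gnorm f r"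
    if "gnorm (fps_deriv (f * lin c)) r * r ^ 2 \<le> \<epsilon> * gnorm (f * lin c) r" "absv c \<le> r" for c
  proof -
    have "(gnorm (fps_deriv (f * lin c)) r * r) * r \<le> (\<epsilon> * gnorm f r) * r"
      using that(1) unfolding norm[OF that(2)] by (simp add: power2_eq_square mult.assoc)
    then show ?thesis using r by simp
  qed
  \<comment> \<open>The difference (a - b) / ((X - a) (X - b)) of the logarithmic derivatives,
    multiplied by \<open>f * lin a * lin b\<close>.\<close>
  have eq: "fps_const (a - b) * f = fps_deriv (f * lin a) * lin b - fps_deriv (f * lin b) * lin a"
    unfolding deriv_mult_lin by (simp add: algebra_simps flip: fps_const_sub)
  have e: "entire absv (fps_deriv (f * lin c) * lin d)" for c d
    by (intro entire_mult entire_deriv f entire_lin)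
  have "absv (a - b) * gnorm f r = gnorm (fps_const (a - b) * f) r"
    using r by (simp add: gnorm_mult gnorm_const f)
  also have "\<dots> \<le> max (gnorm (fps_deriv (f * lin a) * lin b) r) (gnorm (fps_deriv (f * lin b) * lin a) r)"
    unfolding eq using r by (intro gnorm_diff_le e) auto
  also have "\<dots> \<le> \<epsilon> * gnorm f r"
    unfolding gnorm_mult[OF entire_deriv[OF entire_mult[OF f(1) entire_lin]] entire_lin r(3)]
      gnorm_lin[OF r(4)] gnorm_lin[OF r(5)]
    by (intro max.boundedI small R1 R2 r)
  finally have "absv (a - b) \<le> \<epsilon>" using gnorm_pos[OF f(1) r(3) f(2)] by simp
  then show False using ab by (simp add: \<epsilon>_def)
qed

text \<open>
  If every critical point of \<open>U\<close> is a zero of \<open>U\<close>, then the logarithmic derivative \<open>U'/U\<close> has only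
  poles, so with two distinct zeros \<open>c0\<close> and \<open>c1\<close> it decays at least like \<open>1 / z^2\<close>.
\<close>

lemma critical_points_zeros_factor:
  assumes U: "entire absv U" "U \<noteq> 0" "fps_deriv U \<noteq> 0"
    and crit: "\<And>w. entire_eval absv (fps_deriv U) w = 0 \<Longrightarrow> entire_eval absv U w = 0"
    and c: "entire_eval absv U c0 = 0" "entire_eval absv U c1 = 0" "c0 \<noteq> c1"
  obtains E where "entire absv E" "E \<noteq> 0" "U = (lin c0 * lin c1 * fps_deriv U) * E"
proof -
  define U' where "U' = fps_deriv U"
  have U': "entire absv U'" "U' \<noteq> 0" unfolding U'_def using U by (auto intro: entire_deriv)
  have "\<exists>a b. entire absv a \<and> entire absv b \<and> entire_eval absv b w \<noteq> 0 \<and> U * b = (lin c0 * lin c1 * U') * a" for w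
  proof (cases "entire_eval absv U w = 0")
    case False
    then have "w \<noteq> c0" "w \<noteq> c1" "entire_eval absv U' w \<noteq> 0" using c crit by (auto simp: U'_def)
    then have "entire_eval absv (lin c0 * lin c1 * U') w \<noteq> 0"
      by (simp add: eval_mult entire_mult U'(1))
    moreover have "entire absv (lin c0 * lin c1 * U')" by (intro entire_mult entire_lin U'(1))
    ultimately show ?thesis using U(1) by (intro exI[of _ U] exI[of _ "lin c0 * lin c1 * U'"]) (simp add: mult.commute)
  next
    case True
    obtain m g where g: "entire absv g" "U = lin w ^ m * g" "entire_eval absv g w \<noteq> 0"
      by (rule order_factor[OF U(1,2)])
    have "m \<noteq> 0" using True g by (cases m) auto
    then obtain n where n: "m = Suc n" by (cases m) auto
    \<comment> \<open>k(w) = m g(w) is nonzero in characteristic 0, so U' has order exactly m - 1 at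
      w.\<close>
    define k where "k = fps_const (of_nat m) * g + lin w * fps_deriv g"
    have k: "entire absv k" unfolding k_def by (intro entire_add entire_mult entire_const entire_lin entire_deriv g(1))
    have kw: "entire_eval absv k w \<noteq> 0"
      using g(3) \<open>m \<noteq> 0\<close> by (simp add: k_def eval_add eval_mult entire_mult entire_deriv g(1))
    have "fps_deriv (lin w ^ Suc n) = fps_const (of_nat (Suc n)) * lin w ^ n"
      using fps_deriv_power[of "lin w" "Suc n"] by (simp del: power_Suc of_nat_Suc)
    then have "U' = lin w ^ Suc n * fps_deriv g + fps_const (of_nat (Suc n)) * lin w ^ n * g"
      unfolding U'_def g(2) n fps_deriv_mult by simp
    then have U'_eq: "U' = lin w ^ n * k"
      unfolding k_def n by (simp only: power_Suc distrib_left mult_ac add.commute)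
    \<comment> \<open>The factor at w is left out. Since c0 and c1 differ, at most one is, and the
      surplus factor \<open>lin w\<close> of U over U' makes up for it.\<close>
    define h where "h c = (if c = w then 1 else lin c)" for c
    have h: "entire absv (h c)" "entire_eval absv (h c) w \<noteq> 0" for c by (auto simp: h_def)
    show ?thesis
    proof (cases "w = c0 \<or> w = c1")
      case True
      then have "lin c0 * lin c1 = h c0 * h c1 * lin w" using c(3) by (auto simp: h_def mult_ac)
      then have "U * (h c0 * h c1 * k) = (lin c0 * lin c1 * U') * g"
        by (simp add: g(2) U'_eq n mult_ac)
      then show ?thesis using h k kw g(1)
        by (intro exI[of _ g] exI[of _ "h c0 * h c1 * k"]) (auto simp: eval_mult entire_mult)
    next
      case False
      then have "lin c0 * lin c1 = h c0 * h c1" by (auto simp: h_def)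
      then have "U * (h c0 * h c1 * k) = (lin c0 * lin c1 * U') * (lin w * g)"
        by (simp add: g(2) U'_eq n mult_ac)
      then show ?thesis using h k kw g(1)
        by (intro exI[of _ "lin w * g"] exI[of _ "h c0 * h c1 * k"]) (auto simp: eval_mult entire_mult)
    qed
  qed
  moreover have "entire absv (lin c0 * lin c1 * U')" "lin c0 * lin c1 * U' \<noteq> 0"
    using U' by (auto intro!: entire_mult)
  ultimately obtain E where E: "entire absv E" "U = (lin c0 * lin c1 * U') * E"
    using entire_divide[OF U(1)] by metis
  then have "E \<noteq> 0" using U(2) by auto
  then show thesis using E that unfolding U'_def by blast
qed

text \<open>By \<open>eq\<close> the logarithmic derivative is V' / ((V - c0) (V - c1) H). In Gauss
  norm the numerator is at most |V| / r and the denominator at least a constant times |V|^2, while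
  \<open>nonaffine V\<close> gives |V| \<ge> v r^2; so the decay is even O(r^-3).\<close>

lemma flat_of_factor:
  assumes \<phi>: "entire absv \<phi>" and V: "entire absv V" "nonaffine V" and H: "entire absv H" "H \<noteq> 0"
    and eq: "\<phi> * fps_deriv V = (V - fps_const c0) * (V - fps_const c1) * fps_deriv \<phi> * H"
    and "0 < \<epsilon>"
  shows "\<exists>R. \<forall>r\<ge>R. gnorm (fps_deriv \<phi>) r * r ^ 2 \<le> \<epsilon> * gnorm \<phi> r"
proof -
  obtain n where n: "2 \<le> n" "fps_nth V n \<noteq> 0" using V(2) by (auto simp: nonaffine_def)
  define v where "v = absv (fps_nth V n)"
  have v: "0 < v" using n by (simp add: v_def absv_pos)
  define \<eta> where "\<eta> = gnorm H 1"
  have \<eta>: "0 < \<eta>" unfolding \<eta>_def by (rule gnorm_pos[OF H(1) _ H(2)]) simp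
  \<comment> \<open>The second entry lifts the norm of \<open>V\<close> above \<open>absv c0\<close>
    and \<open>absv c1\<close>; the third makes \<epsilon> \<eta> v r at least 1.\<close>
  define R where "R = max 1 (max ((max (absv c0) (absv c1) + 1) / v) (1 / (\<epsilon> * \<eta> * v)))"
  show ?thesis
  proof (intro exI allI impI)
    fix r assume "R \<le> r"
    then have r: "1 \<le> r" "(max (absv c0) (absv c1) + 1) / v \<le> r" "1 / (\<epsilon> * \<eta> * v) \<le> r" by (auto simp: R_def)
    define N where "N = gnorm V r"
    have rn: "r ^ 2 \<le> r ^ n" using r n by (intro power_increasing) auto
    have "v * r ^ 2 \<le> v * r ^ n" using rn v by (intro mult_left_mono) auto
    also have "\<dots> \<le> N" unfolding v_def N_def using r by (intro gnorm_upper V) auto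
    finally have N: "v * r ^ 2 \<le> N" .
    have "v * r \<le> v * r ^ 2" using r v by (simp add: power2_eq_square)
    moreover have "max (absv c0) (absv c1) + 1 \<le> v * r" using r(2) v by (simp add: divide_le_eq mult.commute)
    ultimately have big: "absv c0 < N" "absv c1 < N" using N by linarith+
    then have Npos: "0 < N" using absv_nonneg[of c0] by linarith
    have Vc: "N \<le> gnorm (V - fps_const c0) r" "N \<le> gnorm (V - fps_const c1) r"
      unfolding N_def using big r by (intro gnorm_diff_const V; simp add: N_def)+
    have H\<eta>: "\<eta> \<le> gnorm H r" unfolding \<eta>_def using r by (intro gnorm_mono H) auto
    let ?d = "gnorm (fps_deriv \<phi>) r"
    have d: "0 \<le> ?d" using r by (intro gnorm_nonneg entire_deriv \<phi>) auto
    have "N * N * ?d * \<eta> \<le> gnorm (V - fps_const c0) r * gnorm (V - fps_const c1) r * ?d * gnorm H r"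
      using Vc H\<eta> d \<eta> Npos by (intro mult_mono) auto
    also have "\<dots> = gnorm (\<phi> * fps_deriv V) r"
      unfolding eq using r by (simp add: gnorm_mult entire_mult entire_diff entire_deriv V \<phi> H)
    also have "\<dots> = gnorm \<phi> r * gnorm (fps_deriv V) r"
      using r by (simp add: gnorm_mult entire_deriv V \<phi>)
    also have "\<dots> \<le> gnorm \<phi> r * (N / r)"
      unfolding N_def using r by (intro mult_left_mono gnorm_deriv_le gnorm_nonneg V \<phi>) auto
    finally have "N * (N * ?d * \<eta> * r) \<le> N * gnorm \<phi> r"
      using r by (simp add: field_simps)
    then have 1: "N * (?d * \<eta> * r) \<le> gnorm \<phi> r" using Npos by (simp add: mult_ac)
    have "v * r ^ 2 * (?d * \<eta> * r) \<le> N * (?d * \<eta> * r)"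
      using N d \<eta> r by (intro mult_right_mono) auto
    then have 2: "(?d * r ^ 2) * (\<eta> * v * r) \<le> gnorm \<phi> r" using 1 by (simp add: mult_ac)
    have "1 \<le> \<epsilon> * (\<eta> * v * r)" using r(3) \<open>0 < \<epsilon>\<close> \<eta> v by (simp add: divide_le_eq mult_ac)
    then have "(?d * r ^ 2) * 1 \<le> (?d * r ^ 2) * (\<epsilon> * (\<eta> * v * r))"
      using d by (intro mult_left_mono) auto
    also have "\<dots> = \<epsilon> * ((?d * r ^ 2) * (\<eta> * v * r))" by (simp only: mult_ac)
    also have "\<dots> \<le> \<epsilon> * gnorm \<phi> r" using 2 \<open>0 < \<epsilon>\<close> by (intro mult_left_mono) auto
    finally show "?d * r ^ 2 \<le> \<epsilon> * gnorm \<phi> r" by simp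
  qed
qed

section \<open>Parameters of non-prime products\<close>

text \<open>\<open>xs\<close> lists the fibre of \<open>Q\<close> over a zero c1 of \<open>U\<close>
  other than c0 = Q(a); it misses \<open>a\<close>, so it consists of zeros of \<open>f\<close>. The
  point \<open>b\<close> is another element of the fibre over c0.\<close>

lemma composition_with_polynomial:
  assumes f: "entire absv f" "f \<notin> range fps_of_poly" and fa: "entire_eval absv f a \<noteq> 0"
    and U: "entire absv U" and V: "nonaffine (fps_of_poly Q)"
    and comp: "\<And>x. entire_eval absv (f * lin a) x = entire_eval absv U (poly Q x)"
  shows "\<exists>xs b. xs \<noteq> [] \<and> set xs \<subseteq> {x. entire_eval absv f x = 0} \<and> entire_eval absv f b = 0 \<and>
    poly (split_poly 1 xs) a = poly (split_poly 1 xs) b"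
proof -
  have \<phi>: "entire absv (f * lin a)" by (intro entire_mult f entire_lin)
  have val: "entire_eval absv (f * lin a) x = entire_eval absv f x * (x - a)" for x
    by (simp add: eval_mult f)
  have f_zero: "entire_eval absv f x = 0" if "entire_eval absv (f * lin a) x = 0" "x \<noteq> a" for x
    using that by (simp add: val)
  define c0 where "c0 = poly Q a"
  have Uc0: "entire_eval absv U c0 = 0" using comp[of a] by (simp add: val c0_def)
  obtain n where n: "2 \<le> n" "coeff Q n \<noteq> 0" using V by (auto simp: nonaffine_def)
  have degQ: "2 \<le> degree Q" using n le_degree[OF n(2)] by linarith
  \<comment> \<open>Otherwise \<open>U\<close> is a constant times a power of X - c0, and
    \<open>f * lin a\<close>, hence \<open>f\<close>, would be a polynomial.\<close>
  have "\<exists>c1. c1 \<noteq> c0 \<and> entire_eval absv U c1 = 0"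
  proof (rule ccontr)
    assume no: "\<not> ?thesis"
    obtain R where "U = fps_of_poly R"
    proof (cases "U = 0")
      case True
      then show thesis using that[of 0] by simp
    next
      case False
      obtain c m where "U = lin c0 ^ m * fps_const c"
        by (rule single_zero[OF U False, of c0]) (use no in blast)+
      moreover have "lin c0 = fps_of_poly [:- c0, 1:]" by (simp add: fps_of_poly_pCons)
      ultimately have "U = fps_of_poly ([:- c0, 1:] ^ m * [:c:])"
        by (simp only: fps_of_poly_mult fps_of_poly_power fps_of_poly_const)
      then show thesis using that by blast
    qed
    then have "f * lin a = fps_of_poly (pcompose R Q)"
      using comp by (intro entire_eqI \<phi>) (auto simp: poly_pcompose)
    moreover from this have "poly (pcompose R Q) a = 0" using val[of a] by (metis eval_fps_of_poly cancel_comm_monoid_add_class.diff_cancel mult_zero_right)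
    then obtain S where "pcompose R Q = [:- a, 1:] * S" by (metis poly_eq_0_iff_dvd dvdE)
    moreover have "lin a = fps_of_poly [:- a, 1:]" by (simp add: fps_of_poly_pCons)
    ultimately have "lin a * f = lin a * fps_of_poly S" by (simp only: fps_of_poly_mult mult.commute)
    then have "f = fps_of_poly S" by (simp only: mult_left_cancel[OF lin_nonzero])
    then show False using f(2) by blast
  qed
  then obtain c1 where c1: "c1 \<noteq> c0" "entire_eval absv U c1 = 0" by blast
  obtain l xs where xs: "Q - [:c1:] = split_poly l xs" using poly_splits by blast
  have "Q - [:c1:] \<noteq> 0" using degQ by auto
  then have l: "l \<noteq> 0" using xs by (auto simp: split_poly_def)
  have "xs \<noteq> []"
  proof
    assume "xs = []"
    then have "Q = [:l + c1:]" using xs by (simp add: split_poly_Nil diff_eq_eq)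
    then show False using degQ by simp
  qed
  have Q_eq: "poly Q x - c1 = l * poly (split_poly 1 xs) x" for x
    using arg_cong[OF xs, of "\<lambda>P. poly P x"] by (simp add: split_poly_def)
  have zeros: "set xs \<subseteq> {x. entire_eval absv f x = 0}"
  proof
    fix x assume "x \<in> set xs"
    then have Qx: "poly Q x = c1"
      using poly_split_poly_eq_0[of x xs l] arg_cong[OF xs, of "\<lambda>P. poly P x"] by simp
    then have "x \<noteq> a" using c1 by (auto simp: c0_def)
    then show "x \<in> {x. entire_eval absv f x = 0}" using f_zero comp[of x] Qx c1 by simp
  qed
  have "poly (Q - [:c0:]) a = 0" by (simp add: c0_def)
  then obtain Q1 where Q1: "Q - [:c0:] = [:- a, 1:] * Q1" by (metis poly_eq_0_iff_dvd dvdE)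
  have Q_eq2: "Q = [:c0:] + [:- a, 1:] * Q1" using Q1 by (simp add: diff_eq_eq add.commute)
  have "degree Q1 \<noteq> 0"
  proof
    assume "degree Q1 = 0"
    then obtain q where "Q1 = [:q:]" by (rule degree_eq_zeroE)
    then have "degree Q \<le> 1" unfolding Q_eq2 by (simp add: degree_pCons_le)
    then show False using degQ by simp
  qed
  then have "1 \<le> degree Q1" "coeff Q1 (degree Q1) \<noteq> 0" by auto
  then obtain b where b: "poly Q1 b = 0"
    using entire_surj[of "fps_of_poly Q1" "degree Q1" 0] by auto
  have Qb: "poly Q b = c0" by (subst Q_eq2) (simp add: b)
  \<comment> \<open>A double root would give Q'(a) = 0, so by the chain rule the derivative of
    \<open>f * lin a\<close> at \<open>a\<close>, which is f(a), would vanish.\<close>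
  have "b \<noteq> a"
  proof
    assume "b = a"
    have "entire_eval absv (fps_deriv (fps_of_poly Q)) a = entire_eval absv (fps_of_poly Q1) a"
    proof (rule deriv_expand)
      have "lin a = fps_of_poly [:- a, 1:]" by (simp add: fps_of_poly_pCons)
      then show "fps_of_poly Q = fps_const c0 + lin a * fps_of_poly Q1"
        by (subst Q_eq2) (simp only: fps_of_poly_add fps_of_poly_mult fps_of_poly_const)
    qed simp
    then have "entire_eval absv (fps_deriv (fps_of_poly Q)) a = 0" using b \<open>b = a\<close> by simp
    then have "entire_eval absv (fps_deriv (f * lin a)) a = 0"
      using eval_deriv_compose[OF U entire_fps_of_poly \<phi>, of Q a] comp by simp
    then show False
      using fa unfolding deriv_mult_lin by (simp add: eval_add eval_mult entire_mult entire_deriv f(1))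
  qed
  then have "entire_eval absv f b = 0" using f_zero comp[of b] Qb Uc0 by simp
  moreover have "l * poly (split_poly 1 xs) a = l * poly (split_poly 1 xs) b"
    using Q_eq[of a] Q_eq[of b] Qb by (simp add: c0_def)
  ultimately show ?thesis using l zeros \<open>xs \<noteq> []\<close> by auto
qed

text \<open>A nonempty list gives a non-constant polynomial, so each of the countably many pairs
  (xs, b) admits finitely many a.\<close>

lemma countable_fibre_parameters:
  assumes "countable Z"
  shows "countable {a :: 'a. \<exists>xs b. xs \<noteq> [] \<and> set xs \<subseteq> Z \<and> b \<in> Z \<and>
    poly (split_poly 1 xs) a = poly (split_poly 1 xs) b}" (is "countable ?S")
proof -
  have "?S \<subseteq> (\<Union>xs\<in>lists Z - {[]}. \<Union>b\<in>Z. {a. poly (split_poly 1 xs - [:poly (split_poly 1 xs) b:]) a = 0})"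
    by auto
  moreover have "countable (\<Union>xs\<in>lists Z - {[]}. \<Union>b\<in>Z. {a. poly (split_poly 1 xs - [:poly (split_poly 1 xs) b:]) a = 0})"
  proof (intro countable_UN countable_Diff countable_lists assms countable_finite poly_roots_finite)
    fix xs b assume "xs \<in> lists Z - {[]}"
    then obtain z zs where xs: "xs = z # zs" by (cases xs) auto
    have "split_poly 1 zs \<noteq> (0 :: 'a poly)" by (auto simp: split_poly_def prod_list_zero_iff)
    then have "degree (split_poly 1 xs) = Suc (degree (split_poly 1 zs))"
      unfolding xs split_poly_Cons by (subst degree_mult_eq) auto
    then show "split_poly 1 xs - [:poly (split_poly 1 xs) b:] \<noteq> 0" by (metis degree_pCons_0 eq_iff_diff_eq_0 nat.distinct(1))
  qed
  ultimately show ?thesis by (rule countable_subset)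
qed

lemma composition_with_transcendental:
  assumes f: "entire absv f" "f \<noteq> 0" and fa: "entire_eval absv f a \<noteq> 0"
    and nondeg: "\<And>x. entire_eval absv f x \<noteq> 0 \<Longrightarrow> entire_eval absv (fps_deriv (f * lin a)) x = 0 \<Longrightarrow>
      entire_eval absv (fps_deriv (fps_deriv (f * lin a))) x \<noteq> 0"
    and distinct: "\<And>x y. x \<noteq> y \<Longrightarrow>
      entire_eval absv (fps_deriv (f * lin a)) x = 0 \<Longrightarrow> entire_eval absv (fps_deriv (f * lin a)) y = 0 \<Longrightarrow>
      entire_eval absv (fps_deriv (fps_deriv (f * lin a))) x \<noteq> 0 \<Longrightarrow>
      entire_eval absv (fps_deriv (fps_deriv (f * lin a))) y \<noteq> 0 \<Longrightarrow>
      entire_eval absv (f * lin a) x = entire_eval absv (f * lin a) y \<Longrightarrow> entire_eval absv (f * lin a) x = 0"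
    and U: "entire absv U" "nonaffine U" and V: "entire absv V" "V \<notin> range fps_of_poly" "nonaffine V"
    and comp: "\<And>x. entire_eval absv (f * lin a) x = entire_eval absv U (entire_eval absv V x)"
  shows "flat_parameter f a"
proof -
  define \<phi> where "\<phi> = f * lin a"
  define U' where "U' = fps_deriv U"
  have \<phi>: "entire absv \<phi>" unfolding \<phi>_def by (intro entire_mult f entire_lin)
  have U': "entire absv U'" unfolding U'_def by (intro entire_deriv U)
  have comp\<phi>: "entire_eval absv \<phi> x = entire_eval absv U (entire_eval absv V x)" for x
    using comp by (simp add: \<phi>_def)
  have val: "entire_eval absv \<phi> x = entire_eval absv f x * (x - a)" for x
    by (simp add: \<phi>_def eval_mult f)
  have chain: "entire_eval absv (fps_deriv \<phi>) x = entire_eval absv U' (entire_eval absv V x) * entire_eval absv (fps_deriv V) x" for x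
    unfolding U'_def by (rule eval_deriv_compose[OF U(1) V(1) \<phi> comp\<phi>])
  have crit: "entire_eval absv U w = 0" if w: "entire_eval absv U' w = 0" for w
  proof (rule ccontr)
    assume Uw: "entire_eval absv U w \<noteq> 0"
    obtain x y where xy: "x \<noteq> y" "entire_eval absv V x = w" "entire_eval absv V y = w"
      by (rule transcendental_two_preimages[OF V(1,2)])
    have nz: "entire_eval absv \<phi> x \<noteq> 0" "entire_eval absv \<phi> y \<noteq> 0" using Uw xy comp\<phi> by simp_all
    then have fnz: "entire_eval absv f x \<noteq> 0" "entire_eval absv f y \<noteq> 0" by (auto simp: val)
    have c: "entire_eval absv (fps_deriv \<phi>) x = 0" "entire_eval absv (fps_deriv \<phi>) y = 0"
      using chain xy w by simp_all
    have "entire_eval absv \<phi> x = 0"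
      using distinct[OF xy(1)] nondeg[OF fnz(1)] nondeg[OF fnz(2)] c xy comp\<phi> unfolding \<phi>_def by metis
    then show False using nz by simp
  qed
  define c0 where "c0 = entire_eval absv V a"
  have "entire_eval absv (fps_deriv \<phi>) a \<noteq> 0"
    using fa unfolding \<phi>_def deriv_mult_lin by (simp add: eval_add eval_mult entire_mult entire_deriv f(1))
  then have U'c0: "entire_eval absv U' c0 \<noteq> 0" using chain[of a] by (auto simp: c0_def)
  have Uc0: "entire_eval absv U c0 = 0" using comp\<phi>[of a] val[of a] by (simp add: c0_def)
  \<comment> \<open>c0 is a simple zero of \<open>U\<close>; were it the only one, the zero-free
    cofactor would be constant and \<open>U\<close> affine.\<close>
  have "\<exists>c1. c1 \<noteq> c0 \<and> entire_eval absv U c1 = 0"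
  proof (rule ccontr)
    assume no: "\<not> ?thesis"
    obtain U1 where U1: "entire absv U1" "U = lin c0 * U1" using entire_divide_root[OF U(1) Uc0] by blast
    have "entire_eval absv U1 c0 \<noteq> 0"
      using deriv_expand[OF U1(1), of U 0 c0] U1(2) U'c0 by (simp add: U'_def)
    moreover have "entire_eval absv U w = (w - c0) * entire_eval absv U1 w" for w
      unfolding U1(2) by (simp add: eval_mult U1(1))
    ultimately have "entire_eval absv U1 w \<noteq> 0" for w using no by fastforce
    then have U1c: "U1 = fps_const (fps_nth U1 0)" using zero_free_const[OF U1(1)] by blast
    have "fps_nth U n = 0" if "2 \<le> n" for n
      unfolding U1(2) by (subst U1c) (use that in auto)
    then show False using U(2) by (auto simp: nonaffine_def)
  qed
  then obtain c1 where c1: "c1 \<noteq> c0" "entire_eval absv U c1 = 0" by blast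
  have "U \<noteq> 0" using U(2) by (auto simp: nonaffine_def)
  moreover have "U' \<noteq> 0" using U'c0 by auto
  ultimately obtain E where E: "entire absv E" "E \<noteq> 0" "U = (lin c0 * lin c1 * U') * E"
    using critical_points_zeros_factor[OF U(1) _ _ crit Uc0 c1(2)] c1(1) unfolding U'_def by metis
  obtain H where H: "entire absv H" "\<And>x. entire_eval absv H x = entire_eval absv E (entire_eval absv V x)"
    using entire_compose[OF E(1) V(1)] by blast
  have "H \<noteq> 0"
  proof
    assume "H = 0"
    have "entire_eval absv E w = 0" for w
    proof -
      obtain x where "entire_eval absv V x = w" using transcendental_two_preimages[OF V(1,2)] by metis
      then show ?thesis using H(2)[of x] \<open>H = 0\<close> by simp
    qed
    then have "E = 0" using E(1) by (intro entire_eqI) auto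
    then show False using E(2) by simp
  qed
  \<comment> \<open>The factorization of \<open>U\<close> evaluated at V(x), multiplied by V'(x) and
    rewritten with the chain rule.\<close>
  have "\<phi> * fps_deriv V = (V - fps_const c0) * (V - fps_const c1) * fps_deriv \<phi> * H"
  proof (rule entire_eqI)
    fix x
    let ?v = "entire_eval absv V x"
    have "entire_eval absv U ?v = (?v - c0) * (?v - c1) * entire_eval absv U' ?v * entire_eval absv E ?v"
      by (subst E(3)) (simp add: eval_mult entire_mult U' E(1))
    then show "entire_eval absv (\<phi> * fps_deriv V) x
        = entire_eval absv ((V - fps_const c0) * (V - fps_const c1) * fps_deriv \<phi> * H) x"
      by (simp add: eval_mult eval_diff entire_mult entire_diff entire_deriv \<phi> V(1) H chain comp\<phi>)
  qed (intro entire_mult entire_diff entire_deriv entire_const \<phi> V(1) H(1))+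
  then show ?thesis
    unfolding flat_parameter_def \<phi>_def[symmetric]
    using flat_of_factor[OF \<phi> V(1,3) H(1) \<open>H \<noteq> 0\<close>] by blast
qed

theorem countable_nonprime_parameters:
  assumes f: "entire absv f" "f \<notin> range fps_of_poly"
  shows "countable {a. \<not> prime_meromorphic absv (fps_to_fls (f * lin a))}"
proof -
  have f_nz: "f \<noteq> 0"
  proof
    assume "f = 0"
    then have "f = fps_of_poly 0" by simp
    then show False using f(2) by blast
  qed
  \<comment> \<open>Outside \<open>Z\<close>, \<open>a\<close> is a simple zero of
    \<open>f * lin a\<close>.\<close>
  define Z where "Z = {x. entire_eval absv f x = 0}"
  define S2 where "S2 = {a. \<exists>x. entire_eval absv f x \<noteq> 0 \<and> entire_eval absv (fps_deriv (f * lin a)) x = 0 \<and>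
    entire_eval absv (fps_deriv (fps_deriv (f * lin a))) x = 0}"
  define T where "T = {(x, y, a). x \<noteq> y \<and>
    entire_eval absv (fps_deriv (f * lin a)) x = 0 \<and> entire_eval absv (fps_deriv (f * lin a)) y = 0 \<and>
    entire_eval absv (fps_deriv (fps_deriv (f * lin a))) x \<noteq> 0 \<and>
    entire_eval absv (fps_deriv (fps_deriv (f * lin a))) y \<noteq> 0 \<and>
    entire_eval absv (f * lin a) x = entire_eval absv (f * lin a) y \<and> entire_eval absv (f * lin a) x \<noteq> 0}"
  define S3 where "S3 = (\<lambda>(x, y, a). a) ` T"
  define S4 where "S4 = {a. \<exists>xs b. xs \<noteq> [] \<and> set xs \<subseteq> Z \<and> b \<in> Z \<and>
    poly (split_poly 1 xs) a = poly (split_poly 1 xs) b}"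
  define S5 where "S5 = {a. flat_parameter f a}"
  obtain z where z: "entire_eval absv f z = 0" using transcendental_two_preimages[OF f] by metis
  have Z: "countable Z" unfolding Z_def by (rule countable_zeros[OF f(1) f_nz])
  have S2: "countable S2" unfolding S2_def by (rule countable_degenerate_parameters[OF f(1) f_nz z])
  have S3: "countable S3" unfolding S3_def T_def
    by (intro countable_image countable_coincident_critical_values f)
  have S4: "countable S4" unfolding S4_def by (rule countable_fibre_parameters[OF Z])
  have S5: "countable S5"
  proof (cases "S5 = {}")
    case False
    then obtain b where "b \<in> S5" by blast
    then have "S5 \<subseteq> {b}"
      using flat_parameter_unique[OF f(1) f_nz] by (auto simp: S5_def)
    then show ?thesis by (rule countable_subset) simp
  qed simp
  have "a \<in> Z \<union> S2 \<union> S3 \<union> S4 \<union> S5" if np: "\<not> prime_meromorphic absv (fps_to_fls (f * lin a))" for a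
  proof (rule ccontr)
    assume "a \<notin> Z \<union> S2 \<union> S3 \<union> S4 \<union> S5"
    then have a: "a \<notin> Z" "a \<notin> S2" "a \<notin> S3" "a \<notin> S4" "\<not> flat_parameter f a" by (auto simp: S5_def)
    have fa: "entire_eval absv f a \<noteq> 0" using a(1) by (simp add: Z_def)
    have \<phi>: "entire absv (f * lin a)" by (intro entire_mult f entire_lin)
    have "f * lin a \<noteq> fps_const c" for c
    proof
      assume eq: "f * lin a = fps_const c"
      have val: "entire_eval absv f x * (x - a) = c" for x
        using arg_cong[OF eq, of "\<lambda>g. entire_eval absv g x"] by (simp add: eval_mult f(1))
      have "c = 0" using val[of a] by simp
      then show False using eq f_nz by simp
    qed
    moreover have "fps_to_fls (f * lin a) \<in> meromorphic_functions absv"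
    proof -
      have "fps_to_fls (f * lin a) = fps_to_fls (f * lin a) / fps_to_fls 1" by simp
      then show ?thesis unfolding meromorphic_functions_def using \<phi> entire_1 one_neq_zero by blast
    qed
    then obtain u v where uv: "u \<in> meromorphic_functions absv" "v \<in> meromorphic_functions absv"
      "is_composition absv (fps_to_fls (f * lin a)) u v" "\<not> linear_rational u" "\<not> linear_rational v"
      using np unfolding prime_meromorphic_def by blast
    ultimately obtain U V where UV: "entire absv U" "entire absv V" "nonaffine U" "nonaffine V"
      "\<And>x. entire_eval absv (f * lin a) x = entire_eval absv U (entire_eval absv V x)"
      using decomposition_entire[OF uv(1,4,2,5,3) \<phi>] by metis
    show False
    proof (cases "V \<in> range fps_of_poly")
      case True
      then obtain Q where Q: "V = fps_of_poly Q" by blast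
      have "a \<in> S4"
        using composition_with_polynomial[OF f fa UV(1), of Q] UV(4,5) unfolding S4_def Z_def Q by auto
      then show False using a by simp
    next
      case False
      have "flat_parameter f a"
      proof (rule composition_with_transcendental[OF f(1) f_nz fa _ _ UV(1,3,2) False UV(4,5)])
        show "entire_eval absv (fps_deriv (fps_deriv (f * lin a))) x \<noteq> 0"
          if "entire_eval absv f x \<noteq> 0" "entire_eval absv (fps_deriv (f * lin a)) x = 0" for x
          using a(2) that unfolding S2_def by blast
        show "entire_eval absv (f * lin a) x = 0"
          if "x \<noteq> y" "entire_eval absv (fps_deriv (f * lin a)) x = 0" "entire_eval absv (fps_deriv (f * lin a)) y = 0"
            "entire_eval absv (fps_deriv (fps_deriv (f * lin a))) x \<noteq> 0"
            "entire_eval absv (fps_deriv (fps_deriv (f * lin a))) y \<noteq> 0"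
            "entire_eval absv (f * lin a) x = entire_eval absv (f * lin a) y" for x y
        proof (rule ccontr)
          assume "entire_eval absv (f * lin a) x \<noteq> 0"
          then have "(x, y, a) \<in> T" using that unfolding T_def by blast
          then have "a \<in> S3" unfolding S3_def by force
          then show False using a by simp
        qed
      qed
      then show False using a by simp
    qed
  qed
  then have "{a. \<not> prime_meromorphic absv (fps_to_fls (f * lin a))} \<subseteq> Z \<union> S2 \<union> S3 \<union> S4 \<union> S5"
    by blast
  then show ?thesis by (rule countable_subset) (intro countable_Un Z S2 S3 S4 S5)
qed

end

theorem theorem2p17:
  fixes p :: nat
    and absv :: "'a::field_char_0 \<Rightarrow> real"
    and f :: "'a fps"
  assumes "padic_complex_field p absv"
    and "transcendental_entire absv f"
  shows "countable {a :: 'a. \<not> prime_meromorphic absv (fps_to_fls (f * (fps_X - fps_const a)))}"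
proof -
  interpret padic_complex_field p absv by fact
  show ?thesis
    using assms(2) countable_nonprime_parameters[of f] by (simp add: transcendental_entire_def)
qed

end
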